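(* Let $T>0$, $H_1\in(\tfrac12,\tfrac34]$ and $H_2\in(H_1,1)$. Let $h_T\in L_2(0,T)$ be the (unique) solution of the equation $(\Gamma_{H_1}+\Gamma_{H_2})h_T=\mathbf 1_{[0,T]}$. Then $h_T$ satisfies the following Fredholm integral equation of the second kind: $$h_T(u)+c(H_1,H_2)\int_0^T h_T(s)\,K(u,s)\,ds=g_T(u)\quad\text{for a.a. }u\in(0,T),$$ with $$c(H_1,H_2)=\frac{\Gamma(2-2H_1)\cos(\pi(1-H_1))\,H_2(2H_2-1)}{\pi H_1(2H_1-1)\,\Gamma^2(\frac32-H_1)},\qquad g_T(u)=\frac{u^{1/2-H_1}(T-u)^{1/2-H_1}}{2H_1\,B(\frac32-H_1,H_1+\frac12)},$$ and $$K(u,s)=\begin{cases} K_-(u,s), & 0<s<u<T, \\ K_+(u,s), & 0<u<s<T, \end{cases}$$ where $$K_-(u,s)=u^{H_1-\frac12}(T-u)^{\frac12-H_1}\rho(u,s)+(H_1-\tfrac12)\,u^{\frac12-H_1}\int_u^T\frac{u^{2H_1-1}\rho(u,s)-t^{2H_1-1}\rho(t,s)}{(t-u)^{H_1+\frac12}}\,dt,$$ and $$\begin{aligned} K_+(u,s)&=u^{H_1-\frac12}(s-u)^{\frac12-H_1}\psi(u,s)+(H_1-\tfrac12)\,u^{\frac12-H_1}\int_u^s\frac{u^{2H_1-1}\psi(u,s)-t^{2H_1-1}\psi(t,s)}{(t-u)^{H_1+\frac12}}\,dt \\ &\quad-(H_1-\tfrac12)\,u^{\frac12-H_1}\int_s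^T(t-u)^{-\frac12-H_1}t^{2H_1-1}\rho(t,s)\,dt.\end{aligned}$$
   Context: $\Gamma(\cdot)$ and $B(\cdot,\cdot)$ denote the gamma and beta functions. For $H\in(\tfrac12,1)$ the operator $\Gamma_H$ on $L_2(0,T)$ is $$(\Gamma_Hf)(t)=H(2H-1)\int_0^T\frac{f(s)}{|t-s|^{2-2H}}\,ds,\qquad t\in(0,T).$$ It is known (from earlier work) that for $H_1\in(\frac12,\frac34]$, $H_2\in(H_1,1)$ the equation $(\Gamma_{H_1}+\Gamma_{H_2})h_T=\mathbf 1_{[0,T]}$ has a unique solution $h_T\in L_2(0,T)$. The functions $\psi$ and $\rho$ are defined by $$\psi(u,s)=\frac{\partial}{\partial u}\left(\int_0^u(u-t)^{\frac12-H_1}t^{\frac12-H_1}(s-t)^{2H_2-2}\,dt\right),\quad 0<u<s<T,$$ $$\varphi(u,s)=\frac{\partial}{\partial u}\left(\int_s^u(u-t)^{\frac12-H_1}t^{\frac12-H_1}(t-s)^{2H_2-2}\,dt\right),\quad 0<s<u<T,$$ $$\tau(u,s)=\frac{\partial}{\partial u}\left(\int_0^s(u-t)^{\frac12-H_1}t^{\frac12-H_1}(s-t)^{2H_2-2}\,dt\right),\quad 0<s<u<T,$$ $$\rho(u,s)=\varphi(u,s)+\tau(u,s),\quad 0<s<u<T.$$ *)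

theory Defs
  imports "HOL-Analysis.Analysis"
begin

definition in_L2 :: "real \<Rightarrow> (real \<Rightarrow> real) \<Rightarrow> bool" where
  "in_L2 T f \<longleftrightarrow>
     set_borel_measurable lborel {0<..<T} f \<and>
     set_integrable lborel {0<..<T} (\<lambda>t. (f t)\<^sup>2)"

definition Gamma_op :: "real \<Rightarrow> real \<Rightarrow> (real \<Rightarrow> real) \<Rightarrow> real \<Rightarrow> real" where
  "Gamma_op T H f t =
     H * (2 * H - 1) * (LBINT s:{0<..<T}. f s / \<bar>t - s\<bar> powr (2 - 2 * H))"

text \<open>Elements of the space of square-integrable functions are represented by Borel
  functions, and the equation between its elements becomes equality almost everywhere.\<close>

definition is_solution :: "real \<Rightarrow> real \<Rightarrow> real \<Rightarrow> (real \<Rightarrow> real) \<Rightarrow> bool" where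
  "is_solution T H1 H2 h \<longleftrightarrow>
     in_L2 T h \<and>
     (AE t in lborel. t \<in> {0<..<T} \<longrightarrow>
        Gamma_op T H1 h t + Gamma_op T H2 h t = indicator {0..T} t)"

text \<open>\<open>psi\<close> is meant for \<open>0 < u < s\<close>; \<open>phi\<close>, \<open>tau\<close> and \<open>rho\<close> for \<open>0 < s < u\<close>.
  The derivative is always in the first argument, with \<open>s\<close> fixed.\<close>

definition psi :: "real \<Rightarrow> real \<Rightarrow> real \<Rightarrow> real \<Rightarrow> real" where
  "psi H1 H2 u s = deriv (\<lambda>v. LBINT t:{0<..<v}.
     (v - t) powr (1/2 - H1) * t powr (1/2 - H1) * (s - t) powr (2 * H2 - 2)) u"

definition phi :: "real \<Rightarrow> real \<Rightarrow> real \<Rightarrow> real \<Rightarrow> real" where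
  "phi H1 H2 u s = deriv (\<lambda>v. LBINT t:{s<..<v}.
     (v - t) powr (1/2 - H1) * t powr (1/2 - H1) * (t - s) powr (2 * H2 - 2)) u"

definition tau :: "real \<Rightarrow> real \<Rightarrow> real \<Rightarrow> real \<Rightarrow> real" where
  "tau H1 H2 u s = deriv (\<lambda>v. LBINT t:{0<..<s}.
     (v - t) powr (1/2 - H1) * t powr (1/2 - H1) * (s - t) powr (2 * H2 - 2)) u"

definition rho :: "real \<Rightarrow> real \<Rightarrow> real \<Rightarrow> real \<Rightarrow> real" where
  "rho H1 H2 u s = phi H1 H2 u s + tau H1 H2 u s"

definition c_const :: "real \<Rightarrow> real \<Rightarrow> real" where
  "c_const H1 H2 =
     Gamma (2 - 2 * H1) * cos (pi * (1 - H1)) * H2 * (2 * H2 - 1) /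
     (pi * H1 * (2 * H1 - 1) * (Gamma (3/2 - H1))\<^sup>2)"

definition g_fun :: "real \<Rightarrow> real \<Rightarrow> real \<Rightarrow> real" where
  "g_fun T H1 u =
     u powr (1/2 - H1) * (T - u) powr (1/2 - H1) / (2 * H1 * Beta (3/2 - H1) (H1 + 1/2))"

definition K_minus :: "real \<Rightarrow> real \<Rightarrow> real \<Rightarrow> real \<Rightarrow> real \<Rightarrow> real" where
  "K_minus T H1 H2 u s =
     u powr (H1 - 1/2) * (T - u) powr (1/2 - H1) * rho H1 H2 u s
     + (H1 - 1/2) * u powr (1/2 - H1) *
       (LBINT t:{u<..<T}.
          (u powr (2 * H1 - 1) * rho H1 H2 u s - t powr (2 * H1 - 1) * rho H1 H2 t s)
          / (t - u) powr (H1 + 1/2))"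

definition K_plus :: "real \<Rightarrow> real \<Rightarrow> real \<Rightarrow> real \<Rightarrow> real \<Rightarrow> real" where
  "K_plus T H1 H2 u s =
     u powr (H1 - 1/2) * (s - u) powr (1/2 - H1) * psi H1 H2 u s
     + (H1 - 1/2) * u powr (1/2 - H1) *
       (LBINT t:{u<..<s}.
          (u powr (2 * H1 - 1) * psi H1 H2 u s - t powr (2 * H1 - 1) * psi H1 H2 t s)
          / (t - u) powr (H1 + 1/2))
     - (H1 - 1/2) * u powr (1/2 - H1) *
       (LBINT t:{s<..<T}.
          (t - u) powr (- 1/2 - H1) * t powr (2 * H1 - 1) * rho H1 H2 t s)"

text \<open>The value on the null set \<open>s = u\<close> is an arbitrary choice.\<close>

definition K_kernel :: "real \<Rightarrow> real \<Rightarrow> real \<Rightarrow> real \<Rightarrow> real \<Rightarrow> real" where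
  "K_kernel T H1 H2 u s =
     (if s < u then K_minus T H1 H2 u s
      else if u < s then K_plus T H1 H2 u s
      else 0)"

end

theory Submission
  imports Defs
begin

text \<open>Write \<open>a = H1 - 1/2\<close> and \<open>b = H2 - 1/2\<close>, so that \<open>0 < a < b < 1/2\<close> and the operators have the Riesz
kernels \<open>|t - s|^(2a - 1)\<close> and \<open>|t - s|^(2b - 1)\<close>.  The equation is solved for the more singular of the
two.  That Riesz kernel factors (\<open>riesz_factorisation\<close>) as
\[ B(1 - 2a, a)\, |t - s|^{2a-1} = (ts)^a \int_0^{\min(s,t)} v^{-2a} (t - v)^{a-1} (s - v)^{a-1}\, dv, \]
that is, into a left Abel operator, a power weight and a right Abel operator.  Hence it is inverted by
two Abel inversions, and the theorem records what they do to the other term.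

First inversion: integrate the equation against \<open>(u - t)^(-a) t^(-a)\<close> over \<open>(0,u)\<close>.  The first kernel
becomes an integral over \<open>(0,u)\<close> by \<open>abel_of_riesz\<close>.  The second becomes
\<open>riesz_abel u s = \<integral> (u - t)^(-a) t^(-a) |t - s|^(2b - 1) dt\<close>, whose derivative in \<open>u\<close> is \<open>psi\<close> before the
diagonal (\<open>u < s\<close>) and \<open>rho\<close> behind it (\<open>s < u\<close>); see \<open>has_bochner_integral_theta\<close>.  Both sides are
integrals over \<open>(0,u)\<close> for every \<open>u\<close>, so the integrands agree almost everywhere (\<open>first_inversion\<close>).

Second inversion: integrate against \<open>(v - u)^(-a)\<close> over \<open>(u,T)\<close>.  On the solution this gives the
integral of \<open>s^a h(s)\<close> over \<open>(u,T)\<close>.  On the perturbation it gives a fractional integral, in the first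
variable, of \<open>theta(v,s)\<close>, which is \<open>v^(2a)\<close> times \<open>psi\<close> or \<open>rho\<close>; undoing it requires a fractional
derivative, and \<open>u^a K(u,s)\<close> is exactly its Marchaud form.  So the crux is
\[ \int_u^T w^a K(w,s)\, dw = \int_u^T (v - u)^{-a} \theta(v,s)\, dv \]
together with a bound on \<open>\<integral> |w^a K(w,s)| dw\<close> uniform in \<open>s\<close> (\<open>has_bochner_integral_K_kernel\<close>).

The crux is obtained without estimates on derivatives of \<open>theta\<close>.  For a monotone function the double
integral in the Marchaud derivative has an integrand of constant sign, and a shift of the kernel
evaluates it in closed form (\<open>monotone_double_integral\<close>).  Before the diagonal \<open>theta\<close> is increasing in the
first variable, behind it \<open>theta\<close> is a difference of decreasing functions, and on both sides it is
\<open>O(|v - s|^(b-1))\<close>, which stays integrable against \<open>|v - s|^(-a)\<close> because \<open>a < b\<close>.\<close>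

section \<open>Beta integrals, Fubini and uniqueness of densities\<close>

definition beta_weight :: "real \<Rightarrow> real \<Rightarrow> real \<Rightarrow> real" where
  "beta_weight x y t = indicator {0<..<1} t * (t powr (x - 1) * (1 - t) powr (y - 1))"

lemma beta_weight_measurable [measurable]: "beta_weight x y \<in> borel_measurable borel"
  unfolding beta_weight_def[abs_def] by measurable

lemma beta_weight_nonneg: "beta_weight x y t \<ge> 0"
  by (simp add: beta_weight_def)

lemma beta_weight_nonzero: "beta_weight x y t \<noteq> 0 \<Longrightarrow> 0 < t \<and> t < 1"
  by (auto simp: beta_weight_def indicator_def split: if_splits)

lemma has_bochner_integral_beta_weight:
  assumes "x > 0" "y > 0"
  shows "has_bochner_integral lborel (beta_weight x y) (Beta x y)"
proof -
  let ?B = "\<lambda>t::real. t powr (x - 1) * (1 - t) powr (y - 1)"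
  have set: "set_integrable lborel {0..1} ?B"
    by (rule integrable_Beta) (use assms in auto)
  have "(LBINT t:{0..1}. ?B t) = Beta x y"
    using set_borel_integral_eq_integral(2)[OF set] has_integral_Beta_real[OF assms]
    by (simp add: integral_unique)
  with set have "has_bochner_integral lborel (\<lambda>t. indicator {0..1} t * ?B t) (Beta x y)"
    by (simp add: has_bochner_integral_iff set_integrable_def set_lebesgue_integral_def)
  moreover have "(\<lambda>t. indicator {0..1} t * ?B t) = beta_weight x y"
    by (auto simp: fun_eq_iff indicator_def beta_weight_def)
  ultimately show ?thesis by simp
qed

text \<open>An affine change of variables that splits off the density of the beta distribution.  It is stated for
\<open>has_bochner_integral\<close> so that it transports integrability together with the value.\<close>

lemma beta_substitution:
  fixes g :: "real \<Rightarrow> real"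
  assumes "p < q"
  shows "has_bochner_integral lborel (\<lambda>t. indicator {p<..<q} t * ((t - p) powr (x - 1) * (q - t) powr (y - 1) * g t)) i
    \<longleftrightarrow> has_bochner_integral lborel (\<lambda>z. beta_weight x y z * ((q - p) powr (x + y - 1) * g (p + (q - p) * z))) i"
    (is "has_bochner_integral _ ?f i \<longleftrightarrow> has_bochner_integral _ ?g i")
proof -
  have eq: "?f (p + (q - p) * z) = inverse (q - p) * ?g z" for z
  proof -
    have "p + (q - p) * z < q \<longleftrightarrow> (q - p) * z < (q - p) * 1" by (simp add: algebra_simps)
    also have "\<dots> \<longleftrightarrow> z < 1" using assms by (intro mult_less_cancel_left_pos) simp
    finally have *: "p < p + (q - p) * z \<longleftrightarrow> 0 < z" "p + (q - p) * z < q \<longleftrightarrow> z < 1"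
      using assms by (auto simp: zero_less_mult_iff)
    have **: "q - (p + (q - p) * z) = (q - p) * (1 - z)" "p + (q - p) * z - p = (q - p) * z"
      by (simp_all add: algebra_simps)
    have "(q - p) powr (x - 1) * (q - p) powr (y - 1) = (q - p) powr (x + y - 1) * inverse (q - p)"
      using assms powr_add[of "q - p" "x - 1" "y - 1"] powr_diff[of "q - p" "x + y - 1" 1]
      by (simp add: divide_inverse algebra_simps)
    then have "0 < z \<and> z < 1 \<Longrightarrow> ?f (p + (q - p) * z) = inverse (q - p) * ?g z"
      unfolding ** using assms * by (simp add: beta_weight_def powr_mult mult_ac)
    then show ?thesis using * by (cases "0 < z \<and> z < 1") (auto simp: beta_weight_def indicator_def)
  qed
  have "i /\<^sub>R \<bar>q - p\<bar> = inverse (q - p) * i" using assms by simp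
  then have "has_bochner_integral lborel ?f i \<longleftrightarrow> has_bochner_integral lborel (\<lambda>z. inverse (q - p) * ?g z) (inverse (q - p) * i)"
    using assms by (subst lborel_has_bochner_integral_real_affine_iff[where c = "q - p" and t = p], simp) (simp only: eq)
  also have "\<dots> \<longleftrightarrow> has_bochner_integral lborel ?g i"
    using assms has_bochner_integral_mult_right[of "q - p" lborel "\<lambda>z. inverse (q - p) * ?g z" "inverse (q - p) * i"]
      has_bochner_integral_mult_right[of "inverse (q - p)" lborel ?g i]
    by (auto simp: mult.assoc[symmetric])
  finally show ?thesis .
qed

lemma integral_beta_substitution:
  fixes g :: "real \<Rightarrow> real"
  assumes "p < q"
  shows "(LBINT t. indicator {p<..<q} t * ((t - p) powr (x - 1) * (q - t) powr (y - 1) * g t))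
    = (LBINT z. beta_weight x y z * ((q - p) powr (x + y - 1) * g (p + (q - p) * z)))"
  using beta_substitution[OF assms, of x y g]
  by (metis (no_types, lifting) has_bochner_integral_iff not_integrable_integral_eq)

lemma has_bochner_integral_beta:
  fixes p q x y :: real
  assumes "p < q" "x > 0" "y > 0"
  shows "has_bochner_integral lborel
           (\<lambda>t. indicator {p<..<q} t * ((t - p) powr (x - 1) * (q - t) powr (y - 1)))
           ((q - p) powr (x + y - 1) * Beta x y)"
  using beta_substitution[OF assms(1), of x y "\<lambda>_. 1"]
    has_bochner_integral_mult_left[OF has_bochner_integral_beta_weight[OF assms(2,3)], of "(q - p) powr (x + y - 1)"]
  by (simp add: mult.commute)

lemma nn_integral_beta:
  fixes p q x y :: real
  assumes "p < q" "x > 0" "y > 0"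
  shows "(\<integral>\<^sup>+t. ennreal (indicator {p<..<q} t * ((t - p) powr (x - 1) * (q - t) powr (y - 1))) \<partial>lborel)
           = ennreal ((q - p) powr (x + y - 1) * Beta x y)"
  using has_bochner_integral_beta[OF assms]
  by (subst nn_integral_eq_integral) (auto simp: has_bochner_integral_iff)

lemma Beta_pos: "x > 0 \<Longrightarrow> y > 0 \<Longrightarrow> Beta x y > (0::real)"
  by (simp add: Beta_def Gamma_real_pos)

text \<open>A bound for \<open>k(_,s)\<close> in \<open>L1\<close> that is uniform in \<open>s\<close>, up to one exceptional value \<open>u\<close>: the estimates for \<open>theta\<close>
and \<open>K\<close> on \<open>(u,T)\<close> exclude \<open>s = u\<close>.\<close>

abbreviation column_bound :: "(real \<Rightarrow> real) \<Rightarrow> (real \<Rightarrow> real \<Rightarrow> real) \<Rightarrow> real \<Rightarrow> real \<Rightarrow> bool" where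
  "column_bound h k u C \<equiv>
     \<forall>s. h s \<noteq> 0 \<and> s \<noteq> u \<longrightarrow> integrable lborel (\<lambda>w. k w s) \<and> (LBINT w. \<bar>k w s\<bar>) \<le> C"

text \<open>A column bound makes \<open>h(s) k(w,s)\<close> jointly integrable.  The kernels met below are singular on the diagonal
and at end points, but all of them have column bounds, so every exchange of integrals involving the
solution is an instance of this lemma.\<close>

lemma kernel_fubini:
  fixes h :: "real \<Rightarrow> real" and k :: "real \<Rightarrow> real \<Rightarrow> real"
  assumes h: "integrable lborel h"
    and k [measurable]: "case_prod k \<in> borel_measurable (lborel \<Otimes>\<^sub>M lborel)"
    and bound: "column_bound h k u C"
  shows "integrable (lborel \<Otimes>\<^sub>M lborel) (\<lambda>(w, s). h s * k w s)"
    and "AE w in lborel. integrable lborel (\<lambda>s. h s * k w s)"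
    and "integrable lborel (\<lambda>w. \<integral>s. h s * k w s \<partial>lborel)"
    and "integrable lborel (\<lambda>s. h s * (LBINT w. k w s))"
    and "(LBINT w. (LBINT s. h s * k w s)) = (LBINT s. h s * (LBINT w. k w s))"
proof -
  have [measurable]: "h \<in> borel_measurable borel" using h by auto
  have "(\<integral>\<^sup>+s. \<integral>\<^sup>+w. ennreal \<bar>h s * k w s\<bar> \<partial>lborel \<partial>lborel) \<le> (\<integral>\<^sup>+s. ennreal \<bar>h s\<bar> * ennreal C \<partial>lborel)"
  proof (rule nn_integral_mono_AE)
    show "AE s in lborel. (\<integral>\<^sup>+w. ennreal \<bar>h s * k w s\<bar> \<partial>lborel) \<le> ennreal \<bar>h s\<bar> * ennreal C"
      using AE_lborel_singleton[of u]
    proof eventually_elim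
      case (elim s)
      have "(\<integral>\<^sup>+w. ennreal \<bar>h s * k w s\<bar> \<partial>lborel) = ennreal \<bar>h s\<bar> * (\<integral>\<^sup>+w. ennreal \<bar>k w s\<bar> \<partial>lborel)"
        by (simp add: abs_mult ennreal_mult nn_integral_cmult)
      then show ?case
        using elim bound[rule_format, of s]
        by (cases "h s = 0") (auto simp: nn_integral_eq_integral intro!: mult_left_mono ennreal_leI)
    qed
  qed
  also have "\<dots> = (\<integral>\<^sup>+s. ennreal \<bar>h s\<bar> \<partial>lborel) * ennreal C" by (simp add: nn_integral_multc)
  also have "\<dots> < \<infinity>"
    using h by (auto simp: integrable_iff_bounded ennreal_mult_less_top)
  finally have fin: "(\<integral>\<^sup>+s. \<integral>\<^sup>+w. ennreal \<bar>h s * k w s\<bar> \<partial>lborel \<partial>lborel) < \<infinity>" .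
  have "(\<integral>\<^sup>+z. ennreal (norm (case z of (w, s) \<Rightarrow> h s * k w s)) \<partial>(lborel \<Otimes>\<^sub>M lborel))
     = (\<integral>\<^sup>+s. \<integral>\<^sup>+w. ennreal \<bar>h s * k w s\<bar> \<partial>lborel \<partial>lborel)"
    using lborel_pair.nn_integral_snd[of "\<lambda>z. ennreal (norm (case z of (w, s) \<Rightarrow> h s * k w s))"]
    by (simp add: split_beta')
  with fin have int: "integrable (lborel \<Otimes>\<^sub>M lborel) (\<lambda>(w, s). h s * k w s)"
    by (auto simp: integrable_iff_bounded)
  show "integrable (lborel \<Otimes>\<^sub>M lborel) (\<lambda>(w, s). h s * k w s)" by (rule int)
  show "AE w in lborel. integrable lborel (\<lambda>s. h s * k w s)"
    by (rule lborel_pair.AE_integrable_fst[OF int])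
  show "integrable lborel (\<lambda>w. \<integral>s. h s * k w s \<partial>lborel)"
    by (rule lborel_pair.integrable_fst[OF int])
  show "integrable lborel (\<lambda>s. h s * (LBINT w. k w s))"
    using lborel_pair.integrable_snd[OF int] by simp
  show "(LBINT w. (LBINT s. h s * k w s)) = (LBINT s. h s * (LBINT w. k w s))"
    using lborel_pair.integral_fst[OF int] lborel_pair.integral_snd[OF int] by simp
qed

text \<open>The positive and the negative part of \<open>f\<close> are densities of finite measures that agree on all half-lines,
hence everywhere.  This is how an identity between indefinite integrals is differentiated.\<close>

lemma AE_zero_if_tail_integrals_zero:
  fixes f :: "real \<Rightarrow> real"
  assumes f: "integrable lborel f"
    and zero: "\<And>x. (LBINT w. indicator {x<..} w * f w) = 0"
  shows "AE w in lborel. f w = 0"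
proof -
  have [measurable]: "f \<in> borel_measurable borel" using f by auto
  define P N where "P = (\<lambda>w. max 0 (f w))" and "N = (\<lambda>w. max 0 (- f w))"
  have [measurable]: "P \<in> borel_measurable borel" "N \<in> borel_measurable borel"
    by (auto simp: P_def N_def)
  have PN: "integrable lborel P" "integrable lborel N"
    unfolding P_def N_def
    by (rule integrable_max[OF integrable_zero f], rule integrable_max[OF integrable_zero integrable_minus[OF f]])
  have tail: "integrable lborel (\<lambda>w. indicator {x<..} w * P w)" "integrable lborel (\<lambda>w. indicator {x<..} w * N w)" for x
    using integrable_mult_indicator[OF _ PN(1), of "{x<..}"] integrable_mult_indicator[OF _ PN(2), of "{x<..}"]
    by simp_all
  have em: "emeasure (density lborel (\<lambda>w. ennreal (g w))) {x<..} = ennreal (LBINT w. indicator {x<..} w * g w)"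
    if [measurable]: "integrable lborel g" and g0: "\<And>w. g w \<ge> 0" for g :: "real \<Rightarrow> real" and x
  proof -
    have [measurable]: "g \<in> borel_measurable borel" using that(1) by auto
    have "emeasure (density lborel (\<lambda>w. ennreal (g w))) {x<..} = (\<integral>\<^sup>+w. ennreal (indicator {x<..} w * g w) \<partial>lborel)"
      by (auto simp: emeasure_density indicator_def intro!: nn_integral_cong)
    also have "\<dots> = ennreal (LBINT w. indicator {x<..} w * g w)"
      using integrable_mult_indicator[OF _ that(1), of "{x<..}"] g0
      by (intro nn_integral_eq_integral) auto
    finally show ?thesis .
  qed
  have P0: "P w \<ge> 0" "N w \<ge> 0" for w by (auto simp: P_def N_def)
  note em = em[OF PN(1) P0(1)] em[OF PN(2) P0(2)]
  have "(LBINT w. indicator {x<..} w * P w) - (LBINT w. indicator {x<..} w * N w) = 0" for x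
  proof -
    have "(LBINT w. indicator {x<..} w * P w) - (LBINT w. indicator {x<..} w * N w)
        = (LBINT w. indicator {x<..} w * P w - indicator {x<..} w * N w)"
      using tail[of x] by (rule Bochner_Integration.integral_diff[symmetric])
    also have "\<dots> = (LBINT w. indicator {x<..} w * f w)"
      by (rule Bochner_Integration.integral_cong) (auto simp: P_def N_def max_def indicator_def)
    finally show ?thesis by (simp add: zero)
  qed
  then have "density lborel P = density lborel N"
    by (intro measure_eqI_lessThan) (auto simp: em)
  then have "AE w in lborel. ennreal (P w) = ennreal (N w)"
    by (intro sigma_finite_measure.density_unique[OF lborel.sigma_finite_measure_axioms]) auto
  then show ?thesis by eventually_elim (auto simp: P_def N_def max_def split: if_splits)
qed

text \<open>Dominated convergence of the difference quotients, which the mean value theorem bounds by \<open>C\<close>.  The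
weight carries the end point singularities, so that only \<open>F\<close> has to be smooth.\<close>

lemma has_real_derivative_weighted_integral:
  fixes w :: "real \<Rightarrow> real" and F f :: "real \<Rightarrow> real \<Rightarrow> real"
  assumes w: "integrable lborel w"
    and [measurable]: "\<And>u. F u \<in> borel_measurable borel" "f u \<in> borel_measurable borel"
    and F: "\<And>v. \<bar>v - u\<bar> < d \<Longrightarrow> integrable lborel (\<lambda>y. w y * F v y)"
    and "d > 0"
    and der: "\<And>v y. \<bar>v - u\<bar> < d \<Longrightarrow> w y \<noteq> 0 \<Longrightarrow> ((\<lambda>v. F v y) has_real_derivative f v y) (at v)"
    and bnd: "\<And>v y. \<bar>v - u\<bar> < d \<Longrightarrow> w y \<noteq> 0 \<Longrightarrow> \<bar>f v y\<bar> \<le> C"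
  shows "((\<lambda>v. \<integral>y. w y * F v y \<partial>lborel) has_real_derivative (LBINT y. w y * f u y)) (at u)"
proof -
  have [measurable]: "w \<in> borel_measurable borel" using w by auto
  have "((\<lambda>v. ((LBINT y. w y * F v y) - (LBINT y. w y * F u y)) / (v - u))
      \<longlongrightarrow> (LBINT y. w y * f u y)) (at u)"
  proof (subst tendsto_at_iff_sequentially, intro allI impI)
    fix X :: "nat \<Rightarrow> real"
    assume X: "\<forall>i. X i \<in> UNIV - {u}" and lim: "X \<longlonglongrightarrow> u"
    have "\<forall>\<^sub>F i in sequentially. \<bar>X i - u\<bar> < d"
      using tendstoD[OF lim \<open>d > 0\<close>] by (simp add: dist_real_def)
    then obtain n0 where n0: "\<And>i. i \<ge> n0 \<Longrightarrow> \<bar>X i - u\<bar> < d"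
      by (auto simp: eventually_sequentially)
    let ?Q = "\<lambda>i y. w y * ((F (X (i + n0)) y - F u y) / (X (i + n0) - u))"
    have "(\<lambda>i. \<integral>y. ?Q i y \<partial>lborel) \<longlonglongrightarrow> (LBINT y. w y * f u y)"
    proof (rule integral_dominated_convergence[where w = "\<lambda>y. C * \<bar>w y\<bar>"])
      show "AE y in lborel. (\<lambda>i. ?Q i y) \<longlonglongrightarrow> w y * f u y"
      proof (rule AE_I2)
        fix y
        show "(\<lambda>i. ?Q i y) \<longlonglongrightarrow> w y * f u y"
        proof (cases "w y = 0")
          case False
          have "((\<lambda>v. (F v y - F u y) / (v - u)) \<longlongrightarrow> f u y) (at u)"
            using der[of u y] False \<open>d > 0\<close> by (simp add: has_field_derivative_iff)
          then have "(\<lambda>i. (F (X i) y - F u y) / (X i - u)) \<longlonglongrightarrow> f u y"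
            using X lim by (simp add: tendsto_at_iff_sequentially comp_def)
          then show ?thesis by (intro tendsto_mult tendsto_const) (rule LIMSEQ_ignore_initial_segment)
        qed simp
      qed
      fix i
      show "AE y in lborel. norm (?Q i y) \<le> C * \<bar>w y\<bar>"
      proof (rule AE_I2)
        fix y
        show "norm (?Q i y) \<le> C * \<bar>w y\<bar>"
        proof (cases "w y = 0")
          case False
          have "norm (F (X (i + n0)) y - F u y) \<le> C * norm (X (i + n0) - u)"
          proof (rule field_differentiable_bound[where S = "{u - d<..<u + d}" and f' = "\<lambda>v. f v y"])
            show "((\<lambda>v. F v y) has_field_derivative f v y) (at v within {u - d<..<u + d})"
              if "v \<in> {u - d<..<u + d}" for v
              by (rule has_field_derivative_at_within[OF der]) (use that False in auto)
            show "norm (f v y) \<le> C" if "v \<in> {u - d<..<u + d}" for v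
              using that False bnd[of v y] by auto
          qed (use n0[of "i + n0"] \<open>d > 0\<close> in auto)
          then have "\<bar>(F (X (i + n0)) y - F u y) / (X (i + n0) - u)\<bar> \<le> C"
            using X by (auto simp: field_simps)
          then have "\<bar>w y\<bar> * \<bar>(F (X (i + n0)) y - F u y) / (X (i + n0) - u)\<bar> \<le> \<bar>w y\<bar> * C"
            by (rule mult_left_mono) simp
          then show ?thesis by (simp only: real_norm_def abs_mult mult.commute[of C])
        qed simp
      qed
    qed (use w in auto)
    moreover have "(LBINT y. ?Q i y) = ((LBINT y. w y * F (X (i + n0)) y) - (LBINT y. w y * F u y)) / (X (i + n0) - u)" for i
      using F[of "X (i + n0)"] F[of u] n0[of "i + n0"] \<open>d > 0\<close>
      by (subst Bochner_Integration.integral_diff[symmetric]) (auto simp: right_diff_distrib)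
    ultimately have "(\<lambda>i. ((LBINT y. w y * F (X (i + n0)) y) - (LBINT y. w y * F u y)) / (X (i + n0) - u)) \<longlonglongrightarrow> (LBINT y. w y * f u y)"
      by (simp only:)
    then show "((\<lambda>v. ((LBINT y. w y * F v y) - (LBINT y. w y * F u y)) / (v - u)) \<circ> X) \<longlonglongrightarrow> (LBINT y. w y * f u y)"
      unfolding comp_def by (rule LIMSEQ_offset)
  qed
  then show ?thesis by (simp add: has_field_derivative_iff)
qed

lemma has_bochner_integral_FTC_Ioo_nonneg:
  fixes F f :: "real \<Rightarrow> real"
  assumes [measurable]: "f \<in> borel_measurable borel" and "p \<le> q"
    and cont: "continuous_on {p..q} F"
    and der: "\<And>v. p < v \<Longrightarrow> v < q \<Longrightarrow> (F has_real_derivative f v) (at v)"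
    and f0: "\<And>v. p < v \<Longrightarrow> v < q \<Longrightarrow> f v \<ge> 0"
  shows "has_bochner_integral lborel (\<lambda>v. indicator {p<..<q} v * f v) (F q - F p)"
proof (rule has_bochner_integral_nn_integral)
  have hi: "(f has_integral (F q - F p)) {p..q}"
    by (rule fundamental_theorem_of_calculus_interior)
       (use assms in \<open>auto simp: has_real_derivative_iff_has_vector_derivative[symmetric]\<close>)
  have "(\<lambda>v. indicator {p<..<q} v * f v) = (\<lambda>v. if v \<in> {p<..<q} then f v else 0)"
    by (auto simp: indicator_def fun_eq_iff)
  then have hi': "((\<lambda>v. indicator {p<..<q} v * f v) has_integral (F q - F p)) UNIV"
    using hi by (simp only: has_integral_Icc_iff_Ioo has_integral_restrict_UNIV)
  show "(\<integral>\<^sup>+v. ennreal (indicator {p<..<q} v * f v) \<partial>lborel) = ennreal (F q - F p)"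
    by (intro nn_integral_has_integral_lborel hi') (use f0 in \<open>auto simp: indicator_def\<close>)
  show "0 \<le> F q - F p"
    by (rule has_integral_nonneg[OF hi']) (use f0 in \<open>auto simp: indicator_def\<close>)
qed (use f0 in \<open>auto simp: indicator_def\<close>)

text \<open>The fundamental theorem of calculus inside an integral, by Tonelli: the sign of \<open>f\<close> takes the place of an
integrability condition, so \<open>f\<close> may blow up as \<open>v\<close> approaches \<open>p\<close> or \<open>u\<close>.\<close>

lemma nn_integral_weighted_FTC:
  fixes w :: "real \<Rightarrow> real" and F f :: "real \<Rightarrow> real \<Rightarrow> real"
  assumes [measurable]: "w \<in> borel_measurable borel" "case_prod f \<in> borel_measurable (borel \<Otimes>\<^sub>M borel)"
    and "p \<le> u" and w0: "\<And>y. w y \<ge> 0"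
    and cont: "\<And>y. w y \<noteq> 0 \<Longrightarrow> continuous_on {p..u} (\<lambda>v. F v y)"
    and der: "\<And>v y. p < v \<Longrightarrow> v < u \<Longrightarrow> w y \<noteq> 0 \<Longrightarrow> ((\<lambda>v. F v y) has_real_derivative f v y) (at v)"
    and f0: "\<And>v y. p < v \<Longrightarrow> v < u \<Longrightarrow> w y \<noteq> 0 \<Longrightarrow> f v y \<ge> 0"
  shows "(\<integral>\<^sup>+v. indicator {p<..<u} v * (\<integral>\<^sup>+y. ennreal (w y * f v y) \<partial>lborel) \<partial>lborel)
       = (\<integral>\<^sup>+y. ennreal (w y * (F u y - F p y)) \<partial>lborel)"
proof -
  have "(\<integral>\<^sup>+v. indicator {p<..<u} v * (\<integral>\<^sup>+y. ennreal (w y * f v y) \<partial>lborel) \<partial>lborel)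
    = (\<integral>\<^sup>+v. (\<integral>\<^sup>+y. indicator {p<..<u} v * ennreal (w y * f v y) \<partial>lborel) \<partial>lborel)"
    by (simp add: nn_integral_cmult)
  also have "\<dots> = (\<integral>\<^sup>+y. (\<integral>\<^sup>+v. indicator {p<..<u} v * ennreal (w y * f v y) \<partial>lborel) \<partial>lborel)"
    by (rule lborel_pair.Fubini') measurable
  also have "\<dots> = (\<integral>\<^sup>+y. ennreal (w y * (F u y - F p y)) \<partial>lborel)"
  proof (rule nn_integral_cong)
    fix y
    show "(\<integral>\<^sup>+v. indicator {p<..<u} v * ennreal (w y * f v y) \<partial>lborel) = ennreal (w y * (F u y - F p y))"
    proof (cases "w y = 0")
      case False
      have "has_bochner_integral lborel (\<lambda>v. indicator {p<..<u} v * f v y) (F u y - F p y)"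
        by (rule has_bochner_integral_FTC_Ioo_nonneg) (use assms False in auto)
      then have "(\<integral>\<^sup>+v. ennreal (indicator {p<..<u} v * f v y) \<partial>lborel) = ennreal (F u y - F p y)"
        using f0 False by (subst nn_integral_eq_integral) (auto simp: has_bochner_integral_iff indicator_def)
      moreover have "(\<integral>\<^sup>+v. indicator {p<..<u} v * ennreal (w y * f v y) \<partial>lborel)
          = (\<integral>\<^sup>+v. ennreal (w y) * ennreal (indicator {p<..<u} v * f v y) \<partial>lborel)"
        by (rule nn_integral_cong) (use f0 False w0[of y] in \<open>auto simp: indicator_def ennreal_mult\<close>)
      ultimately show ?thesis using w0[of y] by (simp add: nn_integral_cmult ennreal_mult')
    qed simp
  qed
  finally show ?thesis .
qed

section \<open>Marchaud derivatives of monotone functions\<close>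

lemma regularised_kernel_integrals:
  fixes a e p q :: real
  assumes "0 < a" "0 < e" "p \<le> q"
  shows "has_bochner_integral lborel (\<lambda>t. indicator {p<..<q} t * (a * (t - p + e) powr (- a - 1)))
           (e powr - a - (q - p + e) powr - a)"
    and "has_bochner_integral lborel (\<lambda>w. indicator {p<..<q} w * (a * (q - w + e) powr (- a - 1)))
           (e powr - a - (q - p + e) powr - a)"
proof -
  have "has_bochner_integral lborel (\<lambda>t. indicator {p<..<q} t * (a * (t - p + e) powr (- a - 1)))
           (- ((q - p + e) powr - a) - - ((p - p + e) powr - a))"
    by (rule has_bochner_integral_FTC_Ioo_nonneg[where F = "\<lambda>t. - ((t - p + e) powr - a)"])
       (use assms in \<open>auto intro!: continuous_intros derivative_eq_intros\<close>)
  then show "has_bochner_integral lborel (\<lambda>t. indicator {p<..<q} t * (a * (t - p + e) powr (- a - 1)))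
           (e powr - a - (q - p + e) powr - a)" by simp
  have "has_bochner_integral lborel (\<lambda>w. indicator {p<..<q} w * (a * (q - w + e) powr (- a - 1)))
           ((q - q + e) powr - a - (q - p + e) powr - a)"
    by (rule has_bochner_integral_FTC_Ioo_nonneg[where F = "\<lambda>w. (q - w + e) powr - a"])
       (use assms in \<open>auto intro!: continuous_intros derivative_eq_intros\<close>)
  then show "has_bochner_integral lborel (\<lambda>w. indicator {p<..<q} w * (a * (q - w + e) powr (- a - 1)))
           (e powr - a - (q - p + e) powr - a)" by simp
qed

text \<open>After the shift by \<open>e\<close> the terms with \<open>g t\<close> and \<open>g w\<close> are integrable separately, and in the difference of
their integrals the term \<open>e powr - a\<close>, which diverges as \<open>e\<close> tends to \<open>0\<close>, cancels.\<close>

lemma regularised_double_integral: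
  fixes g :: "real \<Rightarrow> real" and a e p q :: real
  assumes "0 < a" "0 < e"
    and g: "integrable lborel (\<lambda>w. indicator {p<..<q} w * g w)"
  shows "has_bochner_integral (lborel \<Otimes>\<^sub>M lborel)
     (\<lambda>(w, t). indicator {p<..<q} w * indicator {w<..<q} t * (a * (g t - g w) * (t - w + e) powr (- a - 1)))
     (LBINT w. indicator {p<..<q} w * g w * ((q - w + e) powr - a - (w - p + e) powr - a))"
proof -
  let ?h = "\<lambda>w. indicator {p<..<q} w * g w"
  define k where "k w t = (if p < w \<and> w < t \<and> t < q then a * (t - w + e) powr (- a - 1) else 0)" for w t
  have k0: "\<bar>k w t\<bar> = k w t" for w t using assms by (auto simp: k_def)
  have k1: "has_bochner_integral lborel (\<lambda>w. k w t) (e powr - a - (t - p + e) powr - a)" if "p < t" "t < q" for t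
  proof -
    have "(\<lambda>w. k w t) = (\<lambda>w. indicator {p<..<t} w * (a * (t - w + e) powr (- a - 1)))"
      using that by (auto simp: k_def fun_eq_iff)
    then show ?thesis using regularised_kernel_integrals(2)[of a e p t] that assms by simp
  qed
  have k2: "has_bochner_integral lborel (\<lambda>t. k w t) (e powr - a - (q - w + e) powr - a)" if "p < w" "w < q" for w
  proof -
    have "(\<lambda>t. k w t) = (\<lambda>t. indicator {w<..<q} t * (a * (t - w + e) powr (- a - 1)))"
      using that by (auto simp: k_def fun_eq_iff)
    then show ?thesis using regularised_kernel_integrals(1)[of a e w q] that assms by simp
  qed
  have b1: "column_bound ?h k 0 (e powr - a)" and b2: "column_bound ?h (\<lambda>t w. k w t) 0 (e powr - a)"
    using k1 k2 by (auto simp: k0 has_bochner_integral_iff indicator_def)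
  have m1: "case_prod k \<in> borel_measurable (lborel \<Otimes>\<^sub>M lborel)"
    and m2: "(\<lambda>(t, w). k w t) \<in> borel_measurable (lborel \<Otimes>\<^sub>M lborel)"
    unfolding k_def[abs_def] by measurable
  note F1 = kernel_fubini[OF g m1 b1] and F2 = kernel_fubini[OF g m2 b2]
  note i1 = F1(1) and v1 = F1(5) and ih1 = F1(4) and i2' = F2(1) and v2 = F2(5) and ih2 = F2(4)
  have i2: "integrable (lborel \<Otimes>\<^sub>M lborel) (\<lambda>(w, t). ?h w * k w t)"
    using lborel_pair.integrable_product_swap[OF i2'] by (simp add: split_beta')
  have "has_bochner_integral (lborel \<Otimes>\<^sub>M lborel) (\<lambda>(w, t). ?h t * k w t - ?h w * k w t)
      ((LBINT t. ?h t * (LBINT w. k w t)) - (LBINT w. ?h w * (LBINT t. k w t)))"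
    using has_bochner_integral_diff[OF has_bochner_integral_integrable[OF i1] has_bochner_integral_integrable[OF i2]]
      lborel_pair.integral_fst[OF i1] lborel_pair.integral_snd[OF i2] v1 v2
      lborel_pair.integral_fst[OF i2] lborel_pair.integral_snd[OF i2'] lborel_pair.integral_fst[OF i2']
      lborel_pair.integral_snd[OF i1]
    by (simp add: split_beta')
  also have "(LBINT t. ?h t * (LBINT w. k w t)) - (LBINT w. ?h w * (LBINT t. k w t))
     = (LBINT w. ?h w * (LBINT t. k t w) - ?h w * (LBINT t. k w t))"
    by (rule Bochner_Integration.integral_diff[symmetric, OF ih1 ih2])
  also have "\<dots> = (LBINT w. indicator {p<..<q} w * g w * ((q - w + e) powr - a - (w - p + e) powr - a))"
    by (rule Bochner_Integration.integral_cong)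
       (auto simp: indicator_def right_diff_distrib has_bochner_integral_integral_eq[OF k1] has_bochner_integral_integral_eq[OF k2])
  also have "(\<lambda>(w, t). ?h t * k w t - ?h w * k w t) =
     (\<lambda>(w, t). indicator {p<..<q} w * indicator {w<..<q} t * (a * (g t - g w) * (t - w + e) powr (- a - 1)))"
    by (auto simp: fun_eq_iff k_def indicator_def algebra_simps)
  finally show ?thesis .
qed

text \<open>The limit \<open>e \<longlonglongrightarrow> 0\<close> of the previous lemma.  As \<open>g\<close> is increasing, the regularised integrands are
nonnegative and increase to the singular one, so monotone convergence yields both the absolute
convergence of the singular double integral and its value.\<close>

lemma monotone_double_integral:
  fixes g :: "real \<Rightarrow> real" and a p q :: real
  assumes a: "0 < a"
    and [measurable]: "g \<in> borel_measurable borel"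
    and mono: "\<And>w t. p < w \<Longrightarrow> w < t \<Longrightarrow> t < q \<Longrightarrow> g w \<le> g t"
    and gq: "integrable lborel (\<lambda>w. indicator {p<..<q} w * g w * (q - w) powr - a)"
    and gp: "integrable lborel (\<lambda>w. indicator {p<..<q} w * g w * (w - p) powr - a)"
  shows "has_bochner_integral (lborel \<Otimes>\<^sub>M lborel)
     (\<lambda>(w, t). indicator {p<..<q} w * indicator {w<..<q} t * (a * (g t - g w) * (t - w) powr (- a - 1)))
     ((LBINT w. indicator {p<..<q} w * g w * (q - w) powr - a)
      - (LBINT w. indicator {p<..<q} w * g w * (w - p) powr - a))"
proof -
  have g: "integrable lborel (\<lambda>w. indicator {p<..<q} w * g w)"
  proof (rule Bochner_Integration.integrable_bound)
    show "integrable lborel (\<lambda>w. (q - p) powr a * (indicator {p<..<q} w * g w * (q - w) powr - a))"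
      by (intro integrable_mult_right gq)
    show "AE w in lborel. norm (indicator {p<..<q} w * g w) \<le> norm ((q - p) powr a * (indicator {p<..<q} w * g w * (q - w) powr - a))"
    proof (rule AE_I2)
      fix w
      have "1 \<le> (q - p) powr a * (q - w) powr - a" if "p < w" "w < q"
      proof -
        have "(q - w) powr a \<le> (q - p) powr a" using that a by (intro powr_mono2) auto
        then show ?thesis using that by (simp add: powr_minus field_simps)
      qed
      then have "\<bar>g w\<bar> * 1 \<le> \<bar>g w\<bar> * ((q - p) powr a * (q - w) powr - a)" if "p < w" "w < q"
        using that by (intro mult_left_mono) auto
      then show "norm (indicator {p<..<q} w * g w) \<le> norm ((q - p) powr a * (indicator {p<..<q} w * g w * (q - w) powr - a))"
        by (auto simp: indicator_def abs_mult ac_simps)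
    qed
  qed auto
  define e :: "nat \<Rightarrow> real" where "e n = 1 / real (Suc n)" for n
  have e0: "e n > 0" for n by (simp add: e_def)
  have elim: "e \<longlonglongrightarrow> 0" unfolding e_def using LIMSEQ_inverse_real_of_nat by (simp add: inverse_eq_divide)
  have emono: "e n \<le> e m" if "m \<le> n" for m n using that by (simp add: e_def frac_le)
  note reg = regularised_double_integral[OF a e0 g]
  let ?f = "\<lambda>n (w, t). indicator {p<..<q} w * indicator {w<..<q} t * (a * (g t - g w) * (t - w + e n) powr (- a - 1))"
  let ?u = "\<lambda>(w, t). indicator {p<..<q} w * indicator {w<..<q} t * (a * (g t - g w) * (t - w) powr (- a - 1))"
  have lim: "(\<lambda>n. (x + e n) powr c) \<longlonglongrightarrow> x powr c" if "x > 0" for x c :: real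
    using tendsto_powr[OF tendsto_add[OF tendsto_const elim] tendsto_const, of x c] that by simp
  show ?thesis
  proof (rule has_bochner_integral_monotone_convergence)
    show "integrable (lborel \<Otimes>\<^sub>M lborel) (?f n)" for n
      using reg[of n] by (simp add: has_bochner_integral_iff)
    show "AE x in lborel \<Otimes>\<^sub>M lborel. mono (\<lambda>n. ?f n x)"
    proof (rule AE_I2, rule monoI)
      fix x :: "real \<times> real" and m n :: nat assume "m \<le> n"
      obtain w t where x: "x = (w, t)" by fastforce
      have "(t - w + e m) powr (- a - 1) \<le> (t - w + e n) powr (- a - 1)" if "w < t"
        using emono[OF \<open>m \<le> n\<close>] that a e0[of n] by (intro powr_mono2') auto
      then show "?f m x \<le> ?f n x"
        using mono[of w t] a unfolding x by (auto simp: indicator_def intro!: mult_left_mono)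
    qed
    show "AE x in lborel \<Otimes>\<^sub>M lborel. (\<lambda>n. ?f n x) \<longlonglongrightarrow> ?u x"
    proof (rule AE_I2)
      fix x :: "real \<times> real"
      obtain w t where x: "x = (w, t)" by fastforce
      show "(\<lambda>n. ?f n x) \<longlonglongrightarrow> ?u x"
        using lim[of "t - w"] unfolding x by (auto simp: indicator_def intro!: tendsto_mult)
    qed
    have "(\<lambda>n. (LBINT w. indicator {p<..<q} w * g w * ((q - w + e n) powr - a - (w - p + e n) powr - a)))
      \<longlonglongrightarrow> (LBINT w. indicator {p<..<q} w * g w * ((q - w) powr - a - (w - p) powr - a))"
    proof (rule integral_dominated_convergence[where
          w = "\<lambda>w. \<bar>indicator {p<..<q} w * g w * (q - w) powr - a\<bar> + \<bar>indicator {p<..<q} w * g w * (w - p) powr - a\<bar>"])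
      show "AE w in lborel. (\<lambda>n. indicator {p<..<q} w * g w * ((q - w + e n) powr - a - (w - p + e n) powr - a))
        \<longlonglongrightarrow> indicator {p<..<q} w * g w * ((q - w) powr - a - (w - p) powr - a)"
        by (rule AE_I2) (auto simp: indicator_def intro!: tendsto_mult tendsto_diff lim)
      fix n
      show "AE w in lborel. norm (indicator {p<..<q} w * g w * ((q - w + e n) powr - a - (w - p + e n) powr - a))
         \<le> \<bar>indicator {p<..<q} w * g w * (q - w) powr - a\<bar> + \<bar>indicator {p<..<q} w * g w * (w - p) powr - a\<bar>"
      proof (rule AE_I2)
        fix w
        have "\<bar>(q - w + e n) powr - a - (w - p + e n) powr - a\<bar> \<le> (q - w) powr - a + (w - p) powr - a"
          if "p < w" "w < q"
        proof -
          have "(q - w + e n) powr - a \<le> (q - w) powr - a" "(w - p + e n) powr - a \<le> (w - p) powr - a"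
            using that a e0[of n] by (intro powr_mono2'; simp)+
          then show ?thesis
            using powr_ge_zero[of "q - w + e n" "-a"] powr_ge_zero[of "w - p + e n" "-a"] by linarith
        qed
        from mult_left_mono[OF this, of "\<bar>g w\<bar>"]
        show "norm (indicator {p<..<q} w * g w * ((q - w + e n) powr - a - (w - p + e n) powr - a))
         \<le> \<bar>indicator {p<..<q} w * g w * (q - w) powr - a\<bar> + \<bar>indicator {p<..<q} w * g w * (w - p) powr - a\<bar>"
          by (auto simp: indicator_def abs_mult distrib_left)
      qed
    qed (use gp gq in auto)
    also have "(LBINT w. indicator {p<..<q} w * g w * ((q - w) powr - a - (w - p) powr - a))
      = (LBINT w. indicator {p<..<q} w * g w * (q - w) powr - a)
      - (LBINT w. indicator {p<..<q} w * g w * (w - p) powr - a)"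
      by (subst Bochner_Integration.integral_diff[OF gq gp, symmetric]) (simp add: algebra_simps)
    finally show "(\<lambda>n. integral\<^sup>L (lborel \<Otimes>\<^sub>M lborel) (?f n)) \<longlonglongrightarrow> \<dots>"
      using reg by (simp add: has_bochner_integral_iff)
    show "?u \<in> borel_measurable (lborel \<Otimes>\<^sub>M lborel)"
    proof -
      have "?u = (\<lambda>(w, t). if p < w \<and> w < t \<and> t < q then a * (g t - g w) * (t - w) powr (- a - 1) else 0)"
        by (auto simp: fun_eq_iff indicator_def)
      then show ?thesis by simp
    qed
  qed
qed

text \<open>Up to the factor \<open>1 / \<Gamma>(1 - a)\<close> this is the right-sided Marchaud fractional derivative of order \<open>a\<close> on an
interval that ends at \<open>q\<close>.\<close>

definition marchaud :: "real \<Rightarrow> real \<Rightarrow> (real \<Rightarrow> real) \<Rightarrow> real \<Rightarrow> real" where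
  "marchaud a q g w = (q - w) powr - a * g w
     + a * (LBINT t:{w<..<q}. (g w - g t) / (t - w) powr (a + 1))"

text \<open>The integral over \<open>(p,q)\<close> of a Marchaud derivative should be the right-sided fractional integral of
order \<open>1 - a\<close>, without its Gamma factor, taken at \<open>p\<close>.  The predicate says this, with absolute
convergence throughout.  The almost everywhere convergence of the inner integral is what makes the
notion stable under differences, and the explicit constant is what makes bounds uniform in parameters.\<close>

definition marchaud_regular :: "real \<Rightarrow> real \<Rightarrow> real \<Rightarrow> (real \<Rightarrow> real) \<Rightarrow> real \<Rightarrow> bool" where
  "marchaud_regular a p q g C \<longleftrightarrow> g \<in> borel_measurable borel \<and>
     (AE w in lborel. w \<in> {p<..<q} \<longrightarrow> set_integrable lborel {w<..<q} (\<lambda>t. (g w - g t) / (t - w) powr (a + 1))) \<and>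
     integrable lborel (\<lambda>w. indicator {p<..<q} w * g w * (w - p) powr - a) \<and>
     has_bochner_integral lborel (\<lambda>w. indicator {p<..<q} w * marchaud a q g w)
       (LBINT w. indicator {p<..<q} w * g w * (w - p) powr - a) \<and>
     (LBINT w. \<bar>indicator {p<..<q} w * marchaud a q g w\<bar>) \<le> C"

lemma borel_measurable_marchaud [measurable]:
  assumes [measurable]: "g \<in> borel_measurable borel"
  shows "marchaud a q g \<in> borel_measurable borel"
proof -
  have "marchaud a q g = (\<lambda>w. (q - w) powr - a * g w
     + a * (LBINT t. (if w < t \<and> t < q then (g w - g t) / (t - w) powr (a + 1) else 0)))"
    by (auto simp: marchaud_def fun_eq_iff set_lebesgue_integral_def indicator_def intro!: Bochner_Integration.integral_cong)
  then show ?thesis by simp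
qed

text \<open>Integrability against the power \<open>- a\<close> of the distance to either end point.  For a monotone function this
is what makes the integral of its Marchaud derivative converge.\<close>

definition edge_integrable :: "real \<Rightarrow> real \<Rightarrow> real \<Rightarrow> (real \<Rightarrow> real) \<Rightarrow> real \<Rightarrow> bool" where
  "edge_integrable a p q g C \<longleftrightarrow> g \<in> borel_measurable borel \<and>
     (\<forall>d \<in> {\<lambda>w. q - w, \<lambda>w. w - p}. integrable lborel (\<lambda>w. indicator {p<..<q} w * g w * d w powr - a) \<and>
        (LBINT w. \<bar>indicator {p<..<q} w * g w * d w powr - a\<bar>) \<le> C)"

text \<open>Integrating the definition of the Marchaud derivative over \<open>(p,q)\<close>, the boundary term produces the
weight \<open>(q - w) powr - a\<close>, and the double integral replaces it by \<open>(w - p) powr - a\<close>.\<close>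

lemma marchaud_regular_mono:
  fixes g :: "real \<Rightarrow> real" and a p q :: real
  assumes a: "0 < a" and edge: "edge_integrable a p q g C"
    and mono: "\<And>w t. p < w \<Longrightarrow> w < t \<Longrightarrow> t < q \<Longrightarrow> g w \<le> g t"
  shows "marchaud_regular a p q g (3 * C)"
proof -
  let ?f = "\<lambda>w t. indicator {p<..<q} w * indicator {w<..<q} t * (a * (g t - g w) * (t - w) powr (- a - 1))"
  let ?Q = "\<lambda>w. indicator {p<..<q} w * g w * (q - w) powr - a"
  let ?P = "\<lambda>w. indicator {p<..<q} w * g w * (w - p) powr - a"
  have g: "g \<in> borel_measurable borel" and gq: "integrable lborel ?Q" and gp: "integrable lborel ?P"
    and C: "(LBINT w. \<bar>?Q w\<bar>) \<le> C" "(LBINT w. \<bar>?P w\<bar>) \<le> C"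
    using edge by (auto simp: edge_integrable_def)
  note M = monotone_double_integral[OF a g mono gq gp]
  then have int: "integrable (lborel \<Otimes>\<^sub>M lborel) (case_prod ?f)"
    and val: "integral\<^sup>L (lborel \<Otimes>\<^sub>M lborel) (case_prod ?f) = integral\<^sup>L lborel ?Q - integral\<^sup>L lborel ?P"
    by (simp_all add: has_bochner_integral_iff)
  have feq: "?f w t = indicator {w<..<q} t *\<^sub>R ((- a) * ((g w - g t) / (t - w) powr (a + 1)))" if "p < w" "w < q" for w t
    using that a by (auto simp: indicator_def powr_minus field_simps powr_diff powr_add)
  have inner: "(LBINT t. ?f w t) = indicator {p<..<q} w * ((- a) * (LBINT t:{w<..<q}. (g w - g t) / (t - w) powr (a + 1)))" for w
  proof (cases "w \<in> {p<..<q}")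
    case True
    then have "(\<lambda>t. ?f w t) = (\<lambda>t. indicator {w<..<q} t *\<^sub>R ((- a) * ((g w - g t) / (t - w) powr (a + 1))))"
      using feq[of w] by auto
    then have "(LBINT t. ?f w t) = (LBINT t:{w<..<q}. (- a) * ((g w - g t) / (t - w) powr (a + 1)))"
      by (simp add: set_lebesgue_integral_def)
    with True show ?thesis by (simp only: set_integral_mult_right) simp
  qed simp
  have D: "indicator {p<..<q} w * marchaud a q g w = ?Q w - (LBINT t. ?f w t)" for w
    unfolding inner marchaud_def by (simp add: indicator_def)
  have pos: "(LBINT t. ?f w t) \<ge> 0" for w
    by (rule integral_nonneg_AE) (use mono a in \<open>auto simp: indicator_def\<close>)
  have AE: "AE w in lborel. w \<in> {p<..<q} \<longrightarrow> set_integrable lborel {w<..<q} (\<lambda>t. (g w - g t) / (t - w) powr (a + 1))"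
    using lborel_pair.AE_integrable_fst[OF int]
  proof eventually_elim
    case (elim w)
    show ?case
    proof
      assume w: "w \<in> {p<..<q}"
      then have "(\<lambda>t. ?f w t) = (\<lambda>t. indicator {w<..<q} t *\<^sub>R ((- a) * ((g w - g t) / (t - w) powr (a + 1))))"
        using feq[of w] by auto
      with elim have "set_integrable lborel {w<..<q} (\<lambda>t. (- a) * ((g w - g t) / (t - w) powr (a + 1)))"
        by (simp add: set_integrable_def)
      then show "set_integrable lborel {w<..<q} (\<lambda>t. (g w - g t) / (t - w) powr (a + 1))"
        using a by (subst (asm) set_integrable_mult_right_iff) auto
    qed
  qed
  note fI = lborel_pair.integrable_fst[OF int] lborel_pair.integral_fst[OF int]
  have "has_bochner_integral lborel (\<lambda>w. ?Q w - (LBINT t. ?f w t)) (integral\<^sup>L lborel ?Q - (integral\<^sup>L lborel ?Q - integral\<^sup>L lborel ?P))"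
    using has_bochner_integral_diff[OF has_bochner_integral_integrable[OF gq] has_bochner_integral_integrable[OF fI(1)]]
    by (simp only: fI(2) val)
  then have "has_bochner_integral lborel (\<lambda>w. indicator {p<..<q} w * marchaud a q g w) (integral\<^sup>L lborel ?P)"
    unfolding D by simp
  moreover have "(LBINT w. \<bar>indicator {p<..<q} w * marchaud a q g w\<bar>) \<le> 3 * C"
  proof -
    have "(LBINT w. \<bar>indicator {p<..<q} w * marchaud a q g w\<bar>) \<le> (LBINT w. \<bar>?Q w\<bar> + (LBINT t. ?f w t))"
      unfolding D using pos gq fI(1)
      by (intro integral_mono_AE AE_I2 Bochner_Integration.integrable_add integrable_abs Bochner_Integration.integrable_diff)
         (auto intro: order.trans[OF abs_triangle_ineq4])
    also have "\<dots> = (LBINT w. \<bar>?Q w\<bar>) + (integral\<^sup>L lborel ?Q - integral\<^sup>L lborel ?P)"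
      using gq fI val by (subst Bochner_Integration.integral_add) auto
    also have "\<dots> \<le> 3 * C"
      using C integral_abs_bound[of lborel ?Q] integral_abs_bound[of lborel ?P] by linarith
    finally show ?thesis .
  qed
  ultimately show ?thesis using AE gp g unfolding marchaud_regular_def by blast
qed

lemma marchaud_regular_diff:
  assumes "marchaud_regular a p q g C" "marchaud_regular a p q g' C'"
  shows "marchaud_regular a p q (\<lambda>w. g w - g' w) (C + C')"
proof -
  let ?D = "\<lambda>g w. indicator {p<..<q} w * marchaud a q g w"
  let ?P = "\<lambda>g w. indicator {p<..<q} w * g w * (w - p) powr - a"
  note r = assms[unfolded marchaud_regular_def]
  have A: "AE w in lborel. w \<in> {p<..<q} \<longrightarrow> set_integrable lborel {w<..<q} (\<lambda>t. (g w - g t) / (t - w) powr (a + 1))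
      \<and> set_integrable lborel {w<..<q} (\<lambda>t. (g' w - g' t) / (t - w) powr (a + 1))"
    using r by (auto elim: eventually_elim2)
  have eq: "(g w - g' w - (g t - g' t)) / (t - w) powr (a + 1)
      = (g w - g t) / (t - w) powr (a + 1) - (g' w - g' t) / (t - w) powr (a + 1)" for w t
    by (simp add: diff_divide_distrib)
  have AE: "AE w in lborel. w \<in> {p<..<q} \<longrightarrow> set_integrable lborel {w<..<q} (\<lambda>t. (g w - g' w - (g t - g' t)) / (t - w) powr (a + 1))"
    using A unfolding eq by eventually_elim (auto intro: set_integral_diff)
  have D: "AE w in lborel. ?D g w - ?D g' w = ?D (\<lambda>w. g w - g' w) w"
    using A unfolding marchaud_def eq
    by eventually_elim (auto simp: indicator_def algebra_simps set_integral_diff)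
  have [measurable]: "g \<in> borel_measurable borel" "g' \<in> borel_measurable borel" using r by auto
  have m [measurable]: "marchaud a q (\<lambda>w. g w - g' w) \<in> borel_measurable borel"
    by (intro borel_measurable_marchaud) measurable
  have P: "integrable lborel (?P (\<lambda>w. g w - g' w))"
    "integral\<^sup>L lborel (?P (\<lambda>w. g w - g' w)) = integral\<^sup>L lborel (?P g) - integral\<^sup>L lborel (?P g')"
    using r by (simp_all add: algebra_simps)
  have "has_bochner_integral lborel (\<lambda>w. ?D g w - ?D g' w) (integral\<^sup>L lborel (?P g) - integral\<^sup>L lborel (?P g'))"
    using r by (intro has_bochner_integral_diff) auto
  then have H: "has_bochner_integral lborel (?D (\<lambda>w. g w - g' w)) (integral\<^sup>L lborel (?P (\<lambda>w. g w - g' w)))"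
    unfolding P(2) by (rule has_bochner_integralI_AE[OF _ _ D]) measurable
  have I: "integrable lborel (?D g)" "integrable lborel (?D g')"
    using r by (auto simp: has_bochner_integral_iff)
  have "(LBINT w. \<bar>?D (\<lambda>w. g w - g' w) w\<bar>) \<le> (LBINT w. \<bar>?D g w\<bar> + \<bar>?D g' w\<bar>)"
  proof (rule integral_mono_AE)
    show "integrable lborel (\<lambda>w. \<bar>?D (\<lambda>w. g w - g' w) w\<bar>)"
      using H by (intro integrable_abs) (simp add: has_bochner_integral_iff)
    show "integrable lborel (\<lambda>w. \<bar>?D g w\<bar> + \<bar>?D g' w\<bar>)"
      using I by (intro Bochner_Integration.integrable_add integrable_abs)
    show "AE w in lborel. \<bar>?D (\<lambda>w. g w - g' w) w\<bar> \<le> \<bar>?D g w\<bar> + \<bar>?D g' w\<bar>"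
      using D by eventually_elim (metis abs_triangle_ineq4)
  qed
  also have "\<dots> = (LBINT w. \<bar>?D g w\<bar>) + (LBINT w. \<bar>?D g' w\<bar>)"
    using I by (intro Bochner_Integration.integral_add integrable_abs)
  also have "\<dots> \<le> C + C'" using r by (intro add_mono) auto
  finally show ?thesis using AE P(1) H unfolding marchaud_regular_def by simp
qed

lemma marchaud_regular_antimono:
  fixes g :: "real \<Rightarrow> real" and a p q :: real
  assumes a: "0 < a" and edge: "edge_integrable a p q g C"
    and mono: "\<And>w t. p < w \<Longrightarrow> w < t \<Longrightarrow> t < q \<Longrightarrow> g t \<le> g w"
  shows "marchaud_regular a p q g (3 * C)"
proof -
  have 0: "marchaud_regular a p q (\<lambda>_. 0) 0"
    by (auto simp: marchaud_regular_def marchaud_def set_integrable_def set_lebesgue_integral_def has_bochner_integral_iff)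
  have "marchaud_regular a p q (\<lambda>w. - g w) (3 * C)"
    using assms by (intro marchaud_regular_mono) (auto simp: edge_integrable_def)
  from marchaud_regular_diff[OF 0 this] show ?thesis by simp
qed

lemma marchaud_cong:
  assumes "\<And>t. w \<le> t \<Longrightarrow> t < q \<Longrightarrow> g t = g' t" "w < q"
  shows "marchaud a q g w = marchaud a q g' w"
  unfolding marchaud_def using assms
  by (auto intro!: set_lebesgue_integral_cong simp: set_lebesgue_integral_def indicator_def intro!: Bochner_Integration.integral_cong)

section \<open>Explicit densities for psi, phi and tau\<close>

lemma mult_less_bound:
  fixes v y s :: real
  assumes "0 \<le> v" "v \<le> s" "0 < s" "0 < y" "y < 1"
  shows "v * y < s"
proof -
  have "v * y \<le> s * y" using assms by (intro mult_right_mono) auto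
  also have "\<dots> < s * 1" using assms by (intro mult_strict_left_mono)
  finally show ?thesis by simp
qed

lemma integrable_mult_bounded:
  fixes w G :: "'a \<Rightarrow> real"
  assumes w: "integrable M w" and [measurable]: "G \<in> borel_measurable M"
    and "\<And>y. w y \<noteq> 0 \<Longrightarrow> \<bar>G y\<bar> \<le> C"
  shows "integrable M (\<lambda>y. w y * G y)"
proof (rule Bochner_Integration.integrable_bound)
  show "integrable M (\<lambda>y. w y * C)" using w by simp
  show "AE y in M. norm (w y * G y) \<le> norm (w y * C)"
  proof (rule AE_I2)
    fix y
    show "norm (w y * G y) \<le> norm (w y * C)"
      using assms(3)[of y] by (cases "w y = 0") (auto simp: abs_mult intro!: mult_left_mono)
  qed
qed (use w in auto)

text \<open>Integrability at the end point \<open>u\<close> turns \<open>nn_integral_weighted_FTC\<close> into a statement on convergent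
integrals.\<close>

lemma has_bochner_integral_weighted_FTC:
  fixes w :: "real \<Rightarrow> real" and F f :: "real \<Rightarrow> real \<Rightarrow> real"
  assumes [measurable]: "w \<in> borel_measurable borel" "case_prod f \<in> borel_measurable (borel \<Otimes>\<^sub>M borel)"
    and "p \<le> u" and w0: "\<And>y. w y \<ge> 0"
    and cont: "\<And>y. w y \<noteq> 0 \<Longrightarrow> continuous_on {p..u} (\<lambda>v. F v y)"
    and der: "\<And>v y. p < v \<Longrightarrow> v < u \<Longrightarrow> w y \<noteq> 0 \<Longrightarrow> ((\<lambda>v. F v y) has_real_derivative f v y) (at v)"
    and f0: "\<And>v y. p < v \<Longrightarrow> v < u \<Longrightarrow> w y \<noteq> 0 \<Longrightarrow> f v y \<ge> 0"
    and int: "\<And>v. p < v \<Longrightarrow> v < u \<Longrightarrow> integrable lborel (\<lambda>y. w y * f v y)"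
    and intF: "integrable lborel (\<lambda>y. w y * (F u y - F p y))"
  shows "has_bochner_integral lborel (\<lambda>v. indicator {p<..<u} v * (LBINT y. w y * f v y))
           (LBINT y. w y * (F u y - F p y))"
proof -
  have wf0: "0 \<le> w y * f v y" if "p < v" "v < u" for v y
    using w0[of y] f0[OF that, of y] by (cases "w y = 0") auto
  have wF0: "0 \<le> w y * (F u y - F p y)" for y
  proof (cases "w y = 0")
    case False
    have "F p y \<le> F u y"
      by (rule DERIV_nonneg_imp_increasing_open[OF \<open>p \<le> u\<close>]) (use der f0 cont False in blast)+
    then show ?thesis using w0[of y] by simp
  qed simp
  show ?thesis
  proof (rule has_bochner_integral_nn_integral)
    have "(\<integral>\<^sup>+v. ennreal (indicator {p<..<u} v * (LBINT y. w y * f v y)) \<partial>lborel)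
      = (\<integral>\<^sup>+v. indicator {p<..<u} v * (\<integral>\<^sup>+y. ennreal (w y * f v y) \<partial>lborel) \<partial>lborel)"
      by (rule nn_integral_cong) (use int wf0 in \<open>auto simp: indicator_def nn_integral_eq_integral\<close>)
    also have "\<dots> = (\<integral>\<^sup>+y. ennreal (w y * (F u y - F p y)) \<partial>lborel)"
      by (rule nn_integral_weighted_FTC) (use assms in auto)
    also have "\<dots> = ennreal (LBINT y. w y * (F u y - F p y))"
      by (rule nn_integral_eq_integral) (use intF wF0 in auto)
    finally show "(\<integral>\<^sup>+v. ennreal (indicator {p<..<u} v * (LBINT y. w y * f v y)) \<partial>lborel) = \<dots>" .
    show "0 \<le> (LBINT y. w y * (F u y - F p y))" by (rule Bochner_Integration.integral_nonneg) (rule wF0)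
    show "AE v in lborel. 0 \<le> indicator {p<..<u} v * (LBINT y. w y * f v y)"
      using wf0 by (auto simp: indicator_def intro!: AE_I2 Bochner_Integration.integral_nonneg)
  qed measurable
qed

lemma beta_weight_shift:
  "0 < t \<Longrightarrow> t < 1 \<Longrightarrow> beta_weight x y t * (t powr c * (1 - t) powr d) = beta_weight (x + c) (y + d) t"
  by (simp add: beta_weight_def powr_add powr_diff)

lemma integrable_beta_weight: "x > 0 \<Longrightarrow> y > 0 \<Longrightarrow> integrable lborel (beta_weight x y)"
  using has_bochner_integral_beta_weight[of x y] by (simp add: has_bochner_integral_iff)

text \<open>A function dominated by powers of \<open>t\<close> and \<open>1 - t\<close> only shifts the parameters of the beta weight.\<close>

lemma beta_weight_integral_bound:
  assumes "x > 0" "y > 0" and [measurable]: "G \<in> borel_measurable borel"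
    and G: "\<And>t. 0 < t \<Longrightarrow> t < 1 \<Longrightarrow> 0 \<le> G t \<and> G t \<le> C * (t powr c * (1 - t) powr d)"
    and "x + c > 0" "y + d > 0"
  shows "integrable lborel (\<lambda>t. beta_weight x y t * G t)"
    and "(LBINT t. beta_weight x y t * G t) \<le> C * Beta (x + c) (y + d)"
    and "0 \<le> (LBINT t. beta_weight x y t * G t)"
proof -
  have le: "beta_weight x y t * G t \<le> C * beta_weight (x + c) (y + d) t" for t
  proof (cases "0 < t \<and> t < 1")
    case True
    then have "beta_weight x y t * G t \<le> beta_weight x y t * (C * (t powr c * (1 - t) powr d))"
      using G[of t] by (intro mult_left_mono beta_weight_nonneg) auto
    then show ?thesis using True beta_weight_shift[of t x y c d] by (simp add: ac_simps)
  qed (auto simp: beta_weight_def)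
  have ge: "0 \<le> beta_weight x y t * G t" for t
    using G[of t] beta_weight_nonneg[of x y t] by (cases "0 < t \<and> t < 1") (auto simp: beta_weight_def)
  have I: "integrable lborel (\<lambda>t. C * beta_weight (x + c) (y + d) t)"
    using integrable_beta_weight[of "x + c" "y + d"] assms by simp
  show riesz_abel: "integrable lborel (\<lambda>t. beta_weight x y t * G t)"
    by (rule Bochner_Integration.integrable_bound[OF I])
       (use le ge in \<open>auto intro!: AE_I2 order.trans[OF _ abs_ge_self]\<close>)
  have "(LBINT t. beta_weight x y t * G t) \<le> (LBINT t. C * beta_weight (x + c) (y + d) t)"
    by (rule integral_mono[OF riesz_abel I le])
  also have "\<dots> = C * Beta (x + c) (y + d)"
    using has_bochner_integral_beta_weight[of "x + c" "y + d"] assms by (simp add: has_bochner_integral_iff)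
  finally show "(LBINT t. beta_weight x y t * G t) \<le> C * Beta (x + c) (y + d)" .
  show "0 \<le> (LBINT t. beta_weight x y t * G t)"
    by (rule Bochner_Integration.integral_nonneg) (rule ge)
qed

text \<open>The factors of the derivatives below that remain after pulling out a power of the moving variable, as
functions of the base \<open>x\<close> of the other power.\<close>

abbreviation psi_kernel :: "real \<Rightarrow> real \<Rightarrow> real \<Rightarrow> real \<Rightarrow> real" where
  "psi_kernel a b s x \<equiv> x powr (2 * b - 2) * (2 * (b - a) * x + (1 - 2 * b) * s)"

abbreviation phi_kernel :: "real \<Rightarrow> real \<Rightarrow> real \<Rightarrow> real \<Rightarrow> real" where
  "phi_kernel a b s x \<equiv> x powr (- a - 1) * (2 * (b - a) * x + a * s)"

text \<open>This is \<open>t powr (2 * a) * psi\<close> (see \<open>psi_eq\<close>).  It comes from substituting \<open>y * t\<close> for the integration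
variable in the integral that defines \<open>psi\<close>, so that the moving end point enters the integrand
smoothly; the derivative of \<open>t powr (1 - 2 * a) * (s - t * y) powr (2 * b - 1)\<close> is then rearranged
into two nonnegative terms, by writing \<open>t * y = s - (s - t * y)\<close>.\<close>

definition psi_density :: "real \<Rightarrow> real \<Rightarrow> real \<Rightarrow> real \<Rightarrow> real" where
  "psi_density a b t s = (LBINT y. beta_weight (1 - a) (1 - a) y *
     psi_kernel a b s (s - t * y))"

text \<open>This is \<open>phi\<close> itself (see \<open>phi_eq\<close>), after the substitution of \<open>s + (t - s) * y\<close> for the integration
variable and the same rearrangement into nonnegative terms.\<close>

definition phi_density :: "real \<Rightarrow> real \<Rightarrow> real \<Rightarrow> real \<Rightarrow> real" where
  "phi_density a b t s = (t - s) powr (2 * b - 1 - a) * (LBINT y. beta_weight (2 * b) (1 - a) y *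
     phi_kernel a b s (s + (t - s) * y))"

text \<open>This is \<open>- tau\<close> (see \<open>tau_eq\<close>); the sign makes all three densities nonnegative.\<close>

definition tau_density :: "real \<Rightarrow> real \<Rightarrow> real \<Rightarrow> real \<Rightarrow> real" where
  "tau_density a b t s = a * s powr (2 * b - a) *
     (LBINT y. beta_weight (1 - a) (2 * b) y * (t - s * y) powr (- a - 1))"

text \<open>The parameters are \<open>a = H1 - 1/2\<close> and \<open>b = H2 - 1/2\<close>.\<close>

locale riesz_exponents =
  fixes a b :: real
  assumes a: "0 < a" and ab: "a < b" and b: "b < 1/2"
begin

text \<open>The functions of \<open>u\<close> whose derivatives are \<open>psi\<close>, \<open>phi\<close> and \<open>tau\<close>, in this order.\<close>

definition psi_primitive :: "real \<Rightarrow> real \<Rightarrow> real" where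
  "psi_primitive u s = (LBINT t. indicator {0<..<u} t * ((u - t) powr - a * t powr - a * (s - t) powr (2 * b - 1)))"

definition phi_primitive :: "real \<Rightarrow> real \<Rightarrow> real" where
  "phi_primitive u s = (LBINT t. indicator {s<..<u} t * ((u - t) powr - a * t powr - a * (t - s) powr (2 * b - 1)))"

definition tau_primitive :: "real \<Rightarrow> real \<Rightarrow> real" where
  "tau_primitive u s = (LBINT t. indicator {0<..<s} t * ((u - t) powr - a * t powr - a * (s - t) powr (2 * b - 1)))"

lemma psi_primitive_eq:
  assumes "0 < u"
  shows "psi_primitive u s = (LBINT y. beta_weight (1 - a) (1 - a) y * (u powr (1 - 2 * a) * (s - u * y) powr (2 * b - 1)))"
  using integral_beta_substitution[OF assms, of "1 - a" "1 - a" "\<lambda>t. (s - t) powr (2 * b - 1)"]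
  by (simp add: psi_primitive_def mult_ac)

lemma phi_primitive_eq:
  assumes "s < u"
  shows "phi_primitive u s = (LBINT y. beta_weight (2 * b) (1 - a) y * ((u - s) powr (2 * b - a) * (s + (u - s) * y) powr - a))"
  using integral_beta_substitution[OF assms, of "2 * b" "1 - a" "\<lambda>t. t powr - a"]
  by (simp add: phi_primitive_def mult_ac)

lemma tau_primitive_eq:
  assumes "0 < s"
  shows "tau_primitive u s = (LBINT y. beta_weight (1 - a) (2 * b) y * (s powr (2 * b - a) * (u - s * y) powr - a))"
  using integral_beta_substitution[OF assms, of "1 - a" "2 * b" "\<lambda>t. (u - t) powr - a"]
  by (simp add: tau_primitive_def mult_ac)

lemma psi_integrand_derivative:
  assumes "0 < v" "v < s" "0 < y" "y < 1"
  shows "((\<lambda>v. v powr (1 - 2 * a) * (s - v * y) powr (2 * b - 1)) has_real_derivative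
     v powr (- 2 * a) * psi_kernel a b s (s - v * y)) (at v)"
proof -
  have "v * y < s" by (rule mult_less_bound) (use assms in auto)
  then have pos: "s - v * y > 0" by simp
  have e: "v powr (1 - 2 * a) = v * v powr (- 2 * a)" "(s - v * y) powr (2 * b - 1) = (s - v * y) * (s - v * y) powr (2 * b - 2)"
    using assms pos powr_add[of v 1 "- 2 * a"] powr_add[of "s - v * y" 1 "2 * b - 2"] by simp_all
  have e': "2 * b - 1 - 1 = 2 * b - 2" "1 - 2 * a - 1 = - 2 * a" by simp_all
  have "((\<lambda>v. v powr (1 - 2 * a) * (s - v * y) powr (2 * b - 1)) has_real_derivative
     ((1 - 2 * a) * v powr (1 - 2 * a - 1)) * (s - v * y) powr (2 * b - 1)
     + v powr (1 - 2 * a) * ((2 * b - 1) * (s - v * y) powr (2 * b - 1 - 1) * (- y))) (at v)"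
    using assms pos by (auto intro!: derivative_eq_intros)
  also have "((1 - 2 * a) * v powr (1 - 2 * a - 1)) * (s - v * y) powr (2 * b - 1)
     + v powr (1 - 2 * a) * ((2 * b - 1) * (s - v * y) powr (2 * b - 1 - 1) * (- y))
     = v powr (- 2 * a) * psi_kernel a b s (s - v * y)"
    unfolding e' e by (simp add: algebra_simps)
  finally show ?thesis .
qed

lemma psi_integrand_nonneg:
  assumes "0 < v" "v \<le> s" "0 < y" "y < 1"
  shows "0 \<le> psi_kernel a b s (s - v * y)"
proof -
  have "v * y < s" by (rule mult_less_bound) (use assms in auto)
  then show ?thesis using ab b assms by simp
qed

text \<open>Since \<open>s - v * y\<close> is at least \<open>s - v\<close> and at least \<open>s * (1 - y)\<close>, the exponent \<open>2 * b - 2\<close> can be shared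
equally between the two.  The power \<open>(1 - y) powr (b - 1)\<close> is still integrable against the beta weight
because \<open>a < b\<close>, and the remaining singularity in \<open>s - v\<close> is only of order \<open>b - 1\<close>.\<close>

lemma psi_integrand_le:
  assumes "0 < v" "v < s" "0 < y" "y < 1"
  shows "psi_kernel a b s (s - v * y)
     \<le> ((1 - 2 * a) * s powr b * (s - v) powr (b - 1)) * (y powr 0 * (1 - y) powr (b - 1))"
proof -
  have 1: "v * y < v" by (rule mult_less_bound) (use assms in auto)
  have 2: "v * y < s * y" using assms by simp
  have pos: "s - v * y > 0" using 1 assms(2) by linarith
  have le: "s - v * y \<le> s" using assms by simp
  have "(s - v * y) powr (2 * b - 2) = (s - v * y) powr (b - 1) * (s - v * y) powr (b - 1)"
    using powr_add[of "s - v * y" "b - 1" "b - 1"] by simp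
  also have "\<dots> \<le> (s - v) powr (b - 1) * (s * (1 - y)) powr (b - 1)"
    using 1 2 assms b by (intro mult_mono powr_mono2') (auto simp: algebra_simps)
  also have "\<dots> = (s powr (b - 1) * (s - v) powr (b - 1)) * (1 - y) powr (b - 1)"
    using assms by (simp add: powr_mult)
  finally have A: "(s - v * y) powr (2 * b - 2) \<le> (s powr (b - 1) * (s - v) powr (b - 1)) * (1 - y) powr (b - 1)" .
  have "2 * (b - a) * (s - v * y) + (1 - 2 * b) * s \<le> 2 * (b - a) * s + (1 - 2 * b) * s"
    using le ab by (intro add_right_mono mult_left_mono) auto
  also have "\<dots> = (1 - 2 * a) * s" by (simp add: algebra_simps)
  finally have B: "2 * (b - a) * (s - v * y) + (1 - 2 * b) * s \<le> (1 - 2 * a) * s" .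
  have "psi_kernel a b s (s - v * y)
     \<le> ((s powr (b - 1) * (s - v) powr (b - 1)) * (1 - y) powr (b - 1)) * ((1 - 2 * a) * s)"
    using pos ab b assms by (intro mult_mono A B) auto
  also have "\<dots> = ((1 - 2 * a) * (s powr 1 * s powr (b - 1)) * (s - v) powr (b - 1)) * (1 - y) powr (b - 1)"
    using assms by (simp add: ac_simps)
  also have "s powr 1 * s powr (b - 1) = s powr b" by (simp only: powr_add[symmetric]) simp
  finally show ?thesis using assms by simp
qed

lemma psi_density_facts:
  assumes "0 < v" "v < s"
  shows "integrable lborel (\<lambda>y. beta_weight (1 - a) (1 - a) y * psi_kernel a b s (s - v * y))"
    and "psi_density a b v s \<le> (1 - 2 * a) * s powr b * (s - v) powr (b - 1) * Beta (1 - a) (b - a)"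
    and "0 \<le> psi_density a b v s"
  using beta_weight_integral_bound[of "1 - a" "1 - a" "\<lambda>y. psi_kernel a b s (s - v * y)"
      "(1 - 2 * a) * s powr b * (s - v) powr (b - 1)" 0 "b - 1"]
    psi_integrand_le[OF assms] psi_integrand_nonneg[of v s] assms a ab b
  by (auto simp: psi_density_def)

text \<open>The integrand is a nonnegative combination of two negative powers of \<open>s - v * y\<close>.\<close>

lemma psi_density_mono:
  assumes "0 < v" "v \<le> w" "w < s"
  shows "psi_density a b v s \<le> psi_density a b w s"
  unfolding psi_density_def
proof (rule integral_mono)
  fix y
  show "beta_weight (1 - a) (1 - a) y * psi_kernel a b s (s - v * y)
    \<le> beta_weight (1 - a) (1 - a) y * psi_kernel a b s (s - w * y)"
  proof (cases "0 < y \<and> y < 1")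
    case True
    have "w * y < s" "v * y \<le> w * y" using assms True mult_less_bound[of w s y] by auto
    then have pos: "0 < s - w * y" "s - w * y \<le> s - v * y" using assms by auto
    have e: "x powr (2 * b - 2) * (2 * (b - a) * x + (1 - 2 * b) * s) = 2 * (b - a) * x powr (2 * b - 1) + (1 - 2 * b) * s * x powr (2 * b - 2)"
      if "x > 0" for x using that powr_add[of x 1 "2 * b - 2"] by (simp add: algebra_simps)
    have "2 * (b - a) * (s - v * y) powr (2 * b - 1) + (1 - 2 * b) * s * (s - v * y) powr (2 * b - 2)
      \<le> 2 * (b - a) * (s - w * y) powr (2 * b - 1) + (1 - 2 * b) * s * (s - w * y) powr (2 * b - 2)"
      using pos assms ab b by (intro add_mono mult_left_mono powr_mono2') auto
    then show ?thesis unfolding e[OF pos(1)] e[OF order.strict_trans2[OF pos]]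
      by (intro mult_left_mono beta_weight_nonneg)
  qed (auto simp: beta_weight_def)
qed (use psi_density_facts(1) assms in auto)

lemma psi_primitive_integrable:
  assumes "0 < u" "u \<le> s"
  shows "integrable lborel (\<lambda>y. beta_weight (1 - a) (1 - a) y * (u powr (1 - 2 * a) * (s - u * y) powr (2 * b - 1)))"
proof (rule beta_weight_integral_bound(1)[where C = "u powr (1 - 2 * a) * u powr (2 * b - 1)" and c = 0 and d = "2 * b - 1"])
  fix y :: real assume y: "0 < y" "y < 1"
  have "(s - u * y) powr (2 * b - 1) \<le> (u * (1 - y)) powr (2 * b - 1)"
    using y assms b by (intro powr_mono2') (auto simp: algebra_simps)
  then show "0 \<le> u powr (1 - 2 * a) * (s - u * y) powr (2 * b - 1) \<and>
    u powr (1 - 2 * a) * (s - u * y) powr (2 * b - 1) \<le> u powr (1 - 2 * a) * u powr (2 * b - 1) * (y powr 0 * (1 - y) powr (2 * b - 1))"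
    using y assms by (simp add: powr_mult)
qed (use a ab b in auto)

text \<open>The case \<open>u = s\<close> is included: it evaluates the integral of \<open>psi\<close> up to its singularity.\<close>

lemma has_bochner_integral_psi:
  assumes "0 < u" "u \<le> s"
  shows "has_bochner_integral lborel (\<lambda>v. indicator {0<..<u} v * (v powr (- 2 * a) * psi_density a b v s)) (psi_primitive u s)"
proof -
  let ?F = "\<lambda>v y. v powr (1 - 2 * a) * (s - v * y) powr (2 * b - 1)"
  let ?f = "\<lambda>v y. v powr (- 2 * a) * psi_kernel a b s (s - v * y)"
  let ?w = "beta_weight (1 - a) (1 - a)"
  have "has_bochner_integral lborel (\<lambda>v. indicator {0<..<u} v * (LBINT y. ?w y * ?f v y)) (LBINT y. ?w y * (?F u y - ?F 0 y))"
  proof (rule has_bochner_integral_weighted_FTC)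
    fix y assume y: "?w y \<noteq> 0"
    then have y: "0 < y" "y < 1" using beta_weight_nonzero by auto
    have "s \<noteq> v * y" "v * y \<le> s" if "0 \<le> v" "v \<le> u" for v
      using mult_less_bound[of v s y] that y assms by simp_all
    then show "continuous_on {0..u} (\<lambda>v. ?F v y)"
      using a ab b by (intro continuous_on_mult continuous_on_powr' continuous_on_diff continuous_on_id continuous_on_const)
        (auto simp: less_imp_le)
    fix v assume "0 < v" "v < u"
    then show "((\<lambda>v. ?F v y) has_real_derivative ?f v y) (at v)" "0 \<le> ?f v y"
      using psi_integrand_derivative[of v s y] psi_integrand_nonneg[of v s y] y assms by auto
  next
    fix v assume "0 < v" "v < u"
    then show "integrable lborel (\<lambda>y. ?w y * ?f v y)"
      using integrable_mult_right[OF psi_density_facts(1)[of v s], of "v powr (- 2 * a)"] assms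
      by (simp add: mult.left_commute)
  next
    show "integrable lborel (\<lambda>y. ?w y * (?F u y - ?F 0 y))"
      using psi_primitive_integrable[OF assms] by simp
  qed (use assms beta_weight_nonneg in auto)
  moreover have "(LBINT y. ?w y * ?f v y) = v powr (- 2 * a) * psi_density a b v s" for v
    unfolding psi_density_def by (subst integral_mult_right_zero[symmetric]) (simp only: mult.left_commute)
  ultimately show ?thesis using psi_primitive_eq[OF assms(1)] by simp
qed

lemma psi_eq:
  assumes "0 < u" "u < s"
  shows "psi (a + 1/2) (b + 1/2) u s = u powr (- 2 * a) * psi_density a b u s"
proof -
  let ?F = "\<lambda>v y. v powr (1 - 2 * a) * (s - v * y) powr (2 * b - 1)"
  let ?f = "\<lambda>v y. v powr (- 2 * a) * psi_kernel a b s (s - v * y)"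
  let ?w = "beta_weight (1 - a) (1 - a)"
  define d where "d = min (u / 2) ((s - u) / 2)"
  have d: "d > 0" "u - d \<ge> u / 2" "u + d \<le> (s + u) / 2" using assms by (auto simp: d_def min_def field_simps)
  have "((\<lambda>v. \<integral>y. ?w y * ?F v y \<partial>lborel) has_real_derivative (LBINT y. ?w y * ?f u y)) (at u)"
  proof (rule has_real_derivative_weighted_integral)
    fix v assume v: "\<bar>v - u\<bar> < d"
    then have v': "0 < v" "v < s" "u / 2 \<le> v" "v \<le> (s + u) / 2" using d assms by (auto simp: abs_if split: if_splits)
    show "integrable lborel (\<lambda>y. ?w y * ?F v y)" using psi_primitive_integrable[of v s] v' by simp
    fix y assume "?w y \<noteq> 0"
    then have y: "0 < y" "y < 1" using beta_weight_nonzero by auto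
    show "((\<lambda>v. ?F v y) has_real_derivative ?f v y) (at v)"
      using psi_integrand_derivative[of v s y] v' y by auto
    have "v * y < v" by (rule mult_less_bound) (use v' y in auto)
    then have m: "(s - u) / 2 \<le> s - v * y" using v' by argo
    have "s - v * y \<le> s" using v' y by simp
    have A: "(s - v * y) powr (2 * b - 2) \<le> ((s - u) / 2) powr (2 * b - 2)"
      using m assms b by (intro powr_mono2') auto
    have B: "2 * (b - a) * (s - v * y) + (1 - 2 * b) * s \<le> 2 * (b - a) * s + (1 - 2 * b) * s"
      using \<open>s - v * y \<le> s\<close> ab by (intro add_right_mono mult_left_mono) auto
    have "?f v y \<le> (u / 2) powr (- 2 * a) * (((s - u) / 2) powr (2 * b - 2) * (2 * (b - a) * s + (1 - 2 * b) * s))"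
      using v' m assms a ab b by (intro mult_mono A B powr_mono2') (auto intro!: add_nonneg_nonneg mult_nonneg_nonneg)
    moreover have "0 \<le> ?f v y" using psi_integrand_nonneg[of v s y] v' y by simp
    ultimately show "\<bar>?f v y\<bar> \<le> (u / 2) powr (- 2 * a) * (((s - u) / 2) powr (2 * b - 2) * (2 * (b - a) * s + (1 - 2 * b) * s))"
      by simp
  qed (use d a integrable_beta_weight ab b in auto)
  moreover have "(LBINT y. ?w y * ?f u y) = u powr (- 2 * a) * psi_density a b u s"
    unfolding psi_density_def by (subst integral_mult_right_zero[symmetric]) (simp only: mult.left_commute)
  ultimately have D: "((\<lambda>v. \<integral>y. ?w y * ?F v y \<partial>lborel) has_real_derivative u powr (- 2 * a) * psi_density a b u s) (at u)"
    by simp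
  have "((\<lambda>v. psi_primitive v s) has_real_derivative u powr (- 2 * a) * psi_density a b u s) (at u)"
    by (rule DERIV_cong_ev[THEN iffD2, OF refl _ refl D])
       (use eventually_nhds_in_open[of "{0<..<s}" u] assms in \<open>auto elim!: eventually_mono simp: psi_primitive_eq\<close>)
  moreover have "(\<lambda>v. LBINT t:{0<..<v}. (v - t) powr (1/2 - (a + 1/2)) * t powr (1/2 - (a + 1/2)) * (s - t) powr (2 * (b + 1/2) - 2)) = (\<lambda>v. psi_primitive v s)"
    by (simp add: psi_primitive_def set_lebesgue_integral_def fun_eq_iff)
  ultimately show ?thesis unfolding psi_def by (simp add: DERIV_imp_deriv)
qed

lemma phi_point_pos: "0 < s \<Longrightarrow> s < u \<Longrightarrow> 0 < y \<Longrightarrow> 0 < s + (u - s) * y" for u s y :: real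
  by (intro add_pos_pos mult_pos_pos) auto

lemma phi_integrand_derivative:
  assumes "0 < s" "s < v" "0 < y" "y < 1"
  shows "((\<lambda>v. (v - s) powr (2 * b - a) * (s + (v - s) * y) powr - a) has_real_derivative
     (v - s) powr (2 * b - 1 - a) * phi_kernel a b s (s + (v - s) * y)) (at v)"
proof -
  define x where "x = s + (v - s) * y"
  have pos: "x > 0" unfolding x_def by (rule phi_point_pos) (use assms in auto)
  have e: "(v - s) powr (2 * b - a) = (v - s) * (v - s) powr (2 * b - 1 - a)" "x powr - a = x * x powr (- a - 1)"
    using assms pos powr_add[of "v - s" 1 "2 * b - 1 - a"] powr_add[of x 1 "- a - 1"] by simp_all
  have e': "2 * b - a - 1 = 2 * b - 1 - a" by simp_all
  have "((\<lambda>v. (v - s) powr (2 * b - a) * (s + (v - s) * y) powr - a) has_real_derivative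
     ((2 * b - a) * (v - s) powr (2 * b - a - 1)) * x powr - a
     + (v - s) powr (2 * b - a) * ((- a) * x powr (- a - 1) * y)) (at v)"
    using assms pos unfolding x_def by (auto intro!: derivative_eq_intros)
  also have "((2 * b - a) * (v - s) powr (2 * b - a - 1)) * x powr - a
     + (v - s) powr (2 * b - a) * ((- a) * x powr (- a - 1) * y)
     = (v - s) powr (2 * b - 1 - a) * (x powr (- a - 1) * ((2 * b - a) * x - a * ((v - s) * y)))"
    unfolding e' e by (simp add: algebra_simps)
  also have "(2 * b - a) * x - a * ((v - s) * y) = 2 * (b - a) * x + a * s"
    unfolding x_def by (simp add: algebra_simps)
  finally show ?thesis by (simp add: x_def)
qed

lemma phi_integrand_nonneg:
  assumes "0 < s" "s < v" "0 < y"
  shows "0 \<le> phi_kernel a b s (s + (v - s) * y)"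
  using phi_point_pos[OF assms] ab a assms by simp

text \<open>The point \<open>x = s + (v - s) * y\<close> satisfies \<open>s \<le> x\<close> and \<open>v * y \<le> x\<close>.\<close>

lemma phi_integrand_le:
  assumes "0 < s" "s < v" "0 < y" "y < 1"
  shows "phi_kernel a b s (s + (v - s) * y)
     \<le> ((2 * b - a) * v powr - a) * (y powr - a * (1 - y) powr 0)"
proof -
  define x where "x = s + (v - s) * y"
  have pos: "x > 0" unfolding x_def by (rule phi_point_pos) (use assms in auto)
  have sx: "s \<le> x" using assms by (simp add: x_def)
  have "s * y < s" by (rule mult_less_bound) (use assms in auto)
  then have vx: "v * y \<le> x" by (simp add: x_def algebra_simps)
  have "x powr (- a - 1) * (2 * (b - a) * x + a * s) \<le> x powr (- a - 1) * (2 * (b - a) * x + a * x)"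
    using sx a by (intro mult_left_mono add_left_mono) auto
  also have "\<dots> = (2 * b - a) * (x powr (- a - 1) * x powr 1)" using pos by (simp add: algebra_simps)
  also have "x powr (- a - 1) * x powr 1 = x powr - a" by (simp only: powr_add[symmetric]) simp
  also have "(2 * b - a) * x powr - a \<le> (2 * b - a) * (v * y) powr - a"
    using vx assms a ab by (intro mult_left_mono powr_mono2') auto
  also have "\<dots> = ((2 * b - a) * v powr - a) * (y powr - a * (1 - y) powr 0)"
    using assms by (simp add: powr_mult)
  finally show ?thesis by (simp add: x_def)
qed

lemma phi_density_facts:
  assumes "0 < s" "s < v"
  shows "integrable lborel (\<lambda>y. beta_weight (2 * b) (1 - a) y * phi_kernel a b s (s + (v - s) * y))"
    and "phi_density a b v s \<le> (v - s) powr (2 * b - 1 - a) * ((2 * b - a) * v powr - a * Beta (2 * b - a) (1 - a))"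
    and "0 \<le> phi_density a b v s"
proof -
  note B = beta_weight_integral_bound[of "2 * b" "1 - a" "\<lambda>y. phi_kernel a b s (s + (v - s) * y)"
      "(2 * b - a) * v powr - a" "- a" 0]
  have B: "integrable lborel (\<lambda>y. beta_weight (2 * b) (1 - a) y * phi_kernel a b s (s + (v - s) * y))"
    "(LBINT y. beta_weight (2 * b) (1 - a) y * phi_kernel a b s (s + (v - s) * y))
      \<le> (2 * b - a) * v powr - a * Beta (2 * b - a) (1 - a)"
    "0 \<le> (LBINT y. beta_weight (2 * b) (1 - a) y * phi_kernel a b s (s + (v - s) * y))"
    using B phi_integrand_le[OF assms] phi_integrand_nonneg[OF assms] a ab b by simp_all
  show "integrable lborel (\<lambda>y. beta_weight (2 * b) (1 - a) y * phi_kernel a b s (s + (v - s) * y))"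
    by (rule B)
  show "phi_density a b v s \<le> (v - s) powr (2 * b - 1 - a) * ((2 * b - a) * v powr - a * Beta (2 * b - a) (1 - a))"
    unfolding phi_density_def by (rule mult_left_mono[OF B(2)]) simp
  show "0 \<le> phi_density a b v s"
    unfolding phi_density_def by (intro mult_nonneg_nonneg B(3)) simp
qed

text \<open>Like for \<open>psi\<close>, the integrand is a nonnegative combination of negative powers, now of a quantity that
grows with the first variable.  Here \<open>a < b\<close> ensures that the coefficient \<open>2 * (b - a)\<close> is nonnegative.\<close>

lemma phi_density_antimono:
  assumes "0 < s" "s < v" "v \<le> w"
  shows "phi_density a b w s \<le> phi_density a b v s"
  unfolding phi_density_def
proof (rule mult_mono)
  show "(w - s) powr (2 * b - 1 - a) \<le> (v - s) powr (2 * b - 1 - a)"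
    using assms a b by (intro powr_mono2') auto
  show "(LBINT y. beta_weight (2 * b) (1 - a) y * phi_kernel a b s (s + (w - s) * y))
    \<le> (LBINT y. beta_weight (2 * b) (1 - a) y * phi_kernel a b s (s + (v - s) * y))"
  proof (rule integral_mono)
    fix y
    show "beta_weight (2 * b) (1 - a) y * phi_kernel a b s (s + (w - s) * y)
      \<le> beta_weight (2 * b) (1 - a) y * phi_kernel a b s (s + (v - s) * y)"
    proof (cases "0 < y \<and> y < 1")
      case True
      have pos: "0 < s + (v - s) * y" "0 < s + (w - s) * y" by (rule phi_point_pos; use assms True in simp)+
      have le: "s + (v - s) * y \<le> s + (w - s) * y" using assms True by simp
      have e: "x powr (- a - 1) * (2 * (b - a) * x + a * s) = 2 * (b - a) * x powr - a + a * s * x powr (- a - 1)"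
        if "x > 0" for x using that powr_add[of x 1 "- a - 1"] by (simp add: algebra_simps)
      show ?thesis unfolding e[OF pos(1)] e[OF pos(2)]
        using pos le assms a ab b by (intro mult_left_mono beta_weight_nonneg add_mono powr_mono2') auto
    qed (auto simp: beta_weight_def)
  qed (use phi_density_facts(1) assms in auto)
  show "0 \<le> (LBINT y. beta_weight (2 * b) (1 - a) y * phi_kernel a b s (s + (w - s) * y))"
  proof (rule Bochner_Integration.integral_nonneg)
    fix y
    show "0 \<le> beta_weight (2 * b) (1 - a) y * phi_kernel a b s (s + (w - s) * y)"
    proof (cases "beta_weight (2 * b) (1 - a) y = 0")
      case False
      then show ?thesis using phi_integrand_nonneg[of s w y] beta_weight_nonzero[OF False] assms
        by (intro mult_nonneg_nonneg[OF beta_weight_nonneg]) auto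
    qed simp
  qed
qed simp

lemma phi_primitive_integrable:
  assumes "0 < s" "s < u"
  shows "integrable lborel (\<lambda>y. beta_weight (2 * b) (1 - a) y * ((u - s) powr (2 * b - a) * (s + (u - s) * y) powr - a))"
proof (rule integrable_mult_bounded)
  fix y assume "beta_weight (2 * b) (1 - a) y \<noteq> 0"
  then have y: "0 < y" "y < 1" using beta_weight_nonzero by auto
  have "(s + (u - s) * y) powr - a \<le> s powr - a"
    using assms y a by (intro powr_mono2') auto
  then show "\<bar>(u - s) powr (2 * b - a) * (s + (u - s) * y) powr - a\<bar> \<le> (u - s) powr (2 * b - a) * s powr - a"
    using assms by (simp add: mult_left_mono)
qed (use integrable_beta_weight a ab b in auto)

lemma has_bochner_integral_phi:
  assumes "0 < s" "s < u"
  shows "has_bochner_integral lborel (\<lambda>v. indicator {s<..<u} v * phi_density a b v s) (phi_primitive u s)"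
proof -
  let ?F = "\<lambda>v y. (v - s) powr (2 * b - a) * (s + (v - s) * y) powr - a"
  let ?f = "\<lambda>v y. (v - s) powr (2 * b - 1 - a) * phi_kernel a b s (s + (v - s) * y)"
  let ?w = "beta_weight (2 * b) (1 - a)"
  have "has_bochner_integral lborel (\<lambda>v. indicator {s<..<u} v * (LBINT y. ?w y * ?f v y)) (LBINT y. ?w y * (?F u y - ?F s y))"
  proof (rule has_bochner_integral_weighted_FTC)
    fix y assume y: "?w y \<noteq> 0"
    then have y: "0 < y" "y < 1" using beta_weight_nonzero by auto
    have "s + (v - s) * y > 0" if "s \<le> v" for v
      using that y assms by (intro add_pos_nonneg) auto
    then have "s + (v - s) * y \<noteq> 0" "s + (v - s) * y \<ge> 0" if "s \<le> v" for v
      using that by (metis less_irrefl, metis less_imp_le)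
    then show "continuous_on {s..u} (\<lambda>v. ?F v y)"
      using a ab b by (intro continuous_on_mult continuous_on_powr' continuous_on_diff continuous_on_add continuous_on_id continuous_on_const) auto
    fix v assume "s < v" "v < u"
    then show "((\<lambda>v. ?F v y) has_real_derivative ?f v y) (at v)" "0 \<le> ?f v y"
      using phi_integrand_derivative[of s v y] phi_integrand_nonneg[of s v y] y assms by auto
  next
    fix v assume "s < v" "v < u"
    then show "integrable lborel (\<lambda>y. ?w y * ?f v y)"
      using integrable_mult_right[OF phi_density_facts(1)[of s v], of "(v - s) powr (2 * b - 1 - a)"] assms
      by (simp add: mult.left_commute)
  next
    show "integrable lborel (\<lambda>y. ?w y * (?F u y - ?F s y))"
      using phi_primitive_integrable[OF assms] by simp
  qed (use assms beta_weight_nonneg in auto)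
  moreover have "(LBINT y. ?w y * ?f v y) = phi_density a b v s" for v
    unfolding phi_density_def by (subst integral_mult_right_zero[symmetric]) (simp only: mult.left_commute)
  ultimately show ?thesis using phi_primitive_eq[OF assms(2)] by simp
qed

lemma has_real_derivative_phi_primitive:
  assumes "0 < s" "s < u"
  shows "((\<lambda>v. phi_primitive v s) has_real_derivative phi_density a b u s) (at u)"
proof -
  let ?F = "\<lambda>v y. (v - s) powr (2 * b - a) * (s + (v - s) * y) powr - a"
  let ?f = "\<lambda>v y. (v - s) powr (2 * b - 1 - a) * phi_kernel a b s (s + (v - s) * y)"
  let ?w = "beta_weight (2 * b) (1 - a)"
  define d where "d = (u - s) / 2"
  have d: "d > 0" using assms by (auto simp: d_def)
  have "((\<lambda>v. \<integral>y. ?w y * ?F v y \<partial>lborel) has_real_derivative (LBINT y. ?w y * ?f u y)) (at u)"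
  proof (rule has_real_derivative_weighted_integral)
    fix v assume v: "\<bar>v - u\<bar> < d"
    then have v': "s < v" "d \<le> v - s" using d unfolding d_def by (auto simp: abs_if field_simps split: if_splits)
    show "integrable lborel (\<lambda>y. ?w y * ?F v y)" using phi_primitive_integrable[of s v] v' assms by simp
    fix y assume "?w y \<noteq> 0"
    then have y: "0 < y" "y < 1" using beta_weight_nonzero by auto
    show "((\<lambda>v. ?F v y) has_real_derivative ?f v y) (at v)"
      using phi_integrand_derivative[of s v y] v' y assms by auto
    define x where "x = s + (v - s) * y"
    have sx: "s \<le> x" using v' y by (simp add: x_def)
    have "x powr (- a - 1) * (2 * (b - a) * x + a * s) \<le> x powr (- a - 1) * (2 * (b - a) * x + a * x)"
      using sx a by (intro mult_left_mono add_left_mono) auto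
    also have "\<dots> = (2 * b - a) * (x powr (- a - 1) * x powr 1)" using sx assms by (simp add: algebra_simps)
    also have "x powr (- a - 1) * x powr 1 = x powr - a" by (simp only: powr_add[symmetric]) simp
    also have "(2 * b - a) * x powr - a \<le> (2 * b - a) * s powr - a"
      using sx assms a ab by (intro mult_left_mono powr_mono2') auto
    finally have A: "x powr (- a - 1) * (2 * (b - a) * x + a * s) \<le> (2 * b - a) * s powr - a" .
    have "?f v y \<le> d powr (2 * b - 1 - a) * ((2 * b - a) * s powr - a)"
      unfolding x_def[symmetric]
      by (intro mult_mono A powr_mono2') (use v' sx d assms a ab b in auto)
    moreover have "0 \<le> ?f v y" using phi_integrand_nonneg[of s v y] v' y assms by simp
    ultimately show "\<bar>?f v y\<bar> \<le> d powr (2 * b - 1 - a) * ((2 * b - a) * s powr - a)" by simp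
  qed (use d a integrable_beta_weight ab b in auto)
  moreover have "(LBINT y. ?w y * ?f u y) = phi_density a b u s"
    unfolding phi_density_def by (subst integral_mult_right_zero[symmetric]) (simp only: mult.left_commute)
  ultimately have D: "((\<lambda>v. \<integral>y. ?w y * ?F v y \<partial>lborel) has_real_derivative phi_density a b u s) (at u)"
    by simp
  show ?thesis
    by (rule DERIV_cong_ev[THEN iffD2, OF refl _ refl D])
       (use eventually_nhds_in_open[of "{s<..}" u] assms in \<open>auto elim!: eventually_mono simp: phi_primitive_eq\<close>)
qed

lemma phi_eq:
  assumes "0 < s" "s < u"
  shows "phi (a + 1/2) (b + 1/2) u s = phi_density a b u s"
proof -
  have "(\<lambda>v. LBINT t:{s<..<v}. (v - t) powr (1/2 - (a + 1/2)) * t powr (1/2 - (a + 1/2)) * (t - s) powr (2 * (b + 1/2) - 2)) = (\<lambda>v. phi_primitive v s)"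
    by (simp add: phi_primitive_def set_lebesgue_integral_def fun_eq_iff)
  then show ?thesis unfolding phi_def using has_real_derivative_phi_primitive[OF assms] by (simp add: DERIV_imp_deriv)
qed

text \<open>Here \<open>v - s * y\<close> is at least \<open>v - s\<close> and at least \<open>v * (1 - y)\<close>, and the exponent is split as
\<open>(b - 1) + (- a - b)\<close>: the second part must be integrable against \<open>(1 - y) powr (2 * b - 1)\<close>.\<close>

lemma tau_integrand_le:
  assumes "0 < s" "s < v" "0 < y" "y < 1"
  shows "(v - s * y) powr (- a - 1) \<le> ((v - s) powr (b - 1) * v powr (- a - b)) * (y powr 0 * (1 - y) powr (- a - b))"
proof -
  have "s * y < s" by (rule mult_less_bound) (use assms in auto)
  have "s * y \<le> v * y" using assms by simp
  have "(v - s * y) powr (- a - 1) = (v - s * y) powr (b - 1) * (v - s * y) powr (- a - b)"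
  proof -
    have "b - 1 + (- a - b) = - a - 1" by simp
    then show ?thesis by (simp only: powr_add[symmetric])
  qed
  also have "\<dots> \<le> (v - s) powr (b - 1) * (v * (1 - y)) powr (- a - b)"
    using \<open>s * y < s\<close> \<open>s * y \<le> v * y\<close> assms a ab b by (intro mult_mono powr_mono2') (auto simp: right_diff_distrib)
  finally show ?thesis using assms by (simp add: powr_mult mult_ac)
qed

lemma tau_density_facts:
  assumes "0 < s" "s < v"
  shows "integrable lborel (\<lambda>y. beta_weight (1 - a) (2 * b) y * (v - s * y) powr (- a - 1))"
    and "tau_density a b v s \<le> a * s powr (2 * b - a) * ((v - s) powr (b - 1) * v powr (- a - b) * Beta (1 - a) (b - a))"
    and "0 \<le> tau_density a b v s"
proof -
  have B: "integrable lborel (\<lambda>y. beta_weight (1 - a) (2 * b) y * (v - s * y) powr (- a - 1))"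
    "(LBINT y. beta_weight (1 - a) (2 * b) y * (v - s * y) powr (- a - 1))
      \<le> (v - s) powr (b - 1) * v powr (- a - b) * Beta (1 - a) (b - a)"
    "0 \<le> (LBINT y. beta_weight (1 - a) (2 * b) y * (v - s * y) powr (- a - 1))"
    using beta_weight_integral_bound[of "1 - a" "2 * b" "\<lambda>y. (v - s * y) powr (- a - 1)"
      "(v - s) powr (b - 1) * v powr (- a - b)" 0 "- a - b"] tau_integrand_le[OF assms] a ab b
    by (simp_all add: algebra_simps)
  show "integrable lborel (\<lambda>y. beta_weight (1 - a) (2 * b) y * (v - s * y) powr (- a - 1))" by (rule B)
  show "tau_density a b v s \<le> a * s powr (2 * b - a) * ((v - s) powr (b - 1) * v powr (- a - b) * Beta (1 - a) (b - a))"
    unfolding tau_density_def by (rule mult_left_mono[OF B(2)]) (use a in simp)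
  show "0 \<le> tau_density a b v s"
    unfolding tau_density_def by (intro mult_nonneg_nonneg B(3)) (use a in auto)
qed

text \<open>With the factor \<open>v powr (2 * a)\<close> the integrand is \<open>(v / (v - s * y)) powr (2 * a) * (v - s * y) powr (a - 1)\<close>, a
product of two decreasing functions of \<open>v\<close>.\<close>

lemma tau_density_antimono:
  assumes "0 < s" "s < v" "v \<le> w"
  shows "w powr (2 * a) * tau_density a b w s \<le> v powr (2 * a) * tau_density a b v s"
proof -
  have "w powr (2 * a) * (LBINT y. beta_weight (1 - a) (2 * b) y * (w - s * y) powr (- a - 1))
      = (LBINT y. beta_weight (1 - a) (2 * b) y * (w powr (2 * a) * (w - s * y) powr (- a - 1)))"
    by (subst integral_mult_right_zero[symmetric]) (simp only: mult.left_commute)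
  also have "\<dots> \<le> (LBINT y. beta_weight (1 - a) (2 * b) y * (v powr (2 * a) * (v - s * y) powr (- a - 1)))"
  proof (rule integral_mono)
    fix y
    show "beta_weight (1 - a) (2 * b) y * (w powr (2 * a) * (w - s * y) powr (- a - 1))
      \<le> beta_weight (1 - a) (2 * b) y * (v powr (2 * a) * (v - s * y) powr (- a - 1))"
    proof (cases "0 < y \<and> y < 1")
      case True
      have "s * y < s" by (rule mult_less_bound) (use assms True in auto)
      then have pos: "0 < v - s * y" "0 < w - s * y" using assms(2,3) by linarith+
      have e: "x powr (2 * a) * (x - s * y) powr (- a - 1) = (x / (x - s * y)) powr (2 * a) * (x - s * y) powr (a - 1)"
        if "x > s" for x
      proof -
        have "x - s * y > 0" using that \<open>s * y < s\<close> by simp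
        then have "(x / (x - s * y)) powr (2 * a) * (x - s * y) powr (a - 1)
           = x powr (2 * a) * ((x - s * y) powr (a - 1) / (x - s * y) powr (2 * a))"
          using that assms by (simp add: powr_divide)
        also have "(x - s * y) powr (a - 1) / (x - s * y) powr (2 * a) = (x - s * y) powr (- a - 1)"
          by (simp only: powr_diff[symmetric]) simp
        finally show ?thesis by simp
      qed
      have "s * y * v \<le> s * y * w" using assms True by simp
      then have "w * (v - s * y) \<le> v * (w - s * y)" by (simp add: algebra_simps)
      then have "w / (w - s * y) \<le> v / (v - s * y)"
        using pos by (simp add: pos_le_divide_eq pos_divide_le_eq)
      moreover have "0 \<le> w / (w - s * y)" using pos assms by (intro divide_nonneg_pos) auto
      ultimately have "(w / (w - s * y)) powr (2 * a) \<le> (v / (v - s * y)) powr (2 * a)"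
        using a by (intro powr_mono2) auto
      moreover have "(w - s * y) powr (a - 1) \<le> (v - s * y) powr (a - 1)"
        using pos assms ab b by (intro powr_mono2') auto
      ultimately have "w powr (2 * a) * (w - s * y) powr (- a - 1) \<le> v powr (2 * a) * (v - s * y) powr (- a - 1)"
        using e[of w] e[of v] assms by (simp add: mult_mono)
      then show ?thesis by (intro mult_left_mono beta_weight_nonneg)
    qed (auto simp: beta_weight_def)
  qed (use tau_density_facts(1)[of s v] tau_density_facts(1)[of s w] assms in \<open>auto simp: mult.left_commute[of "beta_weight _ _ _"]\<close>)
  also have "\<dots> = v powr (2 * a) * (LBINT y. beta_weight (1 - a) (2 * b) y * (v - s * y) powr (- a - 1))"
    by (subst integral_mult_right_zero[symmetric]) (simp only: mult.left_commute)
  finally show ?thesis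
    unfolding tau_density_def using mult_left_mono[of _ _ "a * s powr (2 * b - a)"] a
    by (simp add: mult.left_commute[of "_ powr (2 * a)"])
qed

lemma tau_primitive_integrable:
  assumes "0 < s" "s \<le> u"
  shows "integrable lborel (\<lambda>y. beta_weight (1 - a) (2 * b) y * (s powr (2 * b - a) * (u - s * y) powr - a))"
proof (rule beta_weight_integral_bound(1)[where C = "s powr (2 * b - a) * s powr - a" and c = 0 and d = "- a"])
  fix y :: real assume y: "0 < y" "y < 1"
  have "(u - s * y) powr - a \<le> (s * (1 - y)) powr - a"
    using y assms a by (intro powr_mono2') (auto simp: algebra_simps)
  then show "0 \<le> s powr (2 * b - a) * (u - s * y) powr - a \<and>
    s powr (2 * b - a) * (u - s * y) powr - a \<le> s powr (2 * b - a) * s powr - a * (y powr 0 * (1 - y) powr - a)"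
    using y assms by (simp add: powr_mult mult.assoc mult_left_mono)
qed (use a ab b in auto)

lemma tau_integrand_derivative:
  assumes "0 < s" "s < v" "0 < y" "y < 1"
  shows "((\<lambda>v. - (s powr (2 * b - a) * (v - s * y) powr - a)) has_real_derivative
     a * s powr (2 * b - a) * (v - s * y) powr (- a - 1)) (at v)"
proof -
  have "s * y < s" by (rule mult_less_bound) (use assms in auto)
  then have "s * y < v" using assms(2) by linarith
  then show ?thesis by (auto intro!: derivative_eq_intros)
qed

lemma has_bochner_integral_tau:
  assumes "0 < s" "s < u"
  shows "has_bochner_integral lborel (\<lambda>v. indicator {s<..<u} v * tau_density a b v s) (tau_primitive s s - tau_primitive u s)"
proof -
  let ?F = "\<lambda>v y. - (s powr (2 * b - a) * (v - s * y) powr - a)"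
  let ?f = "\<lambda>v y. a * s powr (2 * b - a) * (v - s * y) powr (- a - 1)"
  let ?w = "beta_weight (1 - a) (2 * b)"
  note I = tau_primitive_integrable[of s s, OF assms(1) order.refl] tau_primitive_integrable[of s u, OF assms(1)]
  have diff: "?w y * (?F u y - ?F s y) = ?w y * (s powr (2 * b - a) * (s - s * y) powr - a) - ?w y * (s powr (2 * b - a) * (u - s * y) powr - a)" for y
    by (simp add: algebra_simps)
  have "has_bochner_integral lborel (\<lambda>v. indicator {s<..<u} v * (LBINT y. ?w y * ?f v y)) (LBINT y. ?w y * (?F u y - ?F s y))"
  proof (rule has_bochner_integral_weighted_FTC)
    fix y assume y: "?w y \<noteq> 0"
    then have y: "0 < y" "y < 1" using beta_weight_nonzero by auto
    have "s * y < s" by (rule mult_less_bound) (use assms y in auto)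
    then show "continuous_on {s..u} (\<lambda>v. ?F v y)"
      by (intro continuous_on_minus continuous_on_mult continuous_on_powr' continuous_on_diff continuous_on_id continuous_on_const) auto
    fix v assume "s < v" "v < u"
    then show "((\<lambda>v. ?F v y) has_real_derivative ?f v y) (at v)" "0 \<le> ?f v y"
      using tau_integrand_derivative[of s v y] y assms a by auto
  next
    fix v assume "s < v" "v < u"
    then show "integrable lborel (\<lambda>y. ?w y * ?f v y)"
      using integrable_mult_right[OF tau_density_facts(1)[of s v], of "a * s powr (2 * b - a)"] assms
      by (simp add: mult.left_commute)
  next
    show "integrable lborel (\<lambda>y. ?w y * (?F u y - ?F s y))"
      unfolding diff using I assms by (intro Bochner_Integration.integrable_diff) auto
  qed (use assms beta_weight_nonneg in auto)
  moreover have "(LBINT y. ?w y * ?f v y) = tau_density a b v s" for v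
    unfolding tau_density_def by (subst integral_mult_right_zero[symmetric]) (simp only: mult.left_commute)
  moreover have "(LBINT y. ?w y * (?F u y - ?F s y)) = tau_primitive s s - tau_primitive u s"
    unfolding diff using I assms by (subst Bochner_Integration.integral_diff) (auto simp: tau_primitive_eq)
  ultimately show ?thesis by simp
qed

lemma has_real_derivative_tau_primitive:
  assumes "0 < s" "s < u"
  shows "((\<lambda>v. tau_primitive v s) has_real_derivative - tau_density a b u s) (at u)"
proof -
  let ?F = "\<lambda>v y. - (s powr (2 * b - a) * (v - s * y) powr - a)"
  let ?f = "\<lambda>v y. a * s powr (2 * b - a) * (v - s * y) powr (- a - 1)"
  let ?w = "beta_weight (1 - a) (2 * b)"
  define d where "d = (u - s) / 2"
  have d: "d > 0" using assms by (auto simp: d_def)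
  have D0: "((\<lambda>v. \<integral>y. ?w y * ?F v y \<partial>lborel) has_real_derivative (LBINT y. ?w y * ?f u y)) (at u)"
  proof (rule has_real_derivative_weighted_integral)
    fix v assume v: "\<bar>v - u\<bar> < d"
    then have v': "s < v" "d \<le> v - s" using d unfolding d_def by (auto simp: abs_if field_simps split: if_splits)
    show "integrable lborel (\<lambda>y. ?w y * ?F v y)" using tau_primitive_integrable[of s v] v' assms by simp
    fix y assume "?w y \<noteq> 0"
    then have y: "0 < y" "y < 1" using beta_weight_nonzero by auto
    show "((\<lambda>v. ?F v y) has_real_derivative ?f v y) (at v)"
      using tau_integrand_derivative[of s v y] v' y assms by auto
    have "s * y < s" by (rule mult_less_bound) (use assms y in auto)
    then have "(v - s * y) powr (- a - 1) \<le> d powr (- a - 1)"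
      using v' d a by (intro powr_mono2') auto
    then show "\<bar>?f v y\<bar> \<le> a * s powr (2 * b - a) * d powr (- a - 1)"
      using a by (simp add: abs_mult mult_left_mono)
  qed (use d a integrable_beta_weight ab b in auto)
  have E0: "(LBINT y. ?w y * ?f u y) = tau_density a b u s"
    unfolding tau_density_def by (subst integral_mult_right_zero[symmetric]) (simp only: mult.left_commute)
  have "((\<lambda>v. - (LBINT y. ?w y * ?F v y)) has_real_derivative - tau_density a b u s) (at u)"
    using DERIV_minus[OF D0] unfolding E0 .
  moreover have "(\<lambda>v. - (LBINT y. ?w y * ?F v y)) = (\<lambda>v. \<integral>y. ?w y * (s powr (2 * b - a) * (v - s * y) powr - a) \<partial>lborel)"
    by simp
  ultimately have D: "((\<lambda>v. \<integral>y. ?w y * (s powr (2 * b - a) * (v - s * y) powr - a) \<partial>lborel) has_real_derivative - tau_density a b u s) (at u)"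
    by (simp only:)
  show ?thesis
    by (rule DERIV_cong_ev[THEN iffD2, OF refl _ refl D])
       (use eventually_nhds_in_open[of "{s<..}" u] assms in \<open>auto elim!: eventually_mono simp: tau_primitive_eq\<close>)
qed

lemma tau_eq:
  assumes "0 < s" "s < u"
  shows "tau (a + 1/2) (b + 1/2) u s = - tau_density a b u s"
proof -
  have "(\<lambda>v. LBINT t:{0<..<s}. (v - t) powr (1/2 - (a + 1/2)) * t powr (1/2 - (a + 1/2)) * (s - t) powr (2 * (b + 1/2) - 2)) = (\<lambda>v. tau_primitive v s)"
    by (simp add: tau_primitive_def set_lebesgue_integral_def fun_eq_iff)
  then show ?thesis unfolding tau_def using has_real_derivative_tau_primitive[OF assms] by (simp add: DERIV_imp_deriv)
qed

end

section \<open>The Abel integral of the Riesz kernel\<close>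

abbreviation riesz_abel_integrand :: "real \<Rightarrow> real \<Rightarrow> real \<Rightarrow> real \<Rightarrow> real \<Rightarrow> real" where
  "riesz_abel_integrand a b u s t \<equiv>
     indicator {0<..<u} t * ((u - t) powr - a * t powr - a * \<bar>t - s\<bar> powr (2 * b - 1))"

text \<open>On each side of \<open>s\<close>, replacing one of the three distances \<open>u - t\<close>, \<open>t\<close>, \<open>|t - s|\<close> by a smaller one that
already occurs leaves a beta integral.  The case \<open>b = a\<close> serves the kernel to be inverted, the case
\<open>a < b\<close> the perturbation.\<close>

lemma riesz_abel_bound:
  fixes a b u s :: real
  assumes "0 < a" "a \<le> b" "b < 1/2" "0 < u" "0 < s"
  shows "integrable lborel (riesz_abel_integrand a b u s)"
    and "(LBINT t. riesz_abel_integrand a b u s t)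
      \<le> 2 * u powr (2 * b - 2 * a) * (Beta (1 - a) (2 * b - a) + Beta (2 * b - a) (1 - a))"
proof -
  let ?B1 = "Beta (1 - a) (2 * b - a)" and ?B2 = "Beta (2 * b - a) (1 - a)"
  let ?L = "\<integral>\<^sup>+t. ennreal (riesz_abel_integrand a b u s t) \<partial>lborel"
  have Bpos: "?B1 > 0" "?B2 > 0" using assms by (auto intro!: Beta_pos)
  have left: "(\<integral>\<^sup>+t. ennreal (indicator {0<..<x} t * (t powr - a * (x - t) powr (2 * b - 1 - a))) \<partial>lborel)
      = ennreal (x powr (2 * b - 2 * a) * ?B1)" if "0 < x" for x
    using nn_integral_beta[of 0 x "1 - a" "2 * b - a"] that assms by (simp add: algebra_simps)
  have nn: "?L \<le> ennreal (2 * u powr (2 * b - 2 * a) * (?B1 + ?B2))"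
  proof (cases "u \<le> s")
    case True
    have "?L \<le> (\<integral>\<^sup>+t. ennreal (indicator {0<..<u} t * (t powr - a * (u - t) powr (2 * b - 1 - a))) \<partial>lborel)"
    proof (rule nn_integral_mono, rule ennreal_leI)
      fix t
      show "riesz_abel_integrand a b u s t
        \<le> indicator {0<..<u} t * (t powr - a * (u - t) powr (2 * b - 1 - a))"
      proof (cases "t \<in> {0<..<u}")
        case t: True
        have "(u - t) powr - a * t powr - a * \<bar>t - s\<bar> powr (2 * b - 1) \<le> (u - t) powr - a * t powr - a * (u - t) powr (2 * b - 1)"
          using t True assms by (intro mult_left_mono powr_mono2') auto
        also have "\<dots> = t powr - a * ((u - t) powr - a * (u - t) powr (2 * b - 1))" by simp
        also have "(u - t) powr - a * (u - t) powr (2 * b - 1) = (u - t) powr (2 * b - 1 - a)"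
          by (simp only: powr_add[symmetric]) simp
        finally show ?thesis using t by simp
      qed simp
    qed
    also have "\<dots> = ennreal (u powr (2 * b - 2 * a) * ?B1)" by (rule left) fact
    also have "\<dots> \<le> ennreal (2 * u powr (2 * b - 2 * a) * (?B1 + ?B2))"
      using Bpos by (intro ennreal_leI) (simp add: field_simps add_nonneg_nonneg)
    finally show ?thesis .
  next
    case False
    have "?L \<le> (\<integral>\<^sup>+t. ennreal (indicator {0<..<s} t * (t powr - a * (s - t) powr (2 * b - 1 - a)))
         + ennreal (indicator {s<..<u} t * ((t - s) powr (2 * b - 1 - a) * (u - t) powr - a)) \<partial>lborel)"
    proof (rule nn_integral_mono)
      fix t
      consider "t \<le> 0 \<or> u \<le> t \<or> t = s" | "0 < t" "t < s" | "s < t" "t < u" by linarith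
      then show "ennreal (riesz_abel_integrand a b u s t)
        \<le> ennreal (indicator {0<..<s} t * (t powr - a * (s - t) powr (2 * b - 1 - a)))
         + ennreal (indicator {s<..<u} t * ((t - s) powr (2 * b - 1 - a) * (u - t) powr - a))"
      proof cases
        case 2
        have "(u - t) powr - a * t powr - a * \<bar>t - s\<bar> powr (2 * b - 1) \<le> (s - t) powr - a * t powr - a * (s - t) powr (2 * b - 1)"
          using 2 False assms by (intro mult_mono powr_mono2') auto
        also have "\<dots> = t powr - a * ((s - t) powr - a * (s - t) powr (2 * b - 1))" by simp
        also have "(s - t) powr - a * (s - t) powr (2 * b - 1) = (s - t) powr (2 * b - 1 - a)"
          by (simp only: powr_add[symmetric]) simp
        finally show ?thesis using 2 False by (simp add: ennreal_leI)
      next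
        case 3
        have "(u - t) powr - a * t powr - a * \<bar>t - s\<bar> powr (2 * b - 1) \<le> (u - t) powr - a * (t - s) powr - a * (t - s) powr (2 * b - 1)"
          using 3 False assms by (intro mult_mono powr_mono2') auto
        also have "\<dots> = ((t - s) powr - a * (t - s) powr (2 * b - 1)) * (u - t) powr - a" by simp
        also have "(t - s) powr - a * (t - s) powr (2 * b - 1) = (t - s) powr (2 * b - 1 - a)"
          by (simp only: powr_add[symmetric]) simp
        finally show ?thesis using 3 assms by (simp add: ennreal_leI)
      qed auto
    qed
    also have "\<dots> = ennreal (s powr (2 * b - 2 * a) * ?B1) + ennreal ((u - s) powr (2 * b - 2 * a) * ?B2)"
      using nn_integral_beta[of s u "2 * b - a" "1 - a"] False assms left[of s]
      by (subst nn_integral_add) (auto simp: algebra_simps)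
    also have "\<dots> = ennreal (s powr (2 * b - 2 * a) * ?B1 + (u - s) powr (2 * b - 2 * a) * ?B2)"
      using Bpos by (intro ennreal_plus[symmetric]) auto
    also have "\<dots> \<le> ennreal (2 * u powr (2 * b - 2 * a) * (?B1 + ?B2))"
    proof (rule ennreal_leI)
      have "s powr (2 * b - 2 * a) \<le> u powr (2 * b - 2 * a)" "(u - s) powr (2 * b - 2 * a) \<le> u powr (2 * b - 2 * a)"
        using False assms by (intro powr_mono2; simp)+
      then have "s powr (2 * b - 2 * a) * ?B1 + (u - s) powr (2 * b - 2 * a) * ?B2 \<le> u powr (2 * b - 2 * a) * ?B1 + u powr (2 * b - 2 * a) * ?B2"
        using Bpos by (intro add_mono mult_right_mono) auto
      also have "\<dots> \<le> 2 * u powr (2 * b - 2 * a) * (?B1 + ?B2)"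
        using Bpos by (simp add: algebra_simps)
      finally show "s powr (2 * b - 2 * a) * ?B1 + (u - s) powr (2 * b - 2 * a) * ?B2 \<le> 2 * u powr (2 * b - 2 * a) * (?B1 + ?B2)" .
    qed
    finally show ?thesis .
  qed
  show I: "integrable lborel (riesz_abel_integrand a b u s)"
    by (rule integrableI_nonneg) (use nn in \<open>auto intro: le_less_trans\<close>)
  show "(LBINT t. riesz_abel_integrand a b u s t) \<le> 2 * u powr (2 * b - 2 * a) * (?B1 + ?B2)"
    using nn nn_integral_eq_integral[OF I] Bpos by (simp add: ennreal_le_iff)
qed

lemma psi_density_measurable [measurable]:
  assumes [measurable]: "f \<in> borel_measurable M" "g \<in> borel_measurable M"
  shows "(\<lambda>x. psi_density a b (f x) (g x)) \<in> borel_measurable M"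
  unfolding psi_density_def by measurable

lemma phi_density_measurable [measurable]:
  assumes [measurable]: "f \<in> borel_measurable M" "g \<in> borel_measurable M"
  shows "(\<lambda>x. phi_density a b (f x) (g x)) \<in> borel_measurable M"
  unfolding phi_density_def by measurable

lemma tau_density_measurable [measurable]:
  assumes [measurable]: "f \<in> borel_measurable M" "g \<in> borel_measurable M"
  shows "(\<lambda>x. tau_density a b (f x) (g x)) \<in> borel_measurable M"
  unfolding tau_density_def by measurable

text \<open>The function \<open>v powr (2 * a)\<close> times \<open>psi\<close> before the diagonal and times \<open>rho\<close> behind it, in explicit form.
The value \<open>0\<close> on the diagonal lets indicators of adjacent open intervals be added.\<close>

definition theta :: "real \<Rightarrow> real \<Rightarrow> real \<Rightarrow> real \<Rightarrow> real" where
  "theta a b t s =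
     (if t < s then psi_density a b t s
      else if s < t then t powr (2 * a) * (phi_density a b t s - tau_density a b t s) else 0)"

lemma theta_measurable [measurable]:
  assumes [measurable]: "f \<in> borel_measurable M" "g \<in> borel_measurable M"
  shows "(\<lambda>x. theta a b (f x) (g x)) \<in> borel_measurable M"
  unfolding theta_def by measurable

context riesz_exponents
begin

text \<open>What the first Abel transform makes of the perturbing Riesz kernel.\<close>

definition riesz_abel :: "real \<Rightarrow> real \<Rightarrow> real" where
  "riesz_abel u s = (LBINT t. riesz_abel_integrand a b u s t)"

definition riesz_abel_const :: "real \<Rightarrow> real" where
  "riesz_abel_const u = 2 * u powr (2 * b - 2 * a) * (Beta (1 - a) (2 * b - a) + Beta (2 * b - a) (1 - a))"

lemma riesz_abel_integrable:
  assumes "0 < u" "0 < s"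
  shows "integrable lborel (riesz_abel_integrand a b u s)" and "riesz_abel u s \<le> riesz_abel_const u"
  unfolding riesz_abel_def riesz_abel_const_def using riesz_abel_bound[of a b u s] a ab b assms by auto

lemma riesz_abel_const_mono: "0 < s \<Longrightarrow> s \<le> u \<Longrightarrow> riesz_abel_const s \<le> riesz_abel_const u"
  unfolding riesz_abel_const_def using a ab b Beta_pos[of "1 - a" "2 * b - a"] Beta_pos[of "2 * b - a" "1 - a"]
  by (intro mult_right_mono mult_left_mono powr_mono2 add_nonneg_nonneg) auto

lemma psi_primitive_eq_riesz_abel: "u \<le> s \<Longrightarrow> psi_primitive u s = riesz_abel u s"
  unfolding psi_primitive_def riesz_abel_def by (rule Bochner_Integration.integral_cong) (auto simp: indicator_def)

lemma tau_primitive_self: "tau_primitive s s = psi_primitive s s"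
  by (simp add: tau_primitive_def psi_primitive_def)

lemma riesz_abel_split:
  assumes "0 < s" "s < u"
  shows "riesz_abel u s = tau_primitive u s + phi_primitive u s" and "0 \<le> tau_primitive u s" and "0 \<le> phi_primitive u s"
proof -
  let ?f = "\<lambda>t. riesz_abel_integrand a b u s t"
  let ?g = "\<lambda>t. indicator {0<..<s} t * ((u - t) powr - a * t powr - a * (s - t) powr (2 * b - 1))"
  let ?h = "\<lambda>t. indicator {s<..<u} t * ((u - t) powr - a * t powr - a * (t - s) powr (2 * b - 1))"
  have f: "integrable lborel ?f" using riesz_abel_integrable assms by simp
  have g: "integrable lborel ?g" and h: "integrable lborel ?h"
    by (rule Bochner_Integration.integrable_bound[OF f]; use assms in \<open>auto simp: indicator_def intro!: AE_I2\<close>)+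
  have "?f t = ?g t + ?h t" for t
    using assms by (auto simp: indicator_def)
  then have "riesz_abel u s = (LBINT t. ?g t + ?h t)" unfolding riesz_abel_def by simp
  also have "\<dots> = tau_primitive u s + phi_primitive u s"
    unfolding tau_primitive_def phi_primitive_def by (rule Bochner_Integration.integral_add[OF g h])
  finally show "riesz_abel u s = tau_primitive u s + phi_primitive u s" .
  show "0 \<le> tau_primitive u s" "0 \<le> phi_primitive u s"
    unfolding tau_primitive_def phi_primitive_def by (auto intro!: Bochner_Integration.integral_nonneg)
qed

text \<open>As a function of \<open>u\<close>, \<open>riesz_abel u s\<close> is the primitive of \<open>psi\<close> before \<open>s\<close> and of \<open>rho\<close> behind it.  The
two pieces fit together at \<open>s\<close>: the primitives of \<open>psi\<close> and \<open>tau\<close> have the same value there, and that of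
\<open>phi\<close> starts from \<open>0\<close>.\<close>

lemma has_bochner_integral_theta:
  assumes "0 < s" "0 < u" "u \<noteq> s"
  shows "has_bochner_integral lborel (\<lambda>v. indicator {0<..<u} v * (v powr (- 2 * a) * theta a b v s)) (riesz_abel u s)"
    and "(LBINT v. \<bar>indicator {0<..<u} v * (v powr (- 2 * a) * theta a b v s)\<bar>) \<le> 3 * riesz_abel_const u"
proof -
  let ?G = "\<lambda>v. indicator {0<..<u} v * (v powr (- 2 * a) * theta a b v s)"
  have "has_bochner_integral lborel ?G (riesz_abel u s) \<and> (LBINT v. \<bar>?G v\<bar>) \<le> 3 * riesz_abel_const u"
  proof (cases "u < s")
    case True
    have eq: "?G = (\<lambda>v. indicator {0<..<u} v * (v powr (- 2 * a) * psi_density a b v s))"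
      using True by (auto simp: theta_def indicator_def fun_eq_iff)
    have H: "has_bochner_integral lborel ?G (riesz_abel u s)"
      unfolding eq using has_bochner_integral_psi[of u s] True assms psi_primitive_eq_riesz_abel[of u s] by simp
    have "\<bar>?G v\<bar> = ?G v" for v
      using psi_density_facts(3)[of v s] True by (auto simp: indicator_def theta_def)
    then have "(LBINT v. \<bar>?G v\<bar>) = riesz_abel u s" using H by (simp add: has_bochner_integral_iff)
    moreover have "0 \<le> riesz_abel u s" unfolding riesz_abel_def by (intro Bochner_Integration.integral_nonneg) auto
    ultimately show ?thesis using H riesz_abel_integrable(2)[of u s] assms by simp
  next
    case False
    then have su: "s < u" using assms by simp
    let ?A = "\<lambda>v. indicator {0<..<s} v * (v powr (- 2 * a) * psi_density a b v s)"
    let ?B = "\<lambda>v. indicator {s<..<u} v * phi_density a b v s"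
    let ?C = "\<lambda>v. indicator {s<..<u} v * tau_density a b v s"
    note A = has_bochner_integral_psi[of s s, OF assms(1) order.refl]
      and B = has_bochner_integral_phi[OF assms(1) su] and C = has_bochner_integral_tau[OF assms(1) su]
    have pp: "v powr - (2 * a) * v powr (2 * a) = 1" if "v > 0" for v :: real
      using that by (simp add: powr_minus)
    have eq: "?G v = ?A v + (?B v - ?C v)" for v
      using su assms pp[of v] by (auto simp: theta_def indicator_def mult.assoc[symmetric])
    have H: "has_bochner_integral lborel ?G (riesz_abel u s)"
      using has_bochner_integral_add[OF A has_bochner_integral_diff[OF B C]]
      unfolding eq riesz_abel_split(1)[OF assms(1) su] tau_primitive_self by (simp add: add.commute)
    have I: "integrable lborel (\<lambda>v. ?A v + (?B v + ?C v))"
      using A B C by (intro Bochner_Integration.integrable_add) (auto simp: has_bochner_integral_iff)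
    have "(LBINT v. \<bar>?G v\<bar>) \<le> (LBINT v. ?A v + (?B v + ?C v))"
    proof (rule integral_mono)
      show "integrable lborel (\<lambda>v. \<bar>?G v\<bar>)" using H by (intro integrable_abs) (simp add: has_bochner_integral_iff)
      fix v show "\<bar>?G v\<bar> \<le> ?A v + (?B v + ?C v)"
        unfolding eq using psi_density_facts(3)[of v s] phi_density_facts(3)[of s v] tau_density_facts(3)[of s v] assms
        by (auto simp: indicator_def)
    qed (rule I)
    also have "\<dots> = psi_primitive s s + (phi_primitive u s + (tau_primitive s s - tau_primitive u s))"
      by (intro has_bochner_integral_integral_eq has_bochner_integral_add A B C)
    also have "\<dots> \<le> 3 * riesz_abel_const u"
      using riesz_abel_split[OF assms(1) su] riesz_abel_integrable(2)[of u s] riesz_abel_integrable(2)[of s s] riesz_abel_const_mono[of s u] assms su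
        psi_primitive_eq_riesz_abel[of s s] unfolding tau_primitive_self by simp
    finally show ?thesis using H by simp
  qed
  then show "has_bochner_integral lborel ?G (riesz_abel u s)" "(LBINT v. \<bar>?G v\<bar>) \<le> 3 * riesz_abel_const u" by auto
qed

text \<open>All densities have at most the singularity \<open>|v - s| powr (b - 1)\<close> on the diagonal, uniformly in \<open>s\<close>.
Behind the diagonal the first variable is kept above \<open>u0\<close>, since the constants blow up at the origin.
The factor \<open>T powr (2 * a)\<close> is an upper bound for the weight \<open>v powr (2 * a)\<close> in \<open>theta\<close>.\<close>

definition density_bound :: "real \<Rightarrow> real \<Rightarrow> real \<Rightarrow> bool" where
  "density_bound u0 T C \<longleftrightarrow> C \<ge> 0 \<and>
     (\<forall>v s. 0 < v \<and> v < s \<and> s \<le> T \<longrightarrow> psi_density a b v s \<le> C * (s - v) powr (b - 1)) \<and>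
     (\<forall>v s. 0 < s \<and> s < v \<and> u0 \<le> v \<and> v \<le> T \<longrightarrow>
        T powr (2 * a) * phi_density a b v s \<le> C * (v - s) powr (b - 1) \<and>
        T powr (2 * a) * tau_density a b v s \<le> C * (v - s) powr (b - 1))"

lemma density_bound_exists:
  assumes "0 < u0" "0 < T"
  shows "\<exists>C. density_bound u0 T C"
proof -
  define C1 where "C1 = (1 - 2 * a) * T powr b * Beta (1 - a) (b - a)"
  define C2 where "C2 = T powr (2 * a) * (T powr (b - a) * ((2 * b - a) * u0 powr - a * Beta (2 * b - a) (1 - a)))"
  define C3 where "C3 = T powr (2 * a) * (a * T powr (2 * b - a) * (u0 powr (- a - b) * Beta (1 - a) (b - a)))"
  have Bp: "Beta (1 - a) (b - a) > 0" "Beta (2 * b - a) (1 - a) > 0" using a ab b by (auto intro!: Beta_pos)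
  have C0: "C1 \<ge> 0" "C2 \<ge> 0" "C3 \<ge> 0"
    unfolding C1_def C2_def C3_def using Bp a ab b by auto
  have "density_bound u0 T (C1 + C2 + C3)"
    unfolding density_bound_def
  proof (intro conjI allI impI; (elim conjE)?)
    fix v s :: real assume vs: "0 < v" "v < s" "s \<le> T"
    have "psi_density a b v s \<le> (1 - 2 * a) * s powr b * (s - v) powr (b - 1) * Beta (1 - a) (b - a)"
      by (rule psi_density_facts) (use vs in auto)
    also have "\<dots> \<le> (1 - 2 * a) * T powr b * (s - v) powr (b - 1) * Beta (1 - a) (b - a)"
      using vs a ab b Bp by (intro mult_right_mono mult_left_mono powr_mono2) auto
    also have "\<dots> = C1 * (s - v) powr (b - 1)" by (simp add: C1_def)
    also have "\<dots> \<le> (C1 + C2 + C3) * (s - v) powr (b - 1)" using C0 by (intro mult_right_mono) auto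
    finally show "psi_density a b v s \<le> (C1 + C2 + C3) * (s - v) powr (b - 1)" .
  next
    fix v s :: real assume vs: "0 < s" "s < v" "u0 \<le> v" "v \<le> T"
    have "phi_density a b v s \<le> (v - s) powr (2 * b - 1 - a) * ((2 * b - a) * v powr - a * Beta (2 * b - a) (1 - a))"
      by (rule phi_density_facts) (use vs in auto)
    also have "(v - s) powr (2 * b - 1 - a) = (v - s) powr (b - 1) * (v - s) powr (b - a)"
      using powr_add[of "v - s" "b - 1" "b - a"] by (simp add: algebra_simps)
    also have "(v - s) powr (b - 1) * (v - s) powr (b - a) * ((2 * b - a) * v powr - a * Beta (2 * b - a) (1 - a))
       \<le> (v - s) powr (b - 1) * T powr (b - a) * ((2 * b - a) * u0 powr - a * Beta (2 * b - a) (1 - a))"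
      using vs a ab b Bp assms by (intro mult_mono mult_right_mono mult_left_mono powr_mono2 powr_mono2') auto
    finally have "T powr (2 * a) * phi_density a b v s \<le> T powr (2 * a) * ((v - s) powr (b - 1) * T powr (b - a) * ((2 * b - a) * u0 powr - a * Beta (2 * b - a) (1 - a)))"
      by (rule mult_left_mono) simp
    also have "\<dots> = C2 * (v - s) powr (b - 1)" by (simp add: C2_def)
    also have "\<dots> \<le> (C1 + C2 + C3) * (v - s) powr (b - 1)" using C0 by (intro mult_right_mono) auto
    finally show "T powr (2 * a) * phi_density a b v s \<le> (C1 + C2 + C3) * (v - s) powr (b - 1)" .
  next
    fix v s :: real assume vs: "0 < s" "s < v" "u0 \<le> v" "v \<le> T"
    have "tau_density a b v s \<le> a * s powr (2 * b - a) * ((v - s) powr (b - 1) * v powr (- a - b) * Beta (1 - a) (b - a))"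
      by (rule tau_density_facts) (use vs in auto)
    also have "\<dots> \<le> a * T powr (2 * b - a) * ((v - s) powr (b - 1) * u0 powr (- a - b) * Beta (1 - a) (b - a))"
      using vs a ab b Bp assms by (intro mult_mono mult_right_mono mult_left_mono powr_mono2 powr_mono2') auto
    finally have "T powr (2 * a) * tau_density a b v s \<le> T powr (2 * a) * (a * T powr (2 * b - a) * ((v - s) powr (b - 1) * u0 powr (- a - b) * Beta (1 - a) (b - a)))"
      by (rule mult_left_mono) simp
    also have "\<dots> = C3 * (v - s) powr (b - 1)" by (simp add: C3_def)
    also have "\<dots> \<le> (C1 + C2 + C3) * (v - s) powr (b - 1)" using C0 by (intro mult_right_mono) auto
    finally show "T powr (2 * a) * tau_density a b v s \<le> (C1 + C2 + C3) * (v - s) powr (b - 1)" .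
  qed (use C0 in auto)
  then show ?thesis ..
qed

end

section \<open>The kernel K as a Marchaud derivative\<close>

context riesz_exponents
begin

text \<open>One constant for the four integrals of a product of the powers \<open>b - 1\<close> and \<open>- a\<close> of the distances to the
end points, over any interval of length at most \<open>T\<close>.\<close>

definition edge_const :: "real \<Rightarrow> real" where
  "edge_const T = T powr (b - a) * (Beta b (1 - a) + Beta (1 - a) b + Beta (b - a) 1 + Beta 1 (b - a))"

lemma edge_beta_pos: "Beta b (1 - a) > 0" "Beta (1 - a) b > 0" "Beta (b - a) 1 > 0" "Beta 1 (b - a) > 0"
  using a ab b by (auto intro!: Beta_pos)

lemma edge_const_nonneg: "edge_const T \<ge> 0"
  unfolding edge_const_def using edge_beta_pos by simp

text \<open>The pairs \<open>(x, y)\<close> are the exponents that arise when a power \<open>b - 1\<close> of the distance to one end point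
is multiplied by a power \<open>- a\<close> of the distance to the same or to the other end point.\<close>

lemma edge_integral:
  fixes f :: "real \<Rightarrow> real"
  assumes "p < q" "q - p \<le> T" "C \<ge> 0" and [measurable]: "f \<in> borel_measurable borel"
    and xy: "(x, y) \<in> {(b, 1 - a), (1 - a, b), (b - a, 1), (1, b - a)}"
    and f: "\<And>w. p < w \<Longrightarrow> w < q \<Longrightarrow> \<bar>f w\<bar> \<le> C * ((w - p) powr (x - 1) * (q - w) powr (y - 1))"
  shows "integrable lborel (\<lambda>w. indicator {p<..<q} w * f w)"
    and "(LBINT w. \<bar>indicator {p<..<q} w * f w\<bar>) \<le> C * edge_const T"
proof -
  let ?r = "\<lambda>w. indicator {p<..<q} w * ((w - p) powr (x - 1) * (q - w) powr (y - 1))"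
  have H: "has_bochner_integral lborel (\<lambda>w. C * ?r w) (C * ((q - p) powr (x + y - 1) * Beta x y))"
    using xy a ab b assms(1) by (intro has_bochner_integral_mult_right has_bochner_integral_beta) auto
  then have r: "integrable lborel (\<lambda>w. C * ?r w)" by (simp only: has_bochner_integral_iff)
  have le: "\<bar>indicator {p<..<q} w * f w\<bar> \<le> C * ?r w" for w
    using f[of w] by (auto simp: indicator_def)
  show I: "integrable lborel (\<lambda>w. indicator {p<..<q} w * f w)"
    by (rule Bochner_Integration.integrable_bound[OF r])
       (use le in \<open>auto intro!: AE_I2 order.trans[OF _ abs_ge_self]\<close>)
  have "(LBINT w. \<bar>indicator {p<..<q} w * f w\<bar>) \<le> (LBINT w. C * ?r w)"
    by (rule integral_mono[OF integrable_abs[OF I] r le])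
  also have "\<dots> = C * ((q - p) powr (x + y - 1) * Beta x y)" by (rule has_bochner_integral_integral_eq[OF H])
  also have "(q - p) powr (x + y - 1) * Beta x y \<le> edge_const T"
    unfolding edge_const_def
  proof (rule mult_mono)
    have "x + y - 1 = b - a" using xy by auto
    then show "(q - p) powr (x + y - 1) \<le> T powr (b - a)"
      using assms(1,2) ab by (auto intro!: powr_mono2)
  qed (use xy edge_beta_pos in auto)
  finally show "(LBINT w. \<bar>indicator {p<..<q} w * f w\<bar>) \<le> C * edge_const T"
    using \<open>C \<ge> 0\<close> by (simp add: mult_left_mono)
qed

lemma edge_integrable_power:
  assumes "p < q" "q - p \<le> T" "C \<ge> 0" and [measurable]: "g \<in> borel_measurable borel"
  shows "(\<And>w. p < w \<Longrightarrow> w < q \<Longrightarrow> \<bar>g w\<bar> \<le> C * (q - w) powr (b - 1)) \<Longrightarrow> edge_integrable a p q g (C * edge_const T)"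
    and "(\<And>w. p < w \<Longrightarrow> w < q \<Longrightarrow> \<bar>g w\<bar> \<le> C * (w - p) powr (b - 1)) \<Longrightarrow> edge_integrable a p q g (C * edge_const T)"
proof -
  have m: "x powr (b - 1) * x powr - a = x powr (b - a - 1)" for x :: real
    using powr_add[of x "b - 1" "- a"] by (simp add: algebra_simps)
  have m': "x powr - a * x powr (b - 1) = x powr (b - a - 1)" for x :: real
    by (metis m mult.commute)
  have E: "edge_integrable a p q g (C * edge_const T)"
    if xy: "(x, y) \<in> {(b, 1 - a), (1, b - a)}" "(x', y') \<in> {(1 - a, b), (b - a, 1)}"
      and q: "\<And>w. p < w \<Longrightarrow> w < q \<Longrightarrow> \<bar>g w * (q - w) powr - a\<bar> \<le> C * ((w - p) powr (x - 1) * (q - w) powr (y - 1))"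
      and p: "\<And>w. p < w \<Longrightarrow> w < q \<Longrightarrow> \<bar>g w * (w - p) powr - a\<bar> \<le> C * ((w - p) powr (x' - 1) * (q - w) powr (y' - 1))"
    for x y x' y'
    using edge_integral[OF assms(1-3) _ _ q] edge_integral[OF assms(1-3) _ _ p] xy
    unfolding edge_integrable_def by (auto simp: mult.assoc)
  have le: "\<bar>g w * z\<bar> \<le> C * (r * z)" if "\<bar>g w\<bar> \<le> C * r" "0 \<le> z" for w r z :: real
    using mult_right_mono[OF that] that(2) by (simp add: abs_mult mult_ac)
  show "edge_integrable a p q g (C * edge_const T)"
    if "\<And>w. p < w \<Longrightarrow> w < q \<Longrightarrow> \<bar>g w\<bar> \<le> C * (q - w) powr (b - 1)"
  proof (rule E[of 1 "b - a" "1 - a" b])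
    fix w assume w: "p < w" "w < q"
    show "\<bar>g w * (q - w) powr - a\<bar> \<le> C * ((w - p) powr (1 - 1) * (q - w) powr (b - a - 1))"
      "\<bar>g w * (w - p) powr - a\<bar> \<le> C * ((w - p) powr (1 - a - 1) * (q - w) powr (b - 1))"
      using le[OF that[OF w], of "(q - w) powr - a"] le[OF that[OF w], of "(w - p) powr - a"] w
      by (simp_all add: m' mult.commute)
  qed auto
  show "edge_integrable a p q g (C * edge_const T)"
    if "\<And>w. p < w \<Longrightarrow> w < q \<Longrightarrow> \<bar>g w\<bar> \<le> C * (w - p) powr (b - 1)"
  proof (rule E[of b "1 - a" "b - a" 1])
    fix w assume w: "p < w" "w < q"
    show "\<bar>g w * (q - w) powr - a\<bar> \<le> C * ((w - p) powr (b - 1) * (q - w) powr (1 - a - 1))"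
      "\<bar>g w * (w - p) powr - a\<bar> \<le> C * ((w - p) powr (b - a - 1) * (q - w) powr (1 - 1))"
      using le[OF that[OF w], of "(q - w) powr - a"] le[OF that[OF w], of "(w - p) powr - a"] w
      by (simp_all add: m)
  qed auto
qed

lemma marchaud_regular_cong:
  assumes "marchaud_regular a p q g C" and [measurable]: "g' \<in> borel_measurable borel"
    and eq: "\<And>w. p < w \<Longrightarrow> w < q \<Longrightarrow> g w = g' w"
  shows "marchaud_regular a p q g' C"
proof -
  note r = assms(1)[unfolded marchaud_regular_def]
  have D: "indicator {p<..<q} w * marchaud a q g w = indicator {p<..<q} w * marchaud a q g' w" for w
    using marchaud_cong[of w q g g' a] eq by (auto simp: indicator_def)
  have P: "indicator {p<..<q} w * g w * (w - p) powr - a = indicator {p<..<q} w * g' w * (w - p) powr - a" for w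
    using eq by (auto simp: indicator_def)
  have S: "set_integrable lborel {w<..<q} (\<lambda>t. (g w - g t) / (t - w) powr (a + 1)) \<longleftrightarrow>
     set_integrable lborel {w<..<q} (\<lambda>t. (g' w - g' t) / (t - w) powr (a + 1))" if "w \<in> {p<..<q}" for w
    by (rule set_integrable_cong) (use eq that in auto)
  show ?thesis
    using r unfolding marchaud_regular_def D P by (auto simp: S elim!: eventually_mono)
qed


lemma theta_eq_rho:
  assumes "0 < s" "s < t"
  shows "t powr (2 * a) * rho (a + 1/2) (b + 1/2) t s = theta a b t s"
  using assms by (simp add: rho_def phi_eq tau_eq theta_def)

lemma theta_eq_psi:
  assumes "0 < t" "t < s"
  shows "t powr (2 * a) * psi (a + 1/2) (b + 1/2) t s = theta a b t s"
proof -
  have "t powr (2 * a) * t powr - (2 * a) = 1" using assms by (simp add: powr_minus)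
  then show ?thesis using assms by (simp add: psi_eq theta_def mult.assoc[symmetric])
qed

text \<open>Multiplying by \<open>w powr a\<close> absorbs all the powers of \<open>w\<close> outside the integral.\<close>

lemma K_minus_eq:
  assumes "0 < s" "s < w" "w < T"
  shows "w powr a * K_minus T (a + 1/2) (b + 1/2) w s = marchaud a T (\<lambda>t. theta a b t s) w"
proof -
  let ?rho = "rho (a + 1/2) (b + 1/2)"
  have I: "(LBINT t:{w<..<T}. (w powr (2 * a) * ?rho w s - t powr (2 * a) * ?rho t s) / (t - w) powr (a + 1))
      = (LBINT t:{w<..<T}. (theta a b w s - theta a b t s) / (t - w) powr (a + 1))"
    by (rule set_lebesgue_integral_cong) (use assms in \<open>auto simp: theta_eq_rho\<close>)
  have p: "w powr a * w powr - a = 1" "w powr a * w powr a = w powr (2 * a)"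
    using assms powr_add[of w a a] by (simp_all add: powr_minus)
  have "w powr a * K_minus T (a + 1/2) (b + 1/2) w s
      = (T - w) powr - a * ((w powr a * w powr a) * ?rho w s)
        + a * ((w powr a * w powr - a) * (LBINT t:{w<..<T}. (w powr (2 * a) * ?rho w s - t powr (2 * a) * ?rho t s) / (t - w) powr (a + 1)))"
    by (simp add: K_minus_def algebra_simps)
  also have "\<dots> = marchaud a T (\<lambda>t. theta a b t s) w"
    unfolding p I marchaud_def using assms by (simp add: theta_eq_rho)
  finally show ?thesis .
qed

text \<open>Before the diagonal the Marchaud derivative stops at the singularity \<open>s\<close>; the subtracted integral is
the contribution of \<open>theta\<close> behind \<open>s\<close>, differentiated under the integral sign.\<close>

lemma K_plus_eq:
  assumes "0 < w" "w < s" "s < T"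
  shows "w powr a * K_plus T (a + 1/2) (b + 1/2) w s = marchaud a s (\<lambda>t. theta a b t s) w
     - (LBINT t:{s<..<T}. a * (t - w) powr (- a - 1) * theta a b t s)"
proof -
  let ?rho = "rho (a + 1/2) (b + 1/2)" and ?psi = "psi (a + 1/2) (b + 1/2)"
  have I: "(LBINT t:{w<..<s}. (w powr (2 * a) * ?psi w s - t powr (2 * a) * ?psi t s) / (t - w) powr (a + 1))
      = (LBINT t:{w<..<s}. (theta a b w s - theta a b t s) / (t - w) powr (a + 1))"
    by (rule set_lebesgue_integral_cong) (use assms in \<open>auto simp: theta_eq_psi\<close>)
  have I': "a * (LBINT t:{s<..<T}. (t - w) powr (- 1 - a) * t powr (2 * a) * ?rho t s)
      = (LBINT t:{s<..<T}. a * (t - w) powr (- a - 1) * theta a b t s)"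
  proof -
    have e: "- 1 - a = - a - 1" by simp
    have "a * (LBINT t:{s<..<T}. (t - w) powr (- 1 - a) * t powr (2 * a) * ?rho t s)
       = (LBINT t:{s<..<T}. a * ((t - w) powr (- 1 - a) * t powr (2 * a) * ?rho t s))" by simp
    also have "\<dots> = (LBINT t:{s<..<T}. a * (t - w) powr (- a - 1) * theta a b t s)"
      by (rule set_lebesgue_integral_cong) (use assms in \<open>auto simp: theta_eq_rho[symmetric] e\<close>)
    finally show ?thesis .
  qed
  have p: "w powr a * w powr - a = 1" "w powr a * w powr a = w powr (2 * a)"
    using assms powr_add[of w a a] by (simp_all add: powr_minus)
  have "w powr a * K_plus T (a + 1/2) (b + 1/2) w s
      = (s - w) powr - a * ((w powr a * w powr a) * ?psi w s)
        + a * ((w powr a * w powr - a) * (LBINT t:{w<..<s}. (w powr (2 * a) * ?psi w s - t powr (2 * a) * ?psi t s) / (t - w) powr (a + 1)))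
        - (w powr a * w powr - a) * (a * (LBINT t:{s<..<T}. (t - w) powr (- 1 - a) * t powr (2 * a) * ?rho t s))"
    by (simp add: K_plus_def algebra_simps)
  also have "\<dots> = marchaud a s (\<lambda>t. theta a b t s) w
     - (LBINT t:{s<..<T}. a * (t - w) powr (- a - 1) * theta a b t s)"
    unfolding p I I' marchaud_def using assms by (simp add: theta_eq_psi)
  finally show ?thesis .
qed

end

lemma kernel_fubini_abs:
  fixes h :: "real \<Rightarrow> real" and k :: "real \<Rightarrow> real \<Rightarrow> real"
  assumes h: "integrable lborel h"
    and k [measurable]: "case_prod k \<in> borel_measurable (lborel \<Otimes>\<^sub>M lborel)"
    and bound: "column_bound h k u C"
    and "C \<ge> 0"
  shows "(LBINT w. \<bar>\<integral>s. h s * k w s \<partial>lborel\<bar>) \<le> C * (LBINT s. \<bar>h s\<bar>)"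
proof -
  have [measurable]: "h \<in> borel_measurable borel" using h by auto
  have m: "(\<lambda>(w, s). \<bar>k w s\<bar>) \<in> borel_measurable (lborel \<Otimes>\<^sub>M lborel)" by measurable
  have b: "column_bound (\<lambda>s. \<bar>h s\<bar>) (\<lambda>w s. \<bar>k w s\<bar>) u C"
    using bound by (simp add: integrable_abs)
  note F = kernel_fubini[OF h k bound] and G = kernel_fubini[OF integrable_abs[OF h] m b]
  have "(LBINT w. \<bar>\<integral>s. h s * k w s \<partial>lborel\<bar>) \<le> (LBINT w. (LBINT s. \<bar>h s\<bar> * \<bar>k w s\<bar>))"
  proof (rule integral_mono)
    show "integrable lborel (\<lambda>w. \<bar>\<integral>s. h s * k w s \<partial>lborel\<bar>)" by (intro integrable_abs F)
    show "integrable lborel (\<lambda>w. \<integral>s. \<bar>h s\<bar> * \<bar>k w s\<bar> \<partial>lborel)" by (rule G)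
    show "\<bar>\<integral>s. h s * k w s \<partial>lborel\<bar> \<le> (LBINT s. \<bar>h s\<bar> * \<bar>k w s\<bar>)" for w
      using integral_abs_bound[of lborel "\<lambda>s. h s * k w s"] by (simp add: abs_mult)
  qed
  also have "\<dots> = (LBINT s. \<bar>h s\<bar> * (LBINT w. \<bar>k w s\<bar>))" by (rule G)
  also have "\<dots> \<le> (LBINT s. C * \<bar>h s\<bar>)"
  proof (rule integral_mono_AE)
    show "AE s in lborel. \<bar>h s\<bar> * (LBINT w. \<bar>k w s\<bar>) \<le> C * \<bar>h s\<bar>"
      using AE_lborel_singleton[of u]
    proof eventually_elim
      case (elim s)
      show ?case
        using elim bound[rule_format, of s]
        by (cases "h s = 0") (auto simp: mult.commute[of C] mult_left_mono)
    qed
  qed (use h G in auto)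
  finally show ?thesis by simp
qed

context riesz_exponents
begin

context
  fixes T u0 C :: real
  assumes u0: "0 < u0" and T: "u0 < T" and DB: "density_bound u0 T C"
begin

lemma C0: "C \<ge> 0"
  and Cpsi: "0 < v \<Longrightarrow> v < s \<Longrightarrow> s \<le> T \<Longrightarrow> psi_density a b v s \<le> C * (s - v) powr (b - 1)"
  and Cphi: "0 < s \<Longrightarrow> s < v \<Longrightarrow> u0 \<le> v \<Longrightarrow> v \<le> T \<Longrightarrow> T powr (2 * a) * phi_density a b v s \<le> C * (v - s) powr (b - 1)"
  and Ctau: "0 < s \<Longrightarrow> s < v \<Longrightarrow> u0 \<le> v \<Longrightarrow> v \<le> T \<Longrightarrow> T powr (2 * a) * tau_density a b v s \<le> C * (v - s) powr (b - 1)"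
  using DB unfolding density_bound_def by blast+

lemma theta_bound_below:
  assumes "0 < v" "v < s" "s \<le> T"
  shows "\<bar>theta a b v s\<bar> \<le> C * (s - v) powr (b - 1)"
  using Cpsi[OF assms] psi_density_facts(3)[OF assms(1,2)] assms by (simp add: theta_def)

lemma above_bounds:
  assumes "0 < s" "s \<le> p" "u0 \<le> p" "p < v" "v \<le> T" and c: "0 \<le> c" "c \<le> T powr (2 * a)"
  shows "0 \<le> c * phi_density a b v s" "c * phi_density a b v s \<le> C * (v - p) powr (b - 1)"
    and "0 \<le> c * tau_density a b v s" "c * tau_density a b v s \<le> C * (v - p) powr (b - 1)"
proof -
  have "(v - s) powr (b - 1) \<le> (v - p) powr (b - 1)" using assms b by (intro powr_mono2') auto
  then have le: "C * (v - s) powr (b - 1) \<le> C * (v - p) powr (b - 1)" using C0 by (rule mult_left_mono)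
  have pos: "0 \<le> phi_density a b v s" "0 \<le> tau_density a b v s"
    using phi_density_facts(3)[of s v] tau_density_facts(3)[of s v] assms by auto
  show "0 \<le> c * phi_density a b v s" "0 \<le> c * tau_density a b v s" using pos c by auto
  show "c * phi_density a b v s \<le> C * (v - p) powr (b - 1)" "c * tau_density a b v s \<le> C * (v - p) powr (b - 1)"
    using mult_right_mono[OF c(2) pos(1)] mult_right_mono[OF c(2) pos(2)] Cphi[of s v] Ctau[of s v] le assms by auto
qed

lemma theta_bound_above:
  assumes "0 < s" "s \<le> p" "u0 \<le> p" "p < v" "v \<le> T"
  shows "\<bar>theta a b v s\<bar> \<le> 2 * C * (v - p) powr (b - 1)"
proof -
  have "v powr (2 * a) \<le> T powr (2 * a)" using assms a u0 by (intro powr_mono2) auto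
  then show ?thesis using above_bounds[OF assms, of "v powr (2 * a)"] assms by (simp add: theta_def right_diff_distrib)
qed

lemma marchaud_regular_theta_below:
  assumes "0 < u" "u < s" "s \<le> T"
  shows "marchaud_regular a u s (\<lambda>t. theta a b t s) (3 * (C * edge_const T))"
proof (rule marchaud_regular_cong[where g = "\<lambda>t. psi_density a b t s"])
  show "marchaud_regular a u s (\<lambda>t. psi_density a b t s) (3 * (C * edge_const T))"
  proof (rule marchaud_regular_mono[OF a edge_integrable_power(1)])
    show "\<bar>psi_density a b w s\<bar> \<le> C * (s - w) powr (b - 1)" if "u < w" "w < s" for w
      using Cpsi[of w s] psi_density_facts(3)[of w s] that assms by simp
    show "psi_density a b w s \<le> psi_density a b t s" if "u < w" "w < t" "t < s" for w t
      using psi_density_mono[of w t s] that assms by simp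
  qed (use assms C0 in auto)
qed (auto simp: theta_def)

text \<open>Although \<open>phi\<close> decreases, \<open>t powr (2 * a) * phi\<close> need not.  With the constant \<open>T powr (2 * a)\<close> in place of
\<open>t powr (2 * a)\<close> it does, and the correction \<open>(T powr (2 * a) - t powr (2 * a)) * phi\<close> is again decreasing.\<close>

lemma marchaud_regular_theta_above:
  assumes "0 < s" "s \<le> p" "u0 \<le> p" "p < T"
  shows "marchaud_regular a p T (\<lambda>t. theta a b t s) (9 * (C * edge_const T))"
proof -
  let ?g1 = "\<lambda>t. T powr (2 * a) * phi_density a b t s"
  let ?g2 = "\<lambda>t. (T powr (2 * a) - t powr (2 * a)) * phi_density a b t s + t powr (2 * a) * tau_density a b t s"
  have tT: "t powr (2 * a) \<le> T powr (2 * a)" if "p < t" "t < T" for t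
    using that assms a u0 by (intro powr_mono2) auto
  have "marchaud_regular a p T ?g1 (3 * (C * edge_const T))"
  proof (rule marchaud_regular_antimono[OF a edge_integrable_power(2)])
    show "\<bar>?g1 w\<bar> \<le> C * (w - p) powr (b - 1)" if "p < w" "w < T" for w
      using above_bounds[OF assms(1-3), of w "T powr (2 * a)"] that by simp
    show "?g1 t \<le> ?g1 w" if "p < w" "w < t" "t < T" for w t
      using phi_density_antimono[of s w t] that assms by (intro mult_left_mono) auto
  qed (use assms u0 C0 in auto)
  moreover have "marchaud_regular a p T ?g2 (3 * (2 * C * edge_const T))"
  proof (rule marchaud_regular_antimono[OF a edge_integrable_power(2)])
    fix w assume w: "p < w" "w < T"
    show "\<bar>?g2 w\<bar> \<le> 2 * C * (w - p) powr (b - 1)"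
      using above_bounds[OF assms(1-3), of w "T powr (2 * a) - w powr (2 * a)"]
        above_bounds[OF assms(1-3), of w "w powr (2 * a)"] tT[OF w] w by simp
  next
    fix w t assume wt: "p < w" "w < t" "t < T"
    have "w powr (2 * a) \<le> t powr (2 * a)" using wt assms a u0 by (intro powr_mono2) auto
    then have "(T powr (2 * a) - t powr (2 * a)) * phi_density a b t s \<le> (T powr (2 * a) - w powr (2 * a)) * phi_density a b w s"
      using phi_density_antimono[of s w t] phi_density_facts(3)[of s t] tT[of w] wt assms
      by (intro mult_mono) auto
    then show "?g2 t \<le> ?g2 w"
      using tau_density_antimono[of s w t] wt assms by (intro add_mono) auto
  qed (use assms u0 C0 in auto)
  ultimately have "marchaud_regular a p T (\<lambda>t. ?g1 t - ?g2 t) (3 * (C * edge_const T) + 3 * (2 * C * edge_const T))"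
    by (rule marchaud_regular_diff)
  then have "marchaud_regular a p T (\<lambda>t. ?g1 t - ?g2 t) (9 * (C * edge_const T))"
    by (simp add: algebra_simps)
  then show ?thesis
    by (rule marchaud_regular_cong) (use assms in \<open>auto simp: theta_def algebra_simps\<close>)
qed

lemma theta_weight_above:
  assumes "0 < s" "s \<le> p" "u0 \<le> p" "p < T"
  shows "integrable lborel (\<lambda>v. indicator {p<..<T} v * theta a b v s * (v - p) powr - a)"
    and "(LBINT v. \<bar>indicator {p<..<T} v * theta a b v s * (v - p) powr - a\<bar>) \<le> 2 * C * edge_const T"
  using edge_integrable_power(2)[of p T T "2 * C" "\<lambda>v. theta a b v s"] theta_bound_above[OF assms(1-3)] assms u0 C0
  by (auto simp: edge_integrable_def)

lemma theta_weight_below: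
  assumes "0 < u" "u < s" "s \<le> T"
  shows "integrable lborel (\<lambda>v. indicator {u<..<s} v * theta a b v s * (v - u) powr - a)"
    and "(LBINT v. \<bar>indicator {u<..<s} v * theta a b v s * (v - u) powr - a\<bar>) \<le> C * edge_const T"
  using edge_integrable_power(1)[of u s T C "\<lambda>v. theta a b v s"] theta_bound_below[of _ s] assms C0
  by (auto simp: edge_integrable_def)

lemma theta_weight_far:
  assumes "u0 < s" "s < T"
  shows "integrable lborel (\<lambda>v. indicator {s<..<T} v * theta a b v s * (v - u0) powr - a)"
    and "(LBINT v. \<bar>indicator {s<..<T} v * theta a b v s * (v - u0) powr - a\<bar>) \<le> 2 * C * edge_const T"
proof -
  have s: "0 < s" "u0 \<le> s" using assms u0 by auto
  note W = theta_weight_above[OF s(1) order.refl s(2) assms(2)]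
  have le: "\<bar>indicator {s<..<T} v * theta a b v s * (v - u0) powr - a\<bar> \<le> \<bar>indicator {s<..<T} v * theta a b v s * (v - s) powr - a\<bar>" for v
  proof (cases "v \<in> {s<..<T}")
    case True
    have "(v - u0) powr - a \<le> (v - s) powr - a" using True assms a by (intro powr_mono2') auto
    then show ?thesis using True by (simp add: abs_mult mult_left_mono)
  qed simp
  show I: "integrable lborel (\<lambda>v. indicator {s<..<T} v * theta a b v s * (v - u0) powr - a)"
    by (rule Bochner_Integration.integrable_bound[OF W(1)]) (use le in auto)
  have "(LBINT v. \<bar>indicator {s<..<T} v * theta a b v s * (v - u0) powr - a\<bar>) \<le> (LBINT v. \<bar>indicator {s<..<T} v * theta a b v s * (v - s) powr - a\<bar>)"
    by (rule integral_mono[OF integrable_abs[OF I] integrable_abs[OF W(1)] le])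
  then show "(LBINT v. \<bar>indicator {s<..<T} v * theta a b v s * (v - u0) powr - a\<bar>) \<le> 2 * C * edge_const T"
    using W(2) by simp
qed

lemma theta_weight:
  assumes "0 < s" "s < T" "s \<noteq> u0"
  shows "integrable lborel (\<lambda>v. indicator {u0<..<T} v * theta a b v s * (v - u0) powr - a)"
    and "(LBINT v. \<bar>indicator {u0<..<T} v * theta a b v s * (v - u0) powr - a\<bar>) \<le> 3 * (C * edge_const T)"
proof -
  let ?G = "\<lambda>p q v. indicator {p<..<q} v * theta a b v s * (v - u0) powr - a"
  have CE: "0 \<le> C * edge_const T" using C0 edge_const_nonneg by simp
  have "integrable lborel (?G u0 T) \<and> (LBINT v. \<bar>?G u0 T v\<bar>) \<le> 3 * (C * edge_const T)"
  proof (cases "s < u0")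
    case True
    then show ?thesis using theta_weight_above[of s u0] assms T CE by auto
  next
    case False
    then have s: "u0 < s" using assms by simp
    note B = theta_weight_below[OF u0 s less_imp_le[OF assms(2)]] and F = theta_weight_far[OF s assms(2)]
    have eq: "?G u0 T v = ?G u0 s v + ?G s T v" for v
      using s assms by (auto simp: indicator_def theta_def)
    have "integrable lborel (?G u0 T)"
      unfolding eq using B(1) F(1) by (rule Bochner_Integration.integrable_add)
    moreover have "(LBINT v. \<bar>?G u0 T v\<bar>) \<le> (LBINT v. \<bar>?G u0 s v\<bar> + \<bar>?G s T v\<bar>)"
      unfolding eq by (intro integral_mono integrable_abs Bochner_Integration.integrable_add B(1) F(1) abs_triangle_ineq)
    moreover have "(LBINT v. \<bar>?G u0 s v\<bar> + \<bar>?G s T v\<bar>) = (LBINT v. \<bar>?G u0 s v\<bar>) + (LBINT v. \<bar>?G s T v\<bar>)"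
      by (intro Bochner_Integration.integral_add integrable_abs B(1) F(1))
    ultimately show ?thesis using B(2) F(2) by simp
  qed
  then show "integrable lborel (?G u0 T)" "(LBINT v. \<bar>?G u0 T v\<bar>) \<le> 3 * (C * edge_const T)" by auto
qed

text \<open>The last integral of \<open>K_plus\<close>.  The kernel \<open>(t - w) powr (- a - 1)\<close> integrates over \<open>w\<close> to a difference of
the powers \<open>- a\<close> of \<open>t - s\<close> and \<open>t - u0\<close>.\<close>

lemma far_tail:
  assumes "u0 < s" "s < T"
  defines "R \<equiv> \<lambda>w. indicator {u0<..<s} w * (LBINT t:{s<..<T}. a * (t - w) powr (- a - 1) * theta a b t s)"
  shows "has_bochner_integral lborel R
      ((LBINT t. indicator {s<..<T} t * theta a b t s * (t - s) powr - a)
       - (LBINT t. indicator {s<..<T} t * theta a b t s * (t - u0) powr - a))"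
    and "(LBINT w. \<bar>R w\<bar>) \<le> 2 * C * edge_const T"
proof -
  have s: "0 < s" "u0 \<le> s" using assms u0 by auto
  note W = theta_weight_above[OF s(1) order.refl s(2) assms(2)] and F = theta_weight_far[OF assms(1,2)]
  \<comment> \<open>Moving \<open>(t - s) powr a\<close> from \<open>h\<close> to the kernel keeps the integral of the kernel below \<open>1\<close>.\<close>
  define h where "h t = indicator {s<..<T} t * theta a b t s * (t - s) powr - a" for t
  define k where "k w t = (if u0 < w \<and> w < s \<and> s < t then a * (t - w) powr (- a - 1) * (t - s) powr a else 0)" for w t
  have hI: "integrable lborel h" unfolding h_def by (rule W)
  have km: "case_prod k \<in> borel_measurable (lborel \<Otimes>\<^sub>M lborel)"
    unfolding k_def[abs_def] by measurable
  have inv: "(t - s) powr - a * (t - s) powr a = 1" "(t - s) powr a * (t - s) powr - a = 1" if "s < t" for t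
    using that by (simp_all add: powr_minus)
  have kint: "has_bochner_integral lborel (\<lambda>w. k w t) (1 - (t - s) powr a * (t - u0) powr - a)" if t: "s < t" for t
  proof -
    have "has_bochner_integral lborel (\<lambda>w. (t - s) powr a * (indicator {u0<..<s} w * (a * (s - w + (t - s)) powr (- a - 1))))
        ((t - s) powr a * ((t - s) powr - a - (s - u0 + (t - s)) powr - a))"
      by (intro has_bochner_integral_mult_right regularised_kernel_integrals(2)) (use a t assms in auto)
    moreover have "(\<lambda>w. (t - s) powr a * (indicator {u0<..<s} w * (a * (s - w + (t - s)) powr (- a - 1)))) = (\<lambda>w. k w t)"
      using t by (auto simp: k_def fun_eq_iff indicator_def)
    moreover have "(t - s) powr a * ((t - s) powr - a - (s - u0 + (t - s)) powr - a) = 1 - (t - s) powr a * (t - u0) powr - a"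
      using inv[OF t] by (simp add: right_diff_distrib)
    ultimately show ?thesis by simp
  qed
  have k0: "\<bar>k w t\<bar> = k w t" for w t using a by (auto simp: k_def)
  have kb: "column_bound h k s 1"
  proof (intro allI impI)
    fix t assume "h t \<noteq> 0 \<and> t \<noteq> s"
    then have t: "s < t" by (auto simp: h_def indicator_def split: if_splits)
    show "integrable lborel (\<lambda>w. k w t) \<and> (LBINT w. \<bar>k w t\<bar>) \<le> 1"
      using kint[OF t] unfolding k0 by (simp add: has_bochner_integral_iff)
  qed
  have R: "R w = (LBINT t. h t * k w t)" for w
  proof (cases "w \<in> {u0<..<s}")
    case True
    have "h t * k w t = indicator {s<..<T} t *\<^sub>R (a * (t - w) powr (- a - 1) * theta a b t s)" for t
    proof (cases "t \<in> {s<..<T}")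
      case t: True
      have "h t * k w t = theta a b t s * (a * (t - w) powr (- a - 1)) * ((t - s) powr - a * (t - s) powr a)"
        using True t by (simp add: h_def k_def)
      then show ?thesis using t inv[of t] by simp
    qed (simp add: h_def)
    then show ?thesis using True by (simp add: R_def set_lebesgue_integral_def)
  next
    case False
    then show ?thesis by (auto simp: R_def k_def)
  qed
  have R': "R = (\<lambda>w. \<integral>t. h t * k w t \<partial>lborel)" by (rule ext) (rule R)
  have "has_bochner_integral lborel R (LBINT t. h t * (LBINT w. k w t))"
    using kernel_fubini(3,5)[OF hI km kb] by (simp add: has_bochner_integral_iff R')
  also have "(LBINT t. h t * (LBINT w. k w t)) =
     (LBINT t. indicator {s<..<T} t * theta a b t s * (t - s) powr - a - indicator {s<..<T} t * theta a b t s * (t - u0) powr - a)"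
  proof (rule Bochner_Integration.integral_cong[OF refl])
    fix t
    show "h t * (LBINT w. k w t) = indicator {s<..<T} t * theta a b t s * (t - s) powr - a - indicator {s<..<T} t * theta a b t s * (t - u0) powr - a"
    proof (cases "t \<in> {s<..<T}")
      case t: True
      then have t': "s < t" by simp
      have "h t * (LBINT w. k w t) = theta a b t s * (t - s) powr - a - theta a b t s * ((t - s) powr a * (t - s) powr - a) * (t - u0) powr - a"
        unfolding has_bochner_integral_integral_eq[OF kint[OF t']] using t by (simp add: h_def algebra_simps)
      then show ?thesis unfolding inv[OF t'] using t by simp
    qed (simp add: h_def)
  qed
  also have "\<dots> = (LBINT t. indicator {s<..<T} t * theta a b t s * (t - s) powr - a)
       - (LBINT t. indicator {s<..<T} t * theta a b t s * (t - u0) powr - a)"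
    by (rule Bochner_Integration.integral_diff[OF W(1) F(1)])
  finally show "has_bochner_integral lborel R
      ((LBINT t. indicator {s<..<T} t * theta a b t s * (t - s) powr - a)
       - (LBINT t. indicator {s<..<T} t * theta a b t s * (t - u0) powr - a))" .
  show "(LBINT w. \<bar>R w\<bar>) \<le> 2 * C * edge_const T"
    using kernel_fubini_abs[OF hI km kb] W(2) by (simp add: R h_def)
qed

text \<open>For \<open>s < u0\<close> this is the regularity of \<open>theta\<close> on \<open>(u0,T)\<close>.  For \<open>u0 < s\<close> the interval is cut at \<open>s\<close>.
The part behind \<open>s\<close> contributes the weight \<open>(t - s) powr - a\<close>, and the far tail exchanges it for the
weight \<open>(t - u0) powr - a\<close> that belongs to the whole interval.\<close>

lemma has_bochner_integral_K_kernel: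
  assumes "0 < s" "s < T" "s \<noteq> u0"
  shows "has_bochner_integral lborel (\<lambda>w. indicator {u0<..<T} w * (w powr a * K_kernel T (a + 1/2) (b + 1/2) w s))
       (LBINT v. indicator {u0<..<T} v * theta a b v s * (v - u0) powr - a)"
    and "(LBINT w. \<bar>indicator {u0<..<T} w * (w powr a * K_kernel T (a + 1/2) (b + 1/2) w s)\<bar>) \<le> 14 * (C * edge_const T)"
proof -
  let ?F = "\<lambda>w. indicator {u0<..<T} w * (w powr a * K_kernel T (a + 1/2) (b + 1/2) w s)"
  let ?I = "\<lambda>p q x. \<integral>v. indicator {p<..<q} v * theta a b v s * (v - x) powr - a \<partial>lborel"
  let ?D = "\<lambda>p q w. indicator {p<..<q} w * marchaud a q (\<lambda>t. theta a b t s) w"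
  have CE: "0 \<le> C * edge_const T" using C0 edge_const_nonneg by simp
  have "has_bochner_integral lborel ?F (?I u0 T u0) \<and> (LBINT w. \<bar>?F w\<bar>) \<le> 14 * (C * edge_const T)"
  proof (cases "s < u0")
    case True
    have eq: "?F w = ?D u0 T w" for w
      using True K_minus_eq[OF assms(1)] by (auto simp: indicator_def K_kernel_def)
    show ?thesis
      unfolding eq using marchaud_regular_theta_above[of s u0] assms True T CE
      by (auto simp: marchaud_regular_def)
  next
    case False
    then have s: "u0 < s" using assms by simp
    define R where "R \<equiv> \<lambda>w. indicator {u0<..<s} w * (LBINT t:{s<..<T}. a * (t - w) powr (- a - 1) * theta a b t s)"
    note M1 = marchaud_regular_theta_below[OF u0 s less_imp_le[OF assms(2)], unfolded marchaud_regular_def]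
    note M2 = marchaud_regular_theta_above[OF assms(1) order.refl less_imp_le[OF s] assms(2), unfolded marchaud_regular_def]
    have R: "has_bochner_integral lborel R (?I s T s - ?I s T u0)" "(LBINT w. \<bar>R w\<bar>) \<le> 2 * C * edge_const T"
      unfolding R_def by (rule far_tail[OF s assms(2)])+
    have eq: "?F w = ?D u0 s w - R w + ?D s T w" for w
    proof -
      consider "w \<le> u0 \<or> T \<le> w \<or> w = s" | "u0 < w" "w < s" | "s < w" "w < T" by linarith
      then show ?thesis
      proof cases
        case 1
        then show ?thesis using s assms by (auto simp: indicator_def R_def K_kernel_def)
      next
        case 2
        then show ?thesis using K_plus_eq[of w s T] assms u0 by (simp add: R_def K_kernel_def)
      next
        case 3
        then show ?thesis using K_minus_eq[of s w T] assms s by (simp add: R_def K_kernel_def)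
      qed
    qed
    note B = theta_weight_below[OF u0 s less_imp_le[OF assms(2)]] and F = theta_weight_far[OF s assms(2)]
    have H: "has_bochner_integral lborel ?F (?I u0 s u0 - (?I s T s - ?I s T u0) + ?I s T s)"
      unfolding eq using M1 M2 R(1) by (intro has_bochner_integral_add has_bochner_integral_diff) auto
    have "indicator {u0<..<T} v * theta a b v s * (v - u0) powr - a
       = indicator {u0<..<s} v * theta a b v s * (v - u0) powr - a + indicator {s<..<T} v * theta a b v s * (v - u0) powr - a" for v
      using s assms by (auto simp: indicator_def theta_def)
    then have "?I u0 T u0 = ?I u0 s u0 + ?I s T u0"
      using Bochner_Integration.integral_add[OF B(1) F(1)] by simp
    then have H: "has_bochner_integral lborel ?F (?I u0 T u0)" using H by simp
    have I: "integrable lborel (?D u0 s)" "integrable lborel R" "integrable lborel (?D s T)"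
      using M1 M2 R(1) by (auto simp: has_bochner_integral_iff)
    have "(LBINT w. \<bar>?F w\<bar>) \<le> (LBINT w. \<bar>?D u0 s w\<bar> + \<bar>R w\<bar> + \<bar>?D s T w\<bar>)"
    proof (rule integral_mono)
      show "integrable lborel (\<lambda>w. \<bar>?F w\<bar>)" using H by (intro integrable_abs) (simp add: has_bochner_integral_iff)
      show "integrable lborel (\<lambda>w. \<bar>?D u0 s w\<bar> + \<bar>R w\<bar> + \<bar>?D s T w\<bar>)"
        using I by (intro Bochner_Integration.integrable_add integrable_abs)
      show "\<bar>?F w\<bar> \<le> \<bar>?D u0 s w\<bar> + \<bar>R w\<bar> + \<bar>?D s T w\<bar>" for w
        unfolding eq by linarith
    qed
    also have "\<dots> = (LBINT w. \<bar>?D u0 s w\<bar>) + (LBINT w. \<bar>R w\<bar>) + (LBINT w. \<bar>?D s T w\<bar>)"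
      using I by (subst Bochner_Integration.integral_add Bochner_Integration.integral_add; (intro Bochner_Integration.integrable_add integrable_abs)?; simp)+
    also have "\<dots> \<le> 14 * (C * edge_const T)" using M1 M2 R(2) by simp
    finally show ?thesis using H by simp
  qed
  then show "has_bochner_integral lborel ?F (?I u0 T u0)" "(LBINT w. \<bar>?F w\<bar>) \<le> 14 * (C * edge_const T)" by auto
qed

end

end

section \<open>Factorisation of the Riesz kernel\<close>

lemma moebius_integrand:
  fixes a s t x y D M :: real
  assumes "0 < s" "0 < t" "0 < D" "0 < M" "0 < x" "0 < y"
  shows "(s * t * x / D) powr (- 2 * a) * (t * M / D) powr (a - 1) * (s * M * y / D) powr (a - 1) * (s * t * M / D\<^sup>2)
     = (s * t) powr - a * M powr (2 * a - 1) * (x powr (- 2 * a) * y powr (a - 1))"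
proof -
  have e: "s * t * M / D\<^sup>2 = exp (ln s + ln t + ln M - 2 * ln D)"
    using assms by (simp add: exp_add exp_diff exp_double)
  show ?thesis
    unfolding e using assms by (simp add: powr_def ln_mult ln_div mult_exp_exp algebra_simps)
qed

text \<open>The Moebius map \<open>x \<mapsto> s t x / (t - s + s x)\<close> sends \<open>(0,1)\<close> to \<open>(0,s)\<close>; under it both \<open>t - v\<close> and \<open>s - v\<close> are
monomials in \<open>1 - x\<close> and the denominator, and the powers of the denominator cancel.\<close>

lemma nn_integral_riesz_factorisation:
  fixes a s t :: real
  assumes "0 < a" "a < 1/2" "0 < s" "s < t"
  shows "(\<integral>\<^sup>+v. ennreal (indicator {0<..<s} v * (v powr (- 2 * a) * (t - v) powr (a - 1) * (s - v) powr (a - 1))) \<partial>lborel)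
    = ennreal ((s * t) powr - a * (t - s) powr (2 * a - 1) * Beta (1 - 2 * a) a)"
proof -
  define d where "d x = t - s + s * x" for x
  define g where "g x = s * t * x / d x" for x
  define g' where "g' x = s * t * (t - s) / (d x)\<^sup>2" for x
  define f where "f v = v powr (- 2 * a) * (t - v) powr (a - 1) * (s - v) powr (a - 1)" for v
  have [measurable]: "f \<in> borel_measurable borel" unfolding f_def by measurable
  have dpos: "d x > 0" if "0 \<le> x" for x unfolding d_def using that assms by (intro add_pos_nonneg) auto
  have g01: "g 0 = 0" "g 1 = s" using assms by (auto simp: g_def d_def)
  have "(\<integral>\<^sup>+v. ennreal (indicator {0<..<s} v * f v) \<partial>lborel) = (\<integral>\<^sup>+v. ennreal (f v * indicator {g 0..g 1} v) \<partial>lborel)"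
    unfolding g01 by (rule nn_integral_cong) (auto simp: indicator_def f_def)
  also have "\<dots> = (\<integral>\<^sup>+x. ennreal (f (g x) * g' x * indicator {0..1} x) \<partial>lborel)"
  proof (rule nn_integral_substitution)
    show "set_borel_measurable borel {g 0..g 1} f" unfolding set_borel_measurable_def by measurable
    fix x :: real assume x: "x \<in> {0..1}"
    have "((\<lambda>x. s * t * x / d x) has_real_derivative ((s * t) * d x - s * t * x * s) / (d x * d x)) (at x)"
      unfolding d_def using dpos[of x] x by (auto intro!: derivative_eq_intros simp: d_def)
    moreover have "((s * t) * d x - s * t * x * s) / (d x * d x) = g' x"
      by (simp add: g'_def d_def power2_eq_square algebra_simps)
    ultimately show "(g has_real_derivative g' x) (at x)" unfolding g_def by simp
    show "0 \<le> g' x" using assms by (simp add: g'_def)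
  next
    have "d x \<noteq> 0" if "x \<in> {0..1}" for x using dpos[of x] that by simp
    then show "continuous_on {0..1} g'"
      unfolding g'_def d_def by (intro continuous_intros) auto
  qed simp
  also have "\<dots> = (\<integral>\<^sup>+x. ennreal ((s * t) powr - a * (t - s) powr (2 * a - 1)) * ennreal (indicator {0<..<1} x * ((x - 0) powr (1 - 2 * a - 1) * (1 - x) powr (a - 1))) \<partial>lborel)"
  proof (rule nn_integral_cong)
    fix x :: real
    have s1: "s - g x = s * (t - s) * (1 - x) / d x" "t - g x = t * (t - s) / d x" if "0 \<le> x"
    proof -
      have "s * d x - s * t * x = s * (t - s) * (1 - x)" "t * d x - s * t * x = t * (t - s)"
        by (simp_all add: d_def algebra_simps)
      then show "s - g x = s * (t - s) * (1 - x) / d x" "t - g x = t * (t - s) / d x"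
        unfolding g_def using dpos[OF that] by (simp_all add: field_simps)
    qed
    show "ennreal (f (g x) * g' x * indicator {0..1} x)
      = ennreal ((s * t) powr - a * (t - s) powr (2 * a - 1)) * ennreal (indicator {0<..<1} x * ((x - 0) powr (1 - 2 * a - 1) * (1 - x) powr (a - 1)))"
    proof (cases "0 < x \<and> x < 1")
      case True
      have "f (g x) * g' x = (s * t) powr - a * (t - s) powr (2 * a - 1) * (x powr (- 2 * a) * (1 - x) powr (a - 1))"
        unfolding f_def s1[OF less_imp_le[OF conjunct1[OF True]]] g'_def unfolding g_def
        by (rule moebius_integrand) (use assms dpos True in auto)
      then show ?thesis using True by (simp add: ennreal_mult)
    next
      case False
      then have z: "f (g x) * g' x * indicator {0..1} x = 0"
        using g01 by (cases "x = 0 \<or> x = 1") (auto simp: f_def)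
      show ?thesis unfolding z using False by simp
    qed
  qed
  also have "\<dots> = ennreal ((s * t) powr - a * (t - s) powr (2 * a - 1)) * ennreal ((1 - 0) powr (1 - 2 * a + a - 1) * Beta (1 - 2 * a) a)"
    by (subst nn_integral_cmult, measurable, subst nn_integral_beta) (use assms in auto)
  also have "\<dots> = ennreal ((s * t) powr - a * (t - s) powr (2 * a - 1) * Beta (1 - 2 * a) a)"
    using Beta_pos[of "1 - 2 * a" a] assms by (simp add: ennreal_mult)
  finally show ?thesis by (simp add: f_def)
qed

text \<open>The kernel of a right-sided Abel operator composed with multiplication by \<open>s powr a\<close>.\<close>

definition right_kernel :: "real \<Rightarrow> real \<Rightarrow> real \<Rightarrow> real" where
  "right_kernel a v s = (if 0 < v \<and> v < s then s powr a * (s - v) powr (a - 1) else 0)"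

lemma right_kernel_measurable [measurable]:
  assumes [measurable]: "f \<in> borel_measurable M" "g \<in> borel_measurable M"
  shows "(\<lambda>x. right_kernel a (f x) (g x)) \<in> borel_measurable M"
  unfolding right_kernel_def by measurable

lemma right_kernel_nonneg: "right_kernel a v s \<ge> 0"
  by (simp add: right_kernel_def)

context
  fixes a :: real
  assumes a: "0 < a" and a2: "a < 1/2"
begin

text \<open>Up to a beta factor, the Riesz kernel of exponent \<open>2 * a - 1\<close> is the square of the right Abel kernel
with respect to the weight \<open>v powr (- 2 * a)\<close>.\<close>

lemma riesz_factorisation:
  assumes "0 < s" "0 < t" "s \<noteq> t"
  shows "(\<integral>\<^sup>+v. ennreal (v powr (- 2 * a) * right_kernel a v s * right_kernel a v t) \<partial>lborel)
    = ennreal (Beta (1 - 2 * a) a * \<bar>t - s\<bar> powr (2 * a - 1))"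
proof -
  have main: "(\<integral>\<^sup>+v. ennreal (v powr (- 2 * a) * right_kernel a v x * right_kernel a v y) \<partial>lborel)
      = ennreal (Beta (1 - 2 * a) a * (y - x) powr (2 * a - 1))" if "0 < x" "x < y" for x y
  proof -
    have "(\<integral>\<^sup>+v. ennreal (v powr (- 2 * a) * right_kernel a v x * right_kernel a v y) \<partial>lborel)
      = (\<integral>\<^sup>+v. ennreal (x powr a * y powr a) * ennreal (indicator {0<..<x} v * (v powr (- 2 * a) * (y - v) powr (a - 1) * (x - v) powr (a - 1))) \<partial>lborel)"
      using that by (intro nn_integral_cong) (auto simp: right_kernel_def indicator_def ennreal_mult[symmetric] mult_ac)
    also have "\<dots> = ennreal (x powr a * y powr a) * ennreal ((x * y) powr - a * (y - x) powr (2 * a - 1) * Beta (1 - 2 * a) a)"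
      by (subst nn_integral_cmult, measurable, subst nn_integral_riesz_factorisation) (use that a a2 in auto)
    also have "\<dots> = ennreal ((x powr a * x powr - a) * (y powr a * y powr - a) * (y - x) powr (2 * a - 1) * Beta (1 - 2 * a) a)"
      using that Beta_pos[of "1 - 2 * a" a] a a2 by (simp add: ennreal_mult[symmetric] powr_mult mult_ac)
    also have "(x powr a * x powr - a) * (y powr a * y powr - a) = 1" using that by (simp add: powr_minus)
    finally show ?thesis by (simp add: mult.commute)
  qed
  show ?thesis
    using main[of s t] main[of t s] assms by (cases "s < t") (auto simp: mult_ac abs_if)
qed

text \<open>Inserting the factorisation and integrating over \<open>t\<close> first, Abel's identity
\<open>\<integral> (u - t)^(-a) (t - v)^(a-1) dt = B(1 - a, a)\<close> over \<open>(v,u)\<close> removes the left Abel operator.\<close>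

lemma abel_of_riesz:
  assumes "0 < u" "0 < s"
  defines "I \<equiv> \<lambda>t. riesz_abel_integrand a a u s t"
  shows "integrable lborel I"
    and "integrable lborel (\<lambda>v. indicator {0<..<u} v * (v powr (- 2 * a) * right_kernel a v s))"
    and "integral\<^sup>L lborel I = Beta (1 - a) a / Beta (1 - 2 * a) a * (LBINT v. indicator {0<..<u} v * (v powr (- 2 * a) * right_kernel a v s))"
    and "integral\<^sup>L lborel I \<le> 2 * (Beta (1 - a) a + Beta a (1 - a))"
proof -
  have Bp: "Beta (1 - a) a > 0" "Beta (1 - 2 * a) a > 0" "Beta a (1 - a) > 0" using a a2 by (auto intro!: Beta_pos)
  have I0: "I t \<ge> 0" for t by (simp add: I_def)
  have [measurable]: "I \<in> borel_measurable borel" unfolding I_def by measurable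
  show II: "integrable lborel I" and "integral\<^sup>L lborel I \<le> 2 * (Beta (1 - a) a + Beta a (1 - a))"
    unfolding I_def using riesz_abel_bound[of a a u s] a a2 assms by simp_all
  let ?X = "\<lambda>v. indicator {0<..<u} v * (v powr (- 2 * a) * right_kernel a v s)"
  have X0: "?X v \<ge> 0" for v by (simp add: right_kernel_nonneg)
  let ?w = "\<lambda>t. indicator {0<..<u} t * ((u - t) powr - a * t powr - a)"
  have "ennreal (Beta (1 - 2 * a) a) * (\<integral>\<^sup>+t. ennreal (I t) \<partial>lborel)
    = (\<integral>\<^sup>+t. ennreal (?w t) * ennreal (Beta (1 - 2 * a) a * \<bar>t - s\<bar> powr (2 * a - 1)) \<partial>lborel)"
    using Bp by (subst nn_integral_cmult[symmetric]) (auto simp: I_def ennreal_mult[symmetric] mult_ac intro!: nn_integral_cong)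
  also have "\<dots> = (\<integral>\<^sup>+t. (\<integral>\<^sup>+v. ennreal (?w t) * ennreal (v powr (- 2 * a) * right_kernel a v s * right_kernel a v t) \<partial>lborel) \<partial>lborel)"
  proof (rule nn_integral_cong_AE)
    show "AE t in lborel. ennreal (?w t) * ennreal (Beta (1 - 2 * a) a * \<bar>t - s\<bar> powr (2 * a - 1))
      = (\<integral>\<^sup>+v. ennreal (?w t) * ennreal (v powr (- 2 * a) * right_kernel a v s * right_kernel a v t) \<partial>lborel)"
      using AE_lborel_singleton[of s]
    proof eventually_elim
      case (elim t)
      show ?case
      proof (cases "t \<in> {0<..<u}")
        case True
        then show ?thesis
          using riesz_factorisation[of s t] elim assms by (subst nn_integral_cmult) auto
      qed simp
    qed
  qed
  also have "\<dots> = (\<integral>\<^sup>+v. (\<integral>\<^sup>+t. ennreal (?w t) * ennreal (v powr (- 2 * a) * right_kernel a v s * right_kernel a v t) \<partial>lborel) \<partial>lborel)"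
    by (rule lborel_pair.Fubini') measurable
  also have "\<dots> = (\<integral>\<^sup>+v. ennreal (Beta (1 - a) a) * ennreal (?X v) \<partial>lborel)"
  proof (rule nn_integral_cong)
    fix v
    show "(\<integral>\<^sup>+t. ennreal (?w t) * ennreal (v powr (- 2 * a) * right_kernel a v s * right_kernel a v t) \<partial>lborel) = ennreal (Beta (1 - a) a) * ennreal (?X v)"
    proof (cases "0 < v \<and> v < u")
      case True
      have inv: "t powr - a * t powr a = 1" if "0 < t" for t using that by (simp add: powr_minus)
      have "ennreal (?w t) * ennreal (v powr (- 2 * a) * right_kernel a v s * right_kernel a v t)
        = ennreal (?X v) * ennreal (indicator {v<..<u} t * ((t - v) powr (a - 1) * (u - t) powr (1 - a - 1)))" for t
      proof (cases "t \<in> {v<..<u}")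
        case t: True
        have "?w t * (v powr (- 2 * a) * right_kernel a v s * right_kernel a v t)
           = (v powr (- 2 * a) * right_kernel a v s) * ((t powr - a * t powr a) * ((t - v) powr (a - 1) * (u - t) powr - a))"
          using t True unfolding right_kernel_def[of a v t] by (simp add: mult_ac)
        also have "t powr - a * t powr a = 1" using t True by (intro inv) auto
        finally have "?w t * (v powr (- 2 * a) * right_kernel a v s * right_kernel a v t)
           = ?X v * (indicator {v<..<u} t * ((t - v) powr (a - 1) * (u - t) powr (1 - a - 1)))"
          using t True by simp
        then show ?thesis
          by (subst (1 2) ennreal_mult[symmetric]) (simp_all add: right_kernel_nonneg)
      next
        case False
        then show ?thesis by (auto simp: right_kernel_def indicator_def)
      qed
      then have "(\<integral>\<^sup>+t. ennreal (?w t) * ennreal (v powr (- 2 * a) * right_kernel a v s * right_kernel a v t) \<partial>lborel)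
        = (\<integral>\<^sup>+t. ennreal (?X v) * ennreal (indicator {v<..<u} t * ((t - v) powr (a - 1) * (u - t) powr (1 - a - 1))) \<partial>lborel)"
        by (simp only:)
      also have "\<dots> = ennreal (?X v) * ennreal ((u - v) powr (a + (1 - a) - 1) * Beta a (1 - a))"
        by (subst nn_integral_cmult, measurable, subst nn_integral_beta) (use True a a2 in auto)
      finally have "(\<integral>\<^sup>+t. ennreal (?w t) * ennreal (v powr (- 2 * a) * right_kernel a v s * right_kernel a v t) \<partial>lborel)
        = ennreal (?X v) * ennreal ((u - v) powr (a + (1 - a) - 1) * Beta a (1 - a))" .
      then show ?thesis using True a Bp by (simp add: Beta_commute mult.commute)
    next
      case False
      then have z: "ennreal (?w t) * ennreal (v powr (- 2 * a) * right_kernel a v s * right_kernel a v t) = 0" for t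
        by (auto simp: right_kernel_def indicator_def)
      show ?thesis unfolding z using False by simp
    qed
  qed
  also have "\<dots> = ennreal (Beta (1 - a) a) * (\<integral>\<^sup>+v. ennreal (?X v) \<partial>lborel)"
    by (rule nn_integral_cmult) measurable
  finally have eq: "ennreal (Beta (1 - 2 * a) a) * (\<integral>\<^sup>+t. ennreal (I t) \<partial>lborel) = ennreal (Beta (1 - a) a) * (\<integral>\<^sup>+v. ennreal (?X v) \<partial>lborel)" .
  have "ennreal (Beta (1 - a) a) * (\<integral>\<^sup>+v. ennreal (?X v) \<partial>lborel) < \<infinity>"
    unfolding eq[symmetric] nn_integral_eq_integral[OF II AE_I2[OF I0]] by (simp add: ennreal_mult_less_top)
  then have "(\<integral>\<^sup>+v. ennreal (?X v) \<partial>lborel) < \<infinity>"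
    using Bp by (auto simp: ennreal_mult_less_top)
  then show XI: "integrable lborel ?X"
    by (intro integrableI_nonneg) (use X0 in auto)
  have "Beta (1 - 2 * a) a * integral\<^sup>L lborel I = Beta (1 - a) a * integral\<^sup>L lborel ?X"
    using eq unfolding nn_integral_eq_integral[OF II AE_I2[OF I0]] nn_integral_eq_integral[OF XI AE_I2[OF X0]]
    using Bp I0 X0 by (simp add: ennreal_mult[symmetric] Bochner_Integration.integral_nonneg)
  then show "integral\<^sup>L lborel I = Beta (1 - a) a / Beta (1 - 2 * a) a * integral\<^sup>L lborel ?X"
    using Bp by (simp add: field_simps)
qed

end

section \<open>The two Abel inversions\<close>

lemma marchaud_theta_measurable:
  assumes [measurable]: "q \<in> borel_measurable M" "s \<in> borel_measurable M" "w \<in> borel_measurable M"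
  shows "(\<lambda>x. marchaud a (q x) (\<lambda>t. theta a b t (s x)) (w x)) \<in> borel_measurable M"
proof -
  have "(\<lambda>x. marchaud a (q x) (\<lambda>t. theta a b t (s x)) (w x)) = (\<lambda>x. (q x - w x) powr - a * theta a b (w x) (s x)
     + a * (LBINT t. (if w x < t \<and> t < q x then (theta a b (w x) (s x) - theta a b t (s x)) / (t - w x) powr (a + 1) else 0)))"
    by (auto simp: marchaud_def fun_eq_iff set_lebesgue_integral_def indicator_def intro!: Bochner_Integration.integral_cong)
  then show ?thesis by simp
qed

text \<open>The solution is extended by \<open>0\<close> outside \<open>(0,T)\<close>, so that integrals over the whole line can be used.\<close>

locale mixed_equation = riesz_exponents +
  fixes T k1 k2 :: real and h :: "real \<Rightarrow> real"
  assumes T: "0 < T"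
    and h: "integrable lborel h"
    and supp: "\<And>s. s \<notin> {0<..<T} \<Longrightarrow> h s = 0"
    and eqn: "AE t in lborel. t \<in> {0<..<T} \<longrightarrow>
      k1 * (LBINT s. h s * \<bar>t - s\<bar> powr (2 * a - 1)) + k2 * (LBINT s. h s * \<bar>t - s\<bar> powr (2 * b - 1)) = 1"
begin

lemma a2: "a < 1/2" using ab b by simp

abbreviation "rk \<equiv> right_kernel a"

definition right_abel :: "real \<Rightarrow> real" where "right_abel v = (LBINT s. h s * rk v s)"
definition theta_transform :: "real \<Rightarrow> real" where "theta_transform v = (LBINT s. h s * theta a b v s)"
definition abel_ratio :: real where "abel_ratio = Beta (1 - a) a / Beta (1 - 2 * a) a"
text \<open>The transformed right-hand side \<open>u powr (1 - 2 * a) * Beta (1 - a) (1 - a)\<close> has the derivative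
\<open>rhs_const * u powr (- 2 * a)\<close>.\<close>

definition rhs_const :: real where "rhs_const = (1 - 2 * a) * Beta (1 - a) (1 - a)"

lemma h_nz: "h s \<noteq> 0 \<Longrightarrow> 0 < s \<and> s < T"
  using supp[of s] by auto

lemma abel_transformed_equation:
  assumes u: "0 < u" "u \<le> T"
  shows "k1 * (LBINT s. h s * (LBINT t. riesz_abel_integrand a a u s t))
    + k2 * (LBINT s. h s * riesz_abel u s) = u powr (1 - 2 * a) * Beta (1 - a) (1 - a)"
proof -
  let ?w = "\<lambda>t. indicator {0<..<u} t * (u - t) powr - a * t powr - a"
  let ?k = "\<lambda>c t s. riesz_abel_integrand a c u s t"
  have m: "case_prod (?k c) \<in> borel_measurable (lborel \<Otimes>\<^sub>M lborel)" for c by measurable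
  have bd: "\<exists>C. column_bound h (?k c) 0 C" if "a \<le> c" "c < 1/2" for c
    using riesz_abel_bound[of a c u] h_nz that a u
    by (intro exI[of _ "2 * u powr (2 * c - 2 * a) * (Beta (1 - a) (2 * c - a) + Beta (2 * c - a) (1 - a))"]) auto
  obtain C1 where C1: "column_bound h (?k a) 0 C1" using bd[OF order.refl a2] by blast
  obtain C2 where C2: "column_bound h (?k b) 0 C2" using bd[OF less_imp_le[OF ab] b] by blast
  note F1 = kernel_fubini[OF h m C1] and F2 = kernel_fubini[OF h m C2]
  have pull: "(LBINT s. h s * ?k c t s) = ?w t * (LBINT s. h s * \<bar>t - s\<bar> powr (2 * c - 1))" for c t
    by (subst integral_mult_right_zero[symmetric]) (simp add: mult_ac)
  have "k1 * (LBINT s. h s * (LBINT t. ?k a t s)) + k2 * (LBINT s. h s * (LBINT t. ?k b t s))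
    = (LBINT t. k1 * (LBINT s. h s * ?k a t s) + k2 * (LBINT s. h s * ?k b t s))"
    using F1(3) F2(3) by (subst Bochner_Integration.integral_add) (simp_all add: F1(5)[symmetric] F2(5)[symmetric])
  also have "\<dots> = (LBINT t. indicator {0<..<u} t * ((t - 0) powr (1 - a - 1) * (u - t) powr (1 - a - 1)))"
  proof (rule integral_cong_AE)
    show "AE t in lborel. k1 * (LBINT s. h s * ?k a t s) + k2 * (LBINT s. h s * ?k b t s)
       = indicator {0<..<u} t * ((t - 0) powr (1 - a - 1) * (u - t) powr (1 - a - 1))"
      using eqn
    proof eventually_elim
      case (elim t)
      have "k1 * (LBINT s. h s * ?k a t s) + k2 * (LBINT s. h s * ?k b t s)
        = ?w t * (k1 * (LBINT s. h s * \<bar>t - s\<bar> powr (2 * a - 1)) + k2 * (LBINT s. h s * \<bar>t - s\<bar> powr (2 * b - 1)))"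
        unfolding pull by (simp add: algebra_simps)
      also have "\<dots> = ?w t" using elim u by (cases "t \<in> {0<..<u}") auto
      finally show ?case by (simp add: mult_ac)
    qed
  qed (use F1(3) F2(3) in auto)
  also have "\<dots> = u powr (1 - 2 * a) * Beta (1 - a) (1 - a)"
    using has_bochner_integral_integral_eq[OF has_bochner_integral_beta[of 0 u "1 - a" "1 - a"]] u a a2
    by (simp add: algebra_simps)
  finally show ?thesis by (simp only: riesz_abel_def)
qed

lemma right_kernel_side:
  assumes u: "0 < u" "u \<le> T"
  shows "integrable lborel (\<lambda>v. indicator {0<..<u} v * (v powr (- 2 * a) * right_abel v))"
    and "(LBINT s. h s * (LBINT t. riesz_abel_integrand a a u s t))
      = abel_ratio * (LBINT v. indicator {0<..<u} v * (v powr (- 2 * a) * right_abel v))"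
proof -
  let ?k = "\<lambda>v s. indicator {0<..<u} v * (v powr (- 2 * a) * rk v s)"
  note R = abel_of_riesz[OF a a2 u(1)]
  define C where "C = 2 * (Beta (1 - a) a + Beta a (1 - a)) / abel_ratio"
  have Bp: "Beta (1 - a) a > 0" "Beta (1 - 2 * a) a > 0" using a a2 by (auto intro!: Beta_pos)
  then have abel_ratio: "abel_ratio > 0" by (simp add: abel_ratio_def)
  have bd: "column_bound h ?k 0 C"
  proof (intro allI impI conjI; elim conjE)
    fix s assume "h s \<noteq> 0"
    then have s: "0 < s" using h_nz by blast
    show "integrable lborel (\<lambda>v. ?k v s)" by (rule R(2)[OF s])
    have "\<bar>?k v s\<bar> = ?k v s" for v by (simp add: right_kernel_nonneg)
    moreover have "abel_ratio * integral\<^sup>L lborel (\<lambda>v. ?k v s) \<le> 2 * (Beta (1 - a) a + Beta a (1 - a))"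
      using R(3)[OF s] R(4)[OF s] by (simp add: abel_ratio_def)
    ultimately show "(LBINT v. \<bar>?k v s\<bar>) \<le> C"
      using abel_ratio by (simp add: C_def pos_le_divide_eq mult.commute)
  qed
  have m: "case_prod ?k \<in> borel_measurable (lborel \<Otimes>\<^sub>M lborel)"
    by measurable
  note F = kernel_fubini[OF h m bd]
  have pull: "(LBINT s. h s * ?k v s) = indicator {0<..<u} v * (v powr (- 2 * a) * right_abel v)" for v
    unfolding right_abel_def by (simp add: mult.left_commute[of "h _"])
  show "integrable lborel (\<lambda>v. indicator {0<..<u} v * (v powr (- 2 * a) * right_abel v))"
    using F(3) unfolding pull .
  have "(LBINT s. h s * (LBINT t. riesz_abel_integrand a a u s t))
    = (LBINT s. abel_ratio * (h s * (LBINT v. ?k v s)))"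
  proof (rule Bochner_Integration.integral_cong[OF refl])
    fix s
    show "h s * (LBINT t. riesz_abel_integrand a a u s t)
      = abel_ratio * (h s * (LBINT v. ?k v s))"
      using R(3)[of s] h_nz[of s] by (cases "h s = 0") (auto simp: abel_ratio_def)
  qed
  also have "\<dots> = abel_ratio * (LBINT v. indicator {0<..<u} v * (v powr (- 2 * a) * right_abel v))"
    using F(5) unfolding pull by simp
  finally show "(LBINT s. h s * (LBINT t. riesz_abel_integrand a a u s t))
      = abel_ratio * (LBINT v. indicator {0<..<u} v * (v powr (- 2 * a) * right_abel v))" .
qed

lemma theta_side:
  assumes u: "0 < u" "u \<le> T"
  shows "integrable lborel (\<lambda>v. indicator {0<..<u} v * (v powr (- 2 * a) * theta_transform v))"
    and "(LBINT s. h s * riesz_abel u s) = (LBINT v. indicator {0<..<u} v * (v powr (- 2 * a) * theta_transform v))"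
proof -
  let ?k = "\<lambda>v s. indicator {0<..<u} v * (v powr (- 2 * a) * theta a b v s)"
  have bd: "column_bound h ?k u (3 * riesz_abel_const u)"
    using has_bochner_integral_theta[of _ u] h_nz u by (auto simp: has_bochner_integral_iff)
  have m: "case_prod ?k \<in> borel_measurable (lborel \<Otimes>\<^sub>M lborel)" by measurable
  note F = kernel_fubini[OF h m bd]
  have pull: "(LBINT s. h s * ?k v s) = indicator {0<..<u} v * (v powr (- 2 * a) * theta_transform v)" for v
    unfolding theta_transform_def by (simp add: mult.left_commute[of "h _"])
  show "integrable lborel (\<lambda>v. indicator {0<..<u} v * (v powr (- 2 * a) * theta_transform v))"
    using F(3) unfolding pull .
  have "(LBINT s. h s * riesz_abel u s) = (LBINT s. h s * (LBINT v. ?k v s))"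
  proof (rule integral_cong_AE)
    show "AE s in lborel. h s * riesz_abel u s = h s * (LBINT v. ?k v s)"
      using AE_lborel_singleton[of u]
    proof eventually_elim
      case (elim s)
      show ?case
      proof (cases "h s = 0")
        case False
        then have "0 < s" using h_nz by blast
        from has_bochner_integral_integral_eq[OF has_bochner_integral_theta(1)[OF this u(1) elim[symmetric]]]
        show ?thesis by simp
      qed simp
    qed
    have [measurable]: "h \<in> borel_measurable borel" using h by auto
    show "(\<lambda>s. h s * riesz_abel u s) \<in> borel_measurable lborel" unfolding riesz_abel_def by measurable
  qed (use F(4) in auto)
  also have "\<dots> = (LBINT v. indicator {0<..<u} v * (v powr (- 2 * a) * theta_transform v))"
    using F(5) unfolding pull by simp
  finally show "(LBINT s. h s * riesz_abel u s) = (LBINT v. indicator {0<..<u} v * (v powr (- 2 * a) * theta_transform v))" .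
qed

text \<open>The Abel-transformed equation identifies the integrals over \<open>(0,u)\<close> for every \<open>u \<le> T\<close>.\<close>

lemma first_inversion:
  "AE v in lborel. v \<in> {0<..<T} \<longrightarrow> k1 * abel_ratio * right_abel v + k2 * theta_transform v = rhs_const"
proof -
  define Phi where "Phi v = indicator {0<..<T} v * (v powr (- 2 * a) * (k1 * abel_ratio * right_abel v + k2 * theta_transform v - rhs_const))" for v
  let ?g = "\<lambda>u v. indicator {0<..<u} v * (v powr (- 2 * a) * right_abel v)"
  let ?t = "\<lambda>u v. indicator {0<..<u} v * (v powr (- 2 * a) * theta_transform v)"
  let ?p = "\<lambda>u v. indicator {0<..<u} v * v powr (- 2 * a)"
  have p: "has_bochner_integral lborel (?p u) (u powr (1 - 2 * a) / (1 - 2 * a))" if "0 < u" for u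
  proof -
    have "has_bochner_integral lborel (?p u) (u powr (1 - 2 * a) / (1 - 2 * a) - 0 powr (1 - 2 * a) / (1 - 2 * a))"
      by (rule has_bochner_integral_FTC_Ioo_nonneg[where F = "\<lambda>v. v powr (1 - 2 * a) / (1 - 2 * a)"])
         (use that a a2 in \<open>auto intro!: derivative_eq_intros continuous_intros continuous_on_powr'\<close>)
    then show ?thesis using a2 by simp
  qed
  have z: "has_bochner_integral lborel (\<lambda>v. indicator {0<..<u} v * Phi v) 0" if u: "0 < u" "u \<le> T" for u
  proof -
    have "has_bochner_integral lborel (\<lambda>v. (k1 * abel_ratio) * ?g u v + k2 * ?t u v - rhs_const * ?p u v)
       ((k1 * abel_ratio) * integral\<^sup>L lborel (?g u) + k2 * integral\<^sup>L lborel (?t u) - rhs_const * (u powr (1 - 2 * a) / (1 - 2 * a)))"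
      by (intro has_bochner_integral_add has_bochner_integral_diff has_bochner_integral_mult_right p u
          has_bochner_integral_integrable right_kernel_side theta_side)
    moreover have "(\<lambda>v. (k1 * abel_ratio) * ?g u v + k2 * ?t u v - rhs_const * ?p u v) = (\<lambda>v. indicator {0<..<u} v * Phi v)"
      using u by (auto simp: Phi_def indicator_def fun_eq_iff algebra_simps)
    moreover have "(k1 * abel_ratio) * integral\<^sup>L lborel (?g u) + k2 * integral\<^sup>L lborel (?t u) - rhs_const * (u powr (1 - 2 * a) / (1 - 2 * a)) = 0"
      using abel_transformed_equation[OF u] right_kernel_side(2)[OF u] theta_side(2)[OF u] a2 by (simp add: rhs_const_def mult_ac)
    ultimately show ?thesis by simp
  qed
  have PhiT: "indicator {0<..<T} v * Phi v = Phi v" for v by (auto simp: Phi_def indicator_def)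
  have I: "integrable lborel Phi" and I0: "integral\<^sup>L lborel Phi = 0"
    using z[OF T order.refl] unfolding PhiT by (auto simp: has_bochner_integral_iff)
  have "AE v in lborel. Phi v = 0"
  proof (rule AE_zero_if_tail_integrals_zero[OF I])
    fix x
    consider "x \<le> 0" | "T \<le> x" | "0 < x" "x < T" by linarith
    then show "(LBINT w. indicator {x<..} w * Phi w) = 0"
    proof cases
      case 1
      then have e: "indicator {x<..} w * Phi w = Phi w" for w by (auto simp: Phi_def indicator_def)
      show ?thesis unfolding e by (rule I0)
    next
      case 2
      then have e: "indicator {x<..} w * Phi w = 0" for w by (auto simp: Phi_def indicator_def)
      show ?thesis unfolding e by simp
    next
      case 3
      then have zx: "has_bochner_integral lborel (\<lambda>v. indicator {0<..<x} v * Phi v) 0" by (intro z) auto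
      have [measurable]: "Phi \<in> borel_measurable borel" using I by auto
      have "(LBINT w. indicator {x<..} w * Phi w) = (LBINT w. Phi w - indicator {0<..<x} w * Phi w)"
      proof (rule integral_cong_AE)
        show "AE w in lborel. indicator {x<..} w * Phi w = Phi w - indicator {0<..<x} w * Phi w"
          using AE_lborel_singleton[of x] by eventually_elim (auto simp: Phi_def indicator_def)
      qed measurable
      also have "\<dots> = 0"
        using zx I I0 by (subst Bochner_Integration.integral_diff) (auto simp: has_bochner_integral_iff)
      finally show ?thesis .
    qed
  qed
  then show ?thesis by eventually_elim (auto simp: Phi_def)
qed

text \<open>The statement is an integrated form of the claim: for every \<open>u\<close>, the integral over \<open>(u,T)\<close> vanishes.  The
exchange of integrals is justified separately for the three kernels that occur, and \<open>theta\<close> is traded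
for \<open>K\<close> after integration against \<open>(v - u) powr - a\<close>.\<close>

lemma second_inversion:
  assumes u: "0 < u" "u < T"
  shows "AE w in lborel. w \<in> {u<..<T} \<longrightarrow>
      integrable lborel (\<lambda>s. h s * K_kernel T (a + 1/2) (b + 1/2) w s)"
    and "has_bochner_integral lborel (\<lambda>w. indicator {u<..<T} w *
       (k1 * abel_ratio * Beta (1 - a) a * (w powr a * h w)
        + k2 * (w powr a * (LBINT s. h s * K_kernel T (a + 1/2) (b + 1/2) w s)) - rhs_const * (T - w) powr - a)) 0"
proof -
  have [measurable]: "h \<in> borel_measurable borel" using h by auto
  let ?K = "K_kernel T (a + 1/2) (b + 1/2)"
  obtain C where C: "density_bound u T C" using density_bound_exists[OF u(1) T] ..
  note TW = theta_weight[OF u C] and KK = has_bochner_integral_K_kernel[OF u C]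
  let ?E = "C * edge_const T"
  \<comment> \<open>The kernels \<open>kg\<close> and \<open>kt\<close> belong to the two terms of the first inversion, while \<open>kk\<close> is a
    jointly measurable version of \<open>w powr a * K w s\<close>.\<close>
  let ?kg = "\<lambda>v s. indicator {u<..<T} v * ((v - u) powr - a * rk v s)"
  let ?kt = "\<lambda>v s. indicator {u<..<T} v * theta a b v s * (v - u) powr - a"
  define kk where "kk w s = (if 0 < s \<and> s < T \<and> u < w \<and> w < T then
       (if s < w then marchaud a T (\<lambda>t. theta a b t s) w
        else if w < s then marchaud a s (\<lambda>t. theta a b t s) w
          - (LBINT t. (if s < t \<and> t < T then a * (t - w) powr (- a - 1) * theta a b t s else 0)) else 0) else 0)" for w s
  have kk_eq: "kk w s = indicator {u<..<T} w * (w powr a * ?K w s)" if "0 < s" "s < T" for w s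
  proof -
    have "(LBINT t:{s<..<T}. a * (t - w) powr (- a - 1) * theta a b t s) = (LBINT t. (if s < t \<and> t < T then a * (t - w) powr (- a - 1) * theta a b t s else 0))"
      unfolding set_lebesgue_integral_def by (rule Bochner_Integration.integral_cong) (auto simp: indicator_def)
    then show ?thesis
      using K_minus_eq[of s w T] K_plus_eq[of w s T] that u unfolding kk_def by (auto simp: K_kernel_def)
  qed
  have hkk: "h s * kk w s = indicator {u<..<T} w * (w powr a * (h s * ?K w s))" for w s
    using kk_eq[of s w] h_nz[of s] by (cases "h s = 0") auto
  have mk: "case_prod kk \<in> borel_measurable (lborel \<Otimes>\<^sub>M lborel)"
    unfolding kk_def[abs_def] using marchaud_theta_measurable[measurable] by measurable
  have bk: "column_bound h kk u (14 * ?E)"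
    using KK h_nz kk_eq by (auto simp: has_bochner_integral_iff)
  note FK = kernel_fubini[OF h mk bk]
  have pullK: "(LBINT s. h s * kk w s) = indicator {u<..<T} w * (w powr a * (LBINT s. h s * ?K w s))" for w
    unfolding hkk by simp
  show "AE w in lborel. w \<in> {u<..<T} \<longrightarrow> integrable lborel (\<lambda>s. h s * ?K w s)"
    using FK(2)
  proof eventually_elim
    case (elim w)
    show ?case
    proof
      assume w: "w \<in> {u<..<T}"
      have "integrable lborel (\<lambda>s. w powr - a * (h s * kk w s))" using elim by (rule integrable_mult_right)
      moreover have "w powr - a * (h s * kk w s) = h s * ?K w s" for s
      proof -
        have "w powr - a * (h s * kk w s) = (w powr - a * w powr a) * (h s * ?K w s)" using w by (simp add: hkk)
        also have "w powr - a * w powr a = 1" using w u by (simp add: powr_minus)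
        finally show ?thesis by simp
      qed
      ultimately show "integrable lborel (\<lambda>s. h s * ?K w s)" by simp
    qed
  qed
  have bt: "column_bound h ?kt u (3 * ?E)" using TW h_nz by auto
  have mt: "case_prod ?kt \<in> borel_measurable (lborel \<Otimes>\<^sub>M lborel)" by measurable
  note FT = kernel_fubini[OF h mt bt]
  have pullT: "(LBINT s. h s * ?kt v s) = indicator {u<..<T} v * (v - u) powr - a * theta_transform v" for v
    unfolding theta_transform_def by (subst integral_mult_right_zero[symmetric]) (simp add: mult_ac)
  have theta_to_K: "(LBINT s. h s * (LBINT v. ?kt v s)) = (LBINT s. h s * (LBINT w. kk w s))"
  proof (rule integral_cong_AE)
    show "AE s in lborel. h s * (LBINT v. ?kt v s) = h s * (LBINT w. kk w s)"
      using AE_lborel_singleton[of u]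
    proof eventually_elim
      case (elim s)
      show ?case
      proof (cases "h s = 0")
        case False
        then have s: "0 < s" "s < T" using h_nz by auto
        show ?thesis using has_bochner_integral_integral_eq[OF KK(1)[OF s elim]] kk_eq[OF s] by simp
      qed simp
    qed
  qed (use FT(4) FK(4) in auto)
  have kg: "has_bochner_integral lborel (\<lambda>v. ?kg v s) (indicator {u<..<T} s * (Beta (1 - a) a * s powr a))" if "s < T" for s
  proof (cases "u < s")
    case True
    have "has_bochner_integral lborel (\<lambda>v. s powr a * (indicator {u<..<s} v * ((v - u) powr (1 - a - 1) * (s - v) powr (a - 1)))) (s powr a * ((s - u) powr (1 - a + a - 1) * Beta (1 - a) a))"
      by (intro has_bochner_integral_mult_right has_bochner_integral_beta) (use True a a2 in auto)
    moreover have "(\<lambda>v. s powr a * (indicator {u<..<s} v * ((v - u) powr (1 - a - 1) * (s - v) powr (a - 1)))) = (\<lambda>v. ?kg v s)"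
      using that u True by (auto simp: fun_eq_iff right_kernel_def indicator_def)
    ultimately show ?thesis using True that by (simp add: mult.commute)
  next
    case False
    then have "(\<lambda>v. ?kg v s) = (\<lambda>_. 0)" by (auto simp: fun_eq_iff right_kernel_def indicator_def)
    then show ?thesis using False by (simp add: has_bochner_integral_iff)
  qed
  have mg: "case_prod ?kg \<in> borel_measurable (lborel \<Otimes>\<^sub>M lborel)"
    by measurable
  have bg: "column_bound h ?kg u (Beta (1 - a) a * T powr a)"
  proof (intro allI impI conjI; elim conjE)
    fix s assume "h s \<noteq> 0"
    then have s: "0 < s" "s < T" using h_nz by auto
    have B: "Beta (1 - a) a > 0" using a a2 by (auto intro!: Beta_pos)
    show "integrable lborel (\<lambda>v. ?kg v s)" using kg[OF s(2)] by (simp add: has_bochner_integral_iff)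
    have ab: "\<bar>?kg v s\<bar> = ?kg v s" for v by (simp add: right_kernel_nonneg)
    have "s powr a \<le> T powr a" using s a by (intro powr_mono2) auto
    then have "indicator {u<..<T} s * (Beta (1 - a) a * s powr a) \<le> Beta (1 - a) a * T powr a"
      using B by (auto simp: indicator_def)
    then show "(LBINT v. \<bar>?kg v s\<bar>) \<le> Beta (1 - a) a * T powr a"
      unfolding ab has_bochner_integral_integral_eq[OF kg[OF s(2)]] .
  qed
  note FG = kernel_fubini[OF h mg bg]
  have pullG: "(LBINT s. h s * ?kg v s) = indicator {u<..<T} v * (v - u) powr - a * right_abel v" for v
    unfolding right_abel_def by (subst integral_mult_right_zero[symmetric]) (simp add: mult_ac)
  have hg: "h s * (LBINT v. ?kg v s) = Beta (1 - a) a * (indicator {u<..<T} s * (s powr a * h s))" for s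
  proof (cases "h s = 0")
    case False
    then have "s < T" using h_nz by auto
    from has_bochner_integral_integral_eq[OF kg[OF this]] show ?thesis by simp
  qed simp
  have p1: "has_bochner_integral lborel (\<lambda>v. indicator {u<..<T} v * (v - u) powr - a) ((T - u) powr (1 - a) / (1 - a))"
  proof -
    have "has_bochner_integral lborel (\<lambda>v. indicator {u<..<T} v * (v - u) powr - a) ((T - u) powr (1 - a) / (1 - a) - (u - u) powr (1 - a) / (1 - a))"
      by (rule has_bochner_integral_FTC_Ioo_nonneg[where F = "\<lambda>v. (v - u) powr (1 - a) / (1 - a)"])
         (use u a a2 in \<open>auto intro!: derivative_eq_intros continuous_intros continuous_on_powr'\<close>)
    then show ?thesis using a2 by simp
  qed
  have p2: "has_bochner_integral lborel (\<lambda>w. indicator {u<..<T} w * (T - w) powr - a) ((T - u) powr (1 - a) / (1 - a))"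
  proof -
    have "has_bochner_integral lborel (\<lambda>w. indicator {u<..<T} w * (T - w) powr - a) (- ((T - T) powr (1 - a) / (1 - a)) - - ((T - u) powr (1 - a) / (1 - a)))"
      by (rule has_bochner_integral_FTC_Ioo_nonneg[where F = "\<lambda>w. - ((T - w) powr (1 - a) / (1 - a))"])
         (use u a a2 in \<open>auto intro!: derivative_eq_intros continuous_intros continuous_on_powr'\<close>)
    then show ?thesis using a2 by simp
  qed
  let ?L = "\<lambda>v. indicator {u<..<T} v * (v - u) powr - a"
  have IG: "integrable lborel (\<lambda>v. ?L v * right_abel v)" and IT: "integrable lborel (\<lambda>v. ?L v * theta_transform v)"
    using FG(3) FT(3) unfolding pullG pullT by auto
  have "k1 * abel_ratio * integral\<^sup>L lborel (\<lambda>v. ?L v * right_abel v) + k2 * integral\<^sup>L lborel (\<lambda>v. ?L v * theta_transform v)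
     = (LBINT v. k1 * abel_ratio * (?L v * right_abel v) + k2 * (?L v * theta_transform v))"
    using IG IT by (subst Bochner_Integration.integral_add) auto
  also have "\<dots> = (LBINT v. rhs_const * ?L v)"
  proof (rule integral_cong_AE)
    show "AE v in lborel. k1 * abel_ratio * (?L v * right_abel v) + k2 * (?L v * theta_transform v) = rhs_const * ?L v"
      using first_inversion
    proof eventually_elim
      case (elim v)
      have "k1 * abel_ratio * (?L v * right_abel v) + k2 * (?L v * theta_transform v) = ?L v * (k1 * abel_ratio * right_abel v + k2 * theta_transform v)" by (simp add: algebra_simps)
      then show ?case using elim u by (cases "v \<in> {u<..<T}") auto
    qed
  qed (use IG IT in auto)
  also have "\<dots> = rhs_const * ((T - u) powr (1 - a) / (1 - a))"
    using has_bochner_integral_integral_eq[OF p1] by simp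
  finally have main: "k1 * abel_ratio * integral\<^sup>L lborel (\<lambda>v. ?L v * right_abel v) + k2 * integral\<^sup>L lborel (\<lambda>v. ?L v * theta_transform v) = rhs_const * ((T - u) powr (1 - a) / (1 - a))" .
  let ?H = "\<lambda>w. indicator {u<..<T} w * (w powr a * h w)"
  let ?KK = "\<lambda>w. indicator {u<..<T} w * (w powr a * (LBINT s. h s * ?K w s))"
  have Bp: "Beta (1 - a) a > 0" using a a2 by (auto intro!: Beta_pos)
  have GH: "integral\<^sup>L lborel (\<lambda>v. ?L v * right_abel v) = Beta (1 - a) a * integral\<^sup>L lborel ?H"
    using FG(5) unfolding pullG hg by simp
  have IH: "integrable lborel ?H"
    using FG(4) Bp unfolding hg by simp
  have TK: "integral\<^sup>L lborel (\<lambda>v. ?L v * theta_transform v) = integral\<^sup>L lborel ?KK"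
    using FT(5) FK(5) theta_to_K unfolding pullT pullK by simp
  have IK: "integrable lborel ?KK" using FK(3) unfolding pullK .
  have "has_bochner_integral lborel (\<lambda>w. (k1 * abel_ratio * Beta (1 - a) a) * ?H w + k2 * ?KK w - rhs_const * (indicator {u<..<T} w * (T - w) powr - a))
    ((k1 * abel_ratio * Beta (1 - a) a) * integral\<^sup>L lborel ?H + k2 * integral\<^sup>L lborel ?KK - rhs_const * ((T - u) powr (1 - a) / (1 - a)))"
    by (intro has_bochner_integral_add has_bochner_integral_diff has_bochner_integral_mult_right p2 has_bochner_integral_integrable IH IK)
  moreover have "(k1 * abel_ratio * Beta (1 - a) a) * integral\<^sup>L lborel ?H + k2 * integral\<^sup>L lborel ?KK - rhs_const * ((T - u) powr (1 - a) / (1 - a)) = 0"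
    using main unfolding GH TK by (simp add: mult_ac)
  moreover have "(\<lambda>w. (k1 * abel_ratio * Beta (1 - a) a) * ?H w + k2 * ?KK w - rhs_const * (indicator {u<..<T} w * (T - w) powr - a))
    = (\<lambda>w. indicator {u<..<T} w * (k1 * abel_ratio * Beta (1 - a) a * (w powr a * h w) + k2 * (w powr a * (LBINT s. h s * ?K w s)) - rhs_const * (T - w) powr - a))"
    by (simp add: algebra_simps)
  ultimately show "has_bochner_integral lborel (\<lambda>w. indicator {u<..<T} w *
       (k1 * abel_ratio * Beta (1 - a) a * (w powr a * h w) + k2 * (w powr a * (LBINT s. h s * ?K w s)) - rhs_const * (T - w) powr - a)) 0"
    by simp
qed

text \<open>The bounds of the second inversion hold on \<open>(u,T)\<close> for each \<open>u > 0\<close> only, so \<open>(0,T)\<close> is exhausted by a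
sequence of such intervals.\<close>

lemma fredholm_equation:
  "AE w in lborel. w \<in> {0<..<T} \<longrightarrow>
      integrable lborel (\<lambda>s. h s * K_kernel T (a + 1/2) (b + 1/2) w s) \<and>
      k1 * abel_ratio * Beta (1 - a) a * h w + k2 * (LBINT s. h s * K_kernel T (a + 1/2) (b + 1/2) w s)
        = rhs_const * (w powr - a * (T - w) powr - a)"
proof -
  let ?K = "K_kernel T (a + 1/2) (b + 1/2)"
  define P where "P w = k1 * abel_ratio * Beta (1 - a) a * (w powr a * h w)
        + k2 * (w powr a * (LBINT s. h s * ?K w s)) - rhs_const * (T - w) powr - a" for w
  have local: "AE w in lborel. w \<in> {u<..<T} \<longrightarrow> integrable lborel (\<lambda>s. h s * ?K w s) \<and> P w = 0"
    if u: "0 < u" "u < T" for u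
  proof -
    note S = second_inversion(2)[OF u, folded P_def]
    have I: "integrable lborel (\<lambda>w. indicator {u<..<T} w * P w)" using S by (simp add: has_bochner_integral_iff)
    have "AE w in lborel. indicator {u<..<T} w * P w = 0"
    proof (rule AE_zero_if_tail_integrals_zero[OF I])
      fix x
      consider "x \<le> u" | "T \<le> x" | "u < x" "x < T" by linarith
      then show "(LBINT w. indicator {x<..} w * (indicator {u<..<T} w * P w)) = 0"
      proof cases
        case 1
        then have e: "indicator {x<..} w * (indicator {u<..<T} w * P w) = indicator {u<..<T} w * P w" for w
          by (auto simp: indicator_def)
        show ?thesis unfolding e using S by (simp add: has_bochner_integral_iff)
      next
        case 2
        then have e: "indicator {x<..} w * (indicator {u<..<T} w * P w) = 0" for w
          by (auto simp: indicator_def)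
        show ?thesis unfolding e by simp
      next
        case 3
        then have e: "indicator {x<..} w * (indicator {u<..<T} w * P w) = indicator {x<..<T} w * P w" for w
          by (auto simp: indicator_def)
        show ?thesis
          unfolding e using second_inversion(2)[of x, folded P_def] u 3 by (simp add: has_bochner_integral_iff)
      qed
    qed
    with second_inversion(1)[OF u] show ?thesis
      by eventually_elim (auto simp: indicator_def)
  qed
  have "AE w in lborel. \<forall>n. w \<in> {T / real (n + 2)<..<T} \<longrightarrow> integrable lborel (\<lambda>s. h s * ?K w s) \<and> P w = 0"
    unfolding AE_all_countable
  proof
    fix n
    have "T / real (n + 2) < T / 1" using T by (intro divide_strict_left_mono) auto
    then have "0 < T / real (n + 2)" "T / real (n + 2) < T" using T by auto
    then show "AE w in lborel. w \<in> {T / real (n + 2)<..<T} \<longrightarrow> integrable lborel (\<lambda>s. h s * ?K w s) \<and> P w = 0"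
      by (rule local)
  qed
  then show ?thesis
  proof eventually_elim
    case (elim w)
    show ?case
    proof
      assume w: "w \<in> {0<..<T}"
      obtain n where n: "T / w < real n" using reals_Archimedean2 by blast
      have "T < real n * w" using n w by (simp add: field_simps)
      also have "\<dots> \<le> real (n + 2) * w" using w by (intro mult_right_mono) auto
      finally have "T / real (n + 2) < w" by (simp add: pos_divide_less_eq mult.commute)
      then have I: "integrable lborel (\<lambda>s. h s * ?K w s)" and P: "P w = 0" using elim w by auto
      have inv: "w powr - a * w powr a = 1" using w by (simp add: powr_minus)
      have "k1 * abel_ratio * Beta (1 - a) a * h w + k2 * (LBINT s. h s * ?K w s) - rhs_const * (w powr - a * (T - w) powr - a)
        = k1 * abel_ratio * Beta (1 - a) a * ((w powr - a * w powr a) * h w) + k2 * ((w powr - a * w powr a) * (LBINT s. h s * ?K w s)) - rhs_const * (w powr - a * (T - w) powr - a)"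
        unfolding inv by simp
      also have "\<dots> = w powr - a * P w" unfolding P_def by (simp add: algebra_simps)
      finally show "integrable lborel (\<lambda>s. h s * ?K w s) \<and> k1 * abel_ratio * Beta (1 - a) a * h w + k2 * (LBINT s. h s * ?K w s)
        = rhs_const * (w powr - a * (T - w) powr - a)" using I P by simp
    qed
  qed
qed

end

section \<open>Constants and conclusion\<close>

lemma Gamma_reflection_real:
  fixes x :: real
  shows "Gamma x * Gamma (1 - x) = pi / sin (pi * x)"
proof -
  have "complex_of_real (Gamma x * Gamma (1 - x)) = Gamma (complex_of_real x) * Gamma (complex_of_real (1 - x))"
    by (simp only: of_real_mult Gamma_complex_of_real)
  also have "\<dots> = of_real pi / sin (of_real pi * complex_of_real x)"
    unfolding of_real_diff of_real_1 by (rule Gamma_reflection_complex)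
  also have "\<dots> = complex_of_real (pi / sin (pi * x))"
    by (simp only: of_real_mult[symmetric] sin_of_real of_real_divide)
  finally show ?thesis by (simp only: of_real_eq_iff)
qed

text \<open>The two inversions produce beta functions; the reflection formula turns them into the stated constants.\<close>

lemma Fredholm_constants:
  fixes a b T :: real
  assumes a: "0 < a" "a < 1/2"
  defines "k1 \<equiv> (a + 1/2) * (2 * (a + 1/2) - 1)" and "k2 \<equiv> (b + 1/2) * (2 * (b + 1/2) - 1)"
    and "D \<equiv> (a + 1/2) * (2 * (a + 1/2) - 1) * (Beta (1 - a) a / Beta (1 - 2 * a) a) * Beta (1 - a) a"
  shows "D > 0" and "c_const (a + 1/2) (b + 1/2) = k2 / D"
    and "(1 - 2 * a) * Beta (1 - a) (1 - a) * (u powr - a * (T - u) powr - a) / D = g_fun T (a + 1/2) u"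
proof -
  have pos: "Gamma a > 0" "Gamma (1 - a) > 0" "Gamma (1 - 2 * a) > 0"
    using a by (auto intro!: Gamma_real_pos)
  have B1: "Beta (1 - a) a = Gamma a * Gamma (1 - a)" by (simp add: Beta_def)
  have B2: "Beta (1 - 2 * a) a = Gamma (1 - 2 * a) * Gamma a / Gamma (1 - a)" by (simp add: Beta_def)
  have D: "D = k1 * Gamma a * Gamma (1 - a) ^ 3 / Gamma (1 - 2 * a)"
    unfolding D_def k1_def[symmetric] B1 B2 using pos by (simp add: field_simps power3_eq_cube)
  have k1: "k1 > 0" unfolding k1_def using a by (intro mult_pos_pos) auto
  show "D > 0" unfolding D using pos k1 by simp
  have sin: "sin (pi * a) > 0" using a by (intro sin_gt_zero) (auto simp: field_simps)
  have "cos (pi * (1 - (a + 1/2))) = sin (pi * a)"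
    by (simp add: algebra_simps sin_cos_eq[of "pi * a"])
  then have "c_const (a + 1/2) (b + 1/2) = Gamma (1 - 2 * a) * sin (pi * a) * k2 / (pi * k1 * Gamma (1 - a) ^ 2)"
    unfolding c_const_def k1_def k2_def by (simp add: algebra_simps)
  also have "\<dots> = Gamma (1 - 2 * a) * k2 / (k1 * Gamma (1 - a) ^ 2 * (pi / sin (pi * a)))"
    using sin by (simp add: mult_ac)
  also have "\<dots> = k2 / D"
    using Gamma_reflection_real[of a] unfolding D by (simp add: power2_eq_square power3_eq_cube mult_ac)
  finally show "c_const (a + 1/2) (b + 1/2) = k2 / D" .
  have "Gamma (2 - 2 * a) = (1 - 2 * a) * Gamma (1 - 2 * a)"
  proof -
    have "1 - 2 * a \<notin> \<int>\<^sub>\<le>\<^sub>0" using a by (auto elim!: nonpos_Ints_cases)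
    from Gamma_plus1[OF this] show ?thesis by (simp add: algebra_simps)
  qed
  then have A: "(1 - 2 * a) * Beta (1 - a) (1 - a) = Gamma (1 - a) ^ 2 / Gamma (1 - 2 * a)"
    using a by (simp add: Beta_def power2_eq_square)
  have "a \<notin> \<int>\<^sub>\<le>\<^sub>0" using a by (auto elim!: nonpos_Ints_cases)
  then have "Gamma (a + 1) = a * Gamma a" by (rule Gamma_plus1)
  then have B: "Beta (1 - a) (a + 1) = a * Gamma a * Gamma (1 - a)"
    using Gamma_fact[of 1, where 'a = real] by (simp add: Beta_def numeral_2_eq_2)
  have "(1 - 2 * a) * Beta (1 - a) (1 - a) / D = 1 / (k1 * Gamma a * Gamma (1 - a))"
    unfolding A D using pos k1 by (simp add: field_simps power2_eq_square power3_eq_cube)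
  also have "k1 * Gamma a * Gamma (1 - a) = 2 * (a + 1/2) * Beta (1 - a) (a + 1)"
    unfolding B k1_def by (simp add: algebra_simps)
  finally have E: "(1 - 2 * a) * Beta (1 - a) (1 - a) / D = 1 / (2 * (a + 1/2) * Beta (1 - a) (a + 1))" .
  have "(1 - 2 * a) * Beta (1 - a) (1 - a) * x / D = x / (2 * (a + 1/2) * Beta (1 - a) (a + 1))" for x
  proof -
    have "(1 - 2 * a) * Beta (1 - a) (1 - a) * x / D = (1 - 2 * a) * Beta (1 - a) (1 - a) / D * x" by simp
    then show ?thesis unfolding E by simp
  qed
  moreover have "3/2 - (a + 1/2) = 1 - a" "a + 1/2 + 1/2 = a + 1" "1/2 - (a + 1/2) = - a" by simp_all
  ultimately show "(1 - 2 * a) * Beta (1 - a) (1 - a) * (u powr - a * (T - u) powr - a) / D = g_fun T (a + 1/2) u"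
    unfolding g_fun_def by (simp only:)
qed

lemma in_L2_imp_integrable:
  assumes "in_L2 T f"
  shows "set_integrable lborel {0<..<T} f"
proof -
  have m: "set_borel_measurable lborel {0<..<T} f" and sq: "set_integrable lborel {0<..<T} (\<lambda>t. (f t)\<^sup>2)"
    using assms by (auto simp: in_L2_def)
  have "set_integrable lborel {0<..<T} (\<lambda>t. 1 + (f t)\<^sup>2)"
  proof (intro set_integral_add sq)
    have "integrable lborel (indicat_real {0<..<T})"
      by (cases "0 \<le> T") (auto intro: integrable_real_indicator)
    then show "set_integrable lborel {0<..<T} (\<lambda>t. 1 :: real)" by (simp add: set_integrable_def)
  qed
  then show ?thesis unfolding set_integrable_def
  proof (rule Bochner_Integration.integrable_bound)
    show "(\<lambda>x. indicat_real {0<..<T} x *\<^sub>R f x) \<in> borel_measurable lborel"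
      using m by (simp add: set_borel_measurable_def)
    have "\<bar>x\<bar> \<le> 1 + x\<^sup>2" for x :: real
      using zero_le_power2[of "\<bar>x\<bar> - 1/2"] by (simp add: power2_eq_square algebra_simps abs_if split: if_splits)
    then show "AE x in lborel. norm (indicat_real {0<..<T} x *\<^sub>R f x) \<le> norm (indicat_real {0<..<T} x *\<^sub>R (1 + (f x)\<^sup>2))"
      by (intro AE_I2) (auto simp: indicator_def)
  qed
qed

theorem theorem3p1:
  fixes T H1 H2 :: real and h :: "real \<Rightarrow> real"
  assumes "T > 0"
    and "1/2 < H1" and "H1 \<le> 3/4"
    and "H1 < H2" and "H2 < 1"
    and "is_solution T H1 H2 h"
  shows "AE u in lborel. u \<in> {0<..<T} \<longrightarrow>
    set_integrable lborel {0<..<T} (\<lambda>s. h s * K_kernel T H1 H2 u s) \<and>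
    h u + c_const H1 H2 * (LBINT s:{0<..<T}. h s * K_kernel T H1 H2 u s) = g_fun T H1 u"
proof -
  define a b where "a = H1 - 1/2" and "b = H2 - 1/2"
  have H: "H1 = a + 1/2" "H2 = b + 1/2" by (simp_all add: a_def b_def)
  have ex: "0 < a" "a < b" "b < 1/2" "a < 1/2" using assms by (auto simp: a_def b_def)
  define f where "f s = indicator {0<..<T} s * h s" for s
  define k1 k2 where "k1 = H1 * (2 * H1 - 1)" and "k2 = H2 * (2 * H2 - 1)"
  have riesz: "Gamma_op T (c + 1/2) h t = (c + 1/2) * (2 * (c + 1/2) - 1) * (LBINT s. f s * \<bar>t - s\<bar> powr (2 * c - 1))" for c t
  proof -
    have "x / y powr (2 - 2 * (c + 1/2)) = x * y powr (2 * c - 1)" for x y :: real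
      using powr_minus_divide[of y "2 - 2 * (c + 1/2)"] by simp
    then show ?thesis unfolding Gamma_op_def set_lebesgue_integral_def f_def by (simp add: mult.assoc)
  qed
  interpret mixed_equation a b T k1 k2 f
  proof
    show "integrable lborel f"
      using in_L2_imp_integrable[of T h] assms unfolding is_solution_def set_integrable_def f_def by simp
    have "AE t in lborel. t \<in> {0<..<T} \<longrightarrow> Gamma_op T H1 h t + Gamma_op T H2 h t = indicator {0..T} t"
      using assms by (simp add: is_solution_def)
    then show "AE t in lborel. t \<in> {0<..<T} \<longrightarrow>
      k1 * (LBINT s. f s * \<bar>t - s\<bar> powr (2 * a - 1)) + k2 * (LBINT s. f s * \<bar>t - s\<bar> powr (2 * b - 1)) = 1"
      by eventually_elim (auto simp: H riesz k1_def k2_def)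
  qed (use ex assms in \<open>auto simp: f_def\<close>)
  define D where "D = k1 * abel_ratio * Beta (1 - a) a"
  note const = Fredholm_constants(1)[OF ex(1,4), folded H, folded k1_def abel_ratio_def, folded D_def]
    Fredholm_constants(2)[OF ex(1,4), of b, folded H, folded k1_def k2_def abel_ratio_def, folded D_def]
    Fredholm_constants(3)[OF ex(1,4), folded H, folded k1_def abel_ratio_def, folded D_def]
  have fK: "indicator {0<..<T} s *\<^sub>R (h s * K_kernel T H1 H2 u s) = f s * K_kernel T H1 H2 u s" for s u
    by (simp add: f_def)
  show ?thesis
    using fredholm_equation
  proof eventually_elim
    case (elim u)
    show ?case
    proof (rule impI, rule conjI)
      assume u: "u \<in> {0<..<T}"
      show "set_integrable lborel {0<..<T} (\<lambda>s. h s * K_kernel T H1 H2 u s)"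
        unfolding set_integrable_def fK using elim u by (simp add: H)
      have "D * h u + k2 * (LBINT s:{0<..<T}. h s * K_kernel T H1 H2 u s) = rhs_const * (u powr - a * (T - u) powr - a)"
        unfolding set_lebesgue_integral_def fK using elim u by (simp add: H D_def f_def)
      then have "h u + k2 / D * (LBINT s:{0<..<T}. h s * K_kernel T H1 H2 u s) = rhs_const * (u powr - a * (T - u) powr - a) / D"
        using const(1) by (simp add: field_simps)
      then show "h u + c_const H1 H2 * (LBINT s:{0<..<T}. h s * K_kernel T H1 H2 u s) = g_fun T H1 u"
        unfolding const(2) const(3)[symmetric] rhs_const_def .
    qed
  qed
qed

end
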